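(* Consider the problem of minimizing $\tilde J(y,a):=\frac12\|y-y_d\|_{L^2(\Omega)}^2+\int_\Omega g(a(x))\,dx$ over $a\in\mathcal A$ with $a(x)\in\mathcal M\cap\operatorname{span}(I_d)$ for a.a. $x$ (identify $a$ with a scalar function $a\ge\alpha$), where $y\in H^1_0(\Omega)$ solves $\int_\Omega a\nabla y\cdot\nabla v=\int_\Omega fv$ for all $v\in H^1_0(\Omega)$. Let $a$ be a local solution with respect to the $L^1(\Omega)$-norm, with state $y$ and adjoint $p$. Then for almost all $x_0\in\Omega$ and all $b\ge\alpha$, \[ -(b-a(x_0))\nabla y(x_0)\cdot\nabla p(x_0)\,\frac{a(x_0)\,d}{b+a(x_0)(d-1)}+g(b)-g(a(x_0))\ge0. \]
   Context: $\Omega\subset\mathbb R^d$ bounded domain, $\alpha>0$, $y_d,f\in L^2(\Omega)$; $\mathcal M:=\{A\in\mathbb R^{d\times d}:\xi^TA\xi\ge\alpha|\xi|^2\ \forall\xi\}$, $\mathcal A:=\{a\in L^\infty(\Omega;\mathbb R^{d\times d}):a(x)\in\mathcal M\text{ a.e.}\}$. $g$ is lower semicontinuous with values in $\mathbb R\cup\{+\infty\}$ (evaluated at scalars $b$ identified with $bI_d$). The adjoint $p\in H^1_0(\Omega)$ solves $\int_\Omega a\nabla v\cdot\nabla p=\int_\Omega(y-y_d)v$ for all $v\in H^1_0(\Omega)$. "Local solution w.r.t. the $L^1$-norm": there is $\varepsilon>0$ such that $\tilde J(y,a)\le\tilde J(\hat y,\hat a)$ for all feasible $\hat a$ with $\|\hat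 a-a\|_{L^1(\Omega)}<\varepsilon$.
   Formalization: The local solution a is additionally assumed to have finite cost J̃(y,a) < +∞; without this the claim fails, e.g. for g(α)=0, g=+∞ elsewhere and a≡α+1, where every L¹-close competitor has infinite cost. *)

theory Defs
  imports "HOL-Analysis.Analysis"
begin

definition pd :: "'n::finite \<Rightarrow> (real^'n \<Rightarrow> real) \<Rightarrow> real^'n \<Rightarrow> real" where
  "pd i \<phi> x = frechet_derivative \<phi> (at x) (axis i 1)"

definition grad :: "(real^'n::finite \<Rightarrow> real) \<Rightarrow> real^'n \<Rightarrow> real^'n" where
  "grad \<phi> x = (\<chi> i. pd i \<phi> x)"

fun Ck :: "nat \<Rightarrow> (real^'n::finite \<Rightarrow> real) \<Rightarrow> bool" where
  "Ck 0 \<phi> = continuous_on UNIV \<phi>"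
| "Ck (Suc k) \<phi> = (\<phi> differentiable_on UNIV \<and> continuous_on UNIV \<phi> \<and> (\<forall>i. Ck k (pd i \<phi>)))"

definition smooth :: "(real^'n::finite \<Rightarrow> real) \<Rightarrow> bool" where
  "smooth \<phi> = (\<forall>k. Ck k \<phi>)"

definition test_fun :: "(real^'n::finite) set \<Rightarrow> (real^'n \<Rightarrow> real) \<Rightarrow> bool" where
  "test_fun \<Omega> \<phi> = (smooth \<phi> \<and> compact (closure {x. \<phi> x \<noteq> 0}) \<and> closure {x. \<phi> x \<noteq> 0} \<subseteq> \<Omega>)"

definition L2 :: "(real^'n::finite) set \<Rightarrow> (real^'n \<Rightarrow> real) \<Rightarrow> bool" where
  "L2 \<Omega> f = (f \<in> borel_measurable (lebesgue_on \<Omega>) \<and> integrable (lebesgue_on \<Omega>) (\<lambda>x. (f x)\<^sup>2))"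

definition L2v :: "(real^'n::finite) set \<Rightarrow> (real^'n \<Rightarrow> real^'n) \<Rightarrow> bool" where
  "L2v \<Omega> G = (G \<in> borel_measurable (lebesgue_on \<Omega>) \<and> integrable (lebesgue_on \<Omega>) (\<lambda>x. (norm (G x))\<^sup>2))"

definition Linf :: "(real^'n::finite) set \<Rightarrow> (real^'n \<Rightarrow> real) \<Rightarrow> bool" where
  "Linf \<Omega> f = (f \<in> borel_measurable (lebesgue_on \<Omega>) \<and> (\<exists>C. AE x in lebesgue_on \<Omega>. \<bar>f x\<bar> \<le> C))"

text \<open>H10 Omega y G: y belongs to H^1_0(Omega) (closure of C_c^infinity(Omega) in the H^1 norm)
  and G is its (weak) gradient.\<close>
definition H10 :: "(real^'n::finite) set \<Rightarrow> (real^'n \<Rightarrow> real) \<Rightarrow> (real^'n \<Rightarrow> real^'n) \<Rightarrow> bool" where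
  "H10 \<Omega> y G = (L2 \<Omega> y \<and> L2v \<Omega> G \<and>
     (\<exists>\<phi> :: nat \<Rightarrow> real^'n \<Rightarrow> real. (\<forall>n. test_fun \<Omega> (\<phi> n)) \<and>
        (\<lambda>n. integral\<^sup>L (lebesgue_on \<Omega>) (\<lambda>x. (\<phi> n x - y x)\<^sup>2)) \<longlonglongrightarrow> 0 \<and>
        (\<lambda>n. integral\<^sup>L (lebesgue_on \<Omega>) (\<lambda>x. (norm (grad (\<phi> n) x - G x))\<^sup>2)) \<longlonglongrightarrow> 0))"

definition state_eq :: "(real^'n::finite) set \<Rightarrow> (real^'n \<Rightarrow> real) \<Rightarrow> (real^'n \<Rightarrow> real)
     \<Rightarrow> (real^'n \<Rightarrow> real) \<Rightarrow> (real^'n \<Rightarrow> real^'n) \<Rightarrow> bool" where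
  "state_eq \<Omega> f a y Gy = (H10 \<Omega> y Gy \<and>
     (\<forall>v Gv. H10 \<Omega> v Gv \<longrightarrow>
        integral\<^sup>L (lebesgue_on \<Omega>) (\<lambda>x. a x * (Gy x \<bullet> Gv x)) = integral\<^sup>L (lebesgue_on \<Omega>) (\<lambda>x. f x * v x)))"

definition adjoint_eq :: "(real^'n::finite) set \<Rightarrow> (real^'n \<Rightarrow> real) \<Rightarrow> (real^'n \<Rightarrow> real)
     \<Rightarrow> (real^'n \<Rightarrow> real) \<Rightarrow> (real^'n \<Rightarrow> real) \<Rightarrow> (real^'n \<Rightarrow> real^'n) \<Rightarrow> bool" where
  "adjoint_eq \<Omega> yd a y p Gp = (H10 \<Omega> p Gp \<and>
     (\<forall>v Gv. H10 \<Omega> v Gv \<longrightarrow>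
        integral\<^sup>L (lebesgue_on \<Omega>) (\<lambda>x. a x * (Gv x \<bullet> Gp x)) = integral\<^sup>L (lebesgue_on \<Omega>) (\<lambda>x. (y x - yd x) * v x)))"

definition eint :: "'a measure \<Rightarrow> ('a \<Rightarrow> ereal) \<Rightarrow> ereal" where
  "eint M h = enn2ereal (\<integral>\<^sup>+x. e2ennreal (max 0 (h x)) \<partial>M) - enn2ereal (\<integral>\<^sup>+x. e2ennreal (max 0 (- h x)) \<partial>M)"

definition Jt :: "(real^'n::finite) set \<Rightarrow> (real^'n \<Rightarrow> real) \<Rightarrow> (real \<Rightarrow> ereal)
     \<Rightarrow> (real^'n \<Rightarrow> real) \<Rightarrow> (real^'n \<Rightarrow> real) \<Rightarrow> ereal" where
  "Jt \<Omega> yd g y a = ereal (1/2 * integral\<^sup>L (lebesgue_on \<Omega>) (\<lambda>x. (y x - yd x)\<^sup>2))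
       + eint (lebesgue_on \<Omega>) (\<lambda>x. g (a x))"

text \<open>Feasible coefficients: a in L^infinity with a(x) I_d in M, i.e. a(x) \<ge> alpha a.e.\<close>
definition feasible :: "(real^'n::finite) set \<Rightarrow> real \<Rightarrow> (real^'n \<Rightarrow> real) \<Rightarrow> bool" where
  "feasible \<Omega> \<alpha> a = (Linf \<Omega> a \<and> (AE x in lebesgue_on \<Omega>. \<alpha> \<le> a x))"

definition L1dist :: "(real^'n::finite) set \<Rightarrow> (real^'n \<Rightarrow> real) \<Rightarrow> (real^'n \<Rightarrow> real) \<Rightarrow> real" where
  "L1dist \<Omega> a b = integral\<^sup>L (lebesgue_on \<Omega>) (\<lambda>x. \<bar>a x - b x\<bar>)"

definition lsc_on :: "real set \<Rightarrow> (real \<Rightarrow> ereal) \<Rightarrow> bool" where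
  "lsc_on S g = (\<forall>x\<in>S. \<forall>s. (\<forall>n. s n \<in> S) \<longrightarrow> s \<longlonglongrightarrow> x \<longrightarrow> g x \<le> liminf (\<lambda>n. g (s n)))"

end

theory Submission
  imports Defs
begin

text \<open>
  The inequality, which is the one produced by shrinking balls, is deduced from a stronger one produced by
  thin lens-shaped inclusions \<open>E\<close> with normal \<open>n\<close>:
  \<open>- (b - a) \<nabla>y \<bullet> \<nabla>p + (b - a)\<^sup>2 / b (n \<bullet> \<nabla>y) (n \<bullet> \<nabla>p) + g b - g a \<ge> 0\<close> at Lebesgue points, for every unit vector \<open>n\<close>.

  If \<open>z\<close> is the change of state caused by setting \<open>a = b\<close> on \<open>E\<close>, the adjoint equation gives
  \<open>\<integral> (y - yd) z = - \<integral>\<^sub>E (b - a) \<nabla>y \<bullet> \<nabla>p - \<integral>\<^sub>E (b - a) \<nabla>z \<bullet> \<nabla>p\<close>. For a flat lens there is a test function \<open>\<psi>\<close> whose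
  gradient is \<open>n\<close> on \<open>E\<close> up to an error that is small compared with \<open>|E|\<close>. Testing the equation of \<open>z\<close>
  with \<open>\<psi>\<close> determines the mean of \<open>n \<bullet> \<nabla>z\<close> on \<open>E\<close>; the divergence free fields
  \<open>(n \<bullet> \<nabla>\<psi>) t - (t \<bullet> \<nabla>\<psi>) n\<close> show that the mean of \<open>t \<bullet> \<nabla>z\<close> is negligible for \<open>t\<close> orthogonal to \<open>n\<close>. No blow-up
  limit is needed. The remaining term \<open>\<parallel>z\<parallel>\<^sup>2\<close> is \<open>o(|E|)\<close> since \<open>z / |E|\<^sup>1\<^sup>/\<^sup>2\<close> tends to zero weakly, hence strongly
  in \<open>L\<^sup>2\<close>. For \<open>g\<close> only a lower bound \<open>L - K (s - a)\<^sup>2\<close> with \<open>L < g a\<close> is used, so Lebesgue points of \<open>g \<circ> a\<close> play no role.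
\<close>

section \<open>Square-integrable functions\<close>

text \<open>Write Y, P for the gradients of state and adjoint at x0, d for the dimension and q = b +
  a (d - 1). Since a d = q - (b - a), the required inequality is the slab inequality with (n . Y) (n
  . P) / b replaced by (Y . P) / q; as q >= b, some normal always makes the slab term at most as
  large. Flatness is what makes lenses convenient: a function with gradient n on the lens and a
  gradient of size \<delta> next to it has squared error of order \<delta>^2 against a volume of
  order \<delta>, so the exterior field of the inclusion never has to be computed. Two parameters
  compete. The relative error t of the lens is fixed first, from the size of the violation to be
  refuted; only then does the radius tend to 0. The lens fills at least a fixed fraction c of its
  ball, so Lebesgue points for balls control means over the lens. The weak convergence of z /
  |E|^(1/2) is a duality argument: a functional h is the right-hand side of an unperturbed equation,
  and testing with its solution v leaves a constant times the L^2 norm of grad v on E, which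
  vanishes as E shrinks.\<close>

definition sqi :: "'a measure \<Rightarrow> ('a \<Rightarrow> 'b::euclidean_space) \<Rightarrow> bool" where
  "sqi M f \<longleftrightarrow> f \<in> borel_measurable M \<and> integrable M (\<lambda>x. (norm (f x))\<^sup>2)"

text \<open>A seminorm on functions, not on classes. A non-integrable square has integral 0, so the
  estimates between norms carry \<open>sqi\<close> hypotheses.\<close>

definition nrm2 :: "'a measure \<Rightarrow> ('a \<Rightarrow> 'b::euclidean_space) \<Rightarrow> real" where
  "nrm2 M f = sqrt (\<integral>x. (norm (f x))\<^sup>2 \<partial>M)"

lemma sqi_measurable: "sqi M f \<Longrightarrow> f \<in> borel_measurable M"
  by (simp add: sqi_def)

lemma sqi_integrable: "sqi M f \<Longrightarrow> integrable M (\<lambda>x. (norm (f x))\<^sup>2)"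
  by (simp add: sqi_def)

lemma nrm2_nonneg[simp]: "0 \<le> nrm2 M f"
  by (simp add: nrm2_def)

lemma nrm2_sq: "(nrm2 M f)\<^sup>2 = (\<integral>x. (norm (f x))\<^sup>2 \<partial>M)"
  by (simp add: nrm2_def)

lemma sqi_bound:
  fixes f :: "'a \<Rightarrow> 'b::euclidean_space" and g :: "'a \<Rightarrow> 'c::euclidean_space"
  assumes g: "sqi M g" and f: "f \<in> borel_measurable M" and le: "AE x in M. norm (f x) \<le> K * norm (g x)"
  shows "sqi M f"
proof -
  have "integrable M (\<lambda>x. (norm (f x))\<^sup>2)"
  proof (rule Bochner_Integration.integrable_bound)
    show "integrable M (\<lambda>x. K\<^sup>2 * (norm (g x))\<^sup>2)"
      using sqi_integrable[OF g] by simp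
    show "(\<lambda>x. (norm (f x))\<^sup>2) \<in> borel_measurable M" using f by measurable
    show "AE x in M. norm ((norm (f x))\<^sup>2) \<le> norm (K\<^sup>2 * (norm (g x))\<^sup>2)"
      using le
    proof eventually_elim
      case (elim x)
      have "(norm (f x))\<^sup>2 \<le> (K * norm (g x))\<^sup>2" by (rule power_mono[OF elim]) simp
      then show ?case by (simp add: power_mult_distrib)
    qed
  qed
  with f show ?thesis by (simp add: sqi_def)
qed

lemma nrm2_bound:
  fixes f :: "'a \<Rightarrow> 'b::euclidean_space" and g :: "'a \<Rightarrow> 'c::euclidean_space"
  assumes g: "sqi M g" and f: "f \<in> borel_measurable M"
    and le: "AE x in M. norm (f x) \<le> K * norm (g x)" and K: "K \<ge> 0"
  shows "nrm2 M f \<le> K * nrm2 M g"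
proof -
  have "(\<integral>x. (norm (f x))\<^sup>2 \<partial>M) \<le> (\<integral>x. K\<^sup>2 * (norm (g x))\<^sup>2 \<partial>M)"
  proof (rule integral_mono_AE)
    show "integrable M (\<lambda>x. (norm (f x))\<^sup>2)" using sqi_bound[OF g f le] by (simp add: sqi_def)
    show "integrable M (\<lambda>x. K\<^sup>2 * (norm (g x))\<^sup>2)" using sqi_integrable[OF g] by simp
    show "AE x in M. (norm (f x))\<^sup>2 \<le> K\<^sup>2 * (norm (g x))\<^sup>2"
      using le
    proof eventually_elim
      case (elim x)
      have "(norm (f x))\<^sup>2 \<le> (K * norm (g x))\<^sup>2" by (rule power_mono[OF elim]) simp
      then show ?case by (simp add: power_mult_distrib)
    qed
  qed
  also have "\<dots> = (K * nrm2 M g)\<^sup>2" by (simp add: power_mult_distrib nrm2_sq)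
  finally have "(nrm2 M f)\<^sup>2 \<le> (K * nrm2 M g)\<^sup>2" by (simp only: nrm2_sq)
  then show ?thesis by (rule power2_le_imp_le) (simp add: K)
qed

lemma sqi_add:
  assumes "sqi M f" "sqi M g" shows "sqi M (\<lambda>x. f x + g x)"
proof -
  have [measurable]: "f \<in> borel_measurable M" "g \<in> borel_measurable M" using assms by (auto simp: sqi_def)
  have "integrable M (\<lambda>x. (norm (f x + g x))\<^sup>2)"
  proof (rule Bochner_Integration.integrable_bound)
    show "integrable M (\<lambda>x. 2 * (norm (f x))\<^sup>2 + 2 * (norm (g x))\<^sup>2)"
      using assms by (auto simp: sqi_def)
    show "AE x in M. norm ((norm (f x + g x))\<^sup>2) \<le> norm (2 * (norm (f x))\<^sup>2 + 2 * (norm (g x))\<^sup>2)"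
    proof (rule AE_I2)
      fix x
      have "(norm (f x + g x))\<^sup>2 \<le> (norm (f x) + norm (g x))\<^sup>2"
        by (rule power_mono[OF norm_triangle_ineq]) simp
      also have "\<dots> \<le> 2 * (norm (f x))\<^sup>2 + 2 * (norm (g x))\<^sup>2"
        using sum_squares_bound[of "norm (f x)" "norm (g x)"] by (simp add: power2_sum)
      finally show "norm ((norm (f x + g x))\<^sup>2) \<le> norm (2 * (norm (f x))\<^sup>2 + 2 * (norm (g x))\<^sup>2)"
        by simp
    qed
  qed measurable
  then show ?thesis by (simp add: sqi_def)
qed

lemma sqi_mult:
  fixes f :: "'a \<Rightarrow> 'b::euclidean_space"
  assumes "sqi M f" "c \<in> borel_measurable M" "AE x in M. \<bar>c x\<bar> \<le> K"
  shows "sqi M (\<lambda>x. c x *\<^sub>R f x)"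
proof (rule sqi_bound[OF assms(1)])
  show "(\<lambda>x. c x *\<^sub>R f x) \<in> borel_measurable M" using sqi_measurable[OF assms(1)] assms(2) by measurable
  show "AE x in M. norm (c x *\<^sub>R f x) \<le> K * norm (f x)"
    using assms(3) by eventually_elim (simp add: mult_right_mono)
qed

lemma nrm2_mult:
  fixes f :: "'a \<Rightarrow> 'b::euclidean_space"
  assumes "sqi M f" "c \<in> borel_measurable M" "AE x in M. \<bar>c x\<bar> \<le> K" "K \<ge> 0"
  shows "nrm2 M (\<lambda>x. c x *\<^sub>R f x) \<le> K * nrm2 M f"
proof (rule nrm2_bound[OF assms(1)])
  show "(\<lambda>x. c x *\<^sub>R f x) \<in> borel_measurable M" using sqi_measurable[OF assms(1)] assms(2) by measurable
  show "AE x in M. norm (c x *\<^sub>R f x) \<le> K * norm (f x)"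
    using assms(3) by eventually_elim (simp add: mult_right_mono)
qed fact

lemma sqi_scaleR: "sqi M f \<Longrightarrow> sqi M (\<lambda>x. c *\<^sub>R f x)"
  by (auto simp: sqi_def power_mult_distrib)

lemma sqi_diff: "sqi M f \<Longrightarrow> sqi M g \<Longrightarrow> sqi M (\<lambda>x. f x - g x)"
  using sqi_add[of M f "\<lambda>x. (-1) *\<^sub>R g x"] sqi_scaleR[of M g "-1"] by simp

lemma nrm2_scaleR: "nrm2 M (\<lambda>x. c *\<^sub>R f x) = \<bar>c\<bar> * nrm2 M f"
  by (simp add: nrm2_def power_mult_distrib real_sqrt_mult)

lemma nrm2_minus: "nrm2 M (\<lambda>x. f x - g x) = nrm2 M (\<lambda>x. g x - f x)"
  by (simp add: nrm2_def norm_minus_commute)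

lemma sqi_inner_integrable:
  assumes "sqi M f" "sqi M g" shows "integrable M (\<lambda>x. f x \<bullet> g x)"
proof (rule Bochner_Integration.integrable_bound)
  have [measurable]: "f \<in> borel_measurable M" "g \<in> borel_measurable M" using assms by (auto simp: sqi_def)
  show "integrable M (\<lambda>x. (norm (f x))\<^sup>2 + (norm (g x))\<^sup>2)"
    using assms by (auto simp: sqi_def)
  show "(\<lambda>x. f x \<bullet> g x) \<in> borel_measurable M" by measurable
  show "AE x in M. norm (f x \<bullet> g x) \<le> norm ((norm (f x))\<^sup>2 + (norm (g x))\<^sup>2)"
  proof (rule AE_I2)
    fix x
    have "\<bar>f x \<bullet> g x\<bar> \<le> norm (f x) * norm (g x)" by (rule Cauchy_Schwarz_ineq2)
    also have "\<dots> \<le> (norm (f x))\<^sup>2 + (norm (g x))\<^sup>2"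
      using sum_squares_bound[of "norm (f x)" "norm (g x)"]
      unfolding mult.assoc using mult_nonneg_nonneg[OF norm_ge_zero norm_ge_zero, of "f x" "g x"] by linarith
    finally show "norm (f x \<bullet> g x) \<le> norm ((norm (f x))\<^sup>2 + (norm (g x))\<^sup>2)" by simp
  qed
qed

text \<open>Evaluating at the vertex t = B / C gives the bound; for C = 0 the affine function must
  be constant. Besides Cauchy-Schwarz this serves in \<open>H10_weak_solution_exists\<close>, where
  it turns near-minimality of the energy into smallness of its first variation.\<close>

lemma quad_nonneg_discr:
  fixes A B C :: real
  assumes "\<And>t. 0 \<le> A - 2 * t * B + t\<^sup>2 * C" "C \<ge> 0"
  shows "B\<^sup>2 \<le> A * C"
proof (cases "C = 0")
  case True
  have "B = 0"
  proof (rule ccontr)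
    assume "B \<noteq> 0"
    \<comment> \<open>At this t the affine function A - 2 t B takes the value -1.\<close>
    then show False using assms(1)[of "(A + 1) / (2 * B)"] True by (simp add: field_simps)
  qed
  then show ?thesis using True by simp
next
  case False
  then have "C > 0" using assms(2) by simp
  have "0 \<le> A - 2 * (B / C) * B + (B / C)\<^sup>2 * C" by (rule assms)
  also have "\<dots> = A - B\<^sup>2 / C" using \<open>C > 0\<close> by (simp add: field_simps power2_eq_square)
  finally show ?thesis using \<open>C > 0\<close> by (simp add: field_simps)
qed

lemma sqi_cs:
  assumes f: "sqi M f" and g: "sqi M g"
  shows "\<bar>\<integral>x. f x \<bullet> g x \<partial>M\<bar> \<le> nrm2 M f * nrm2 M g"
proof -
  have "(\<integral>x. f x \<bullet> g x \<partial>M)\<^sup>2 \<le> (nrm2 M f)\<^sup>2 * (nrm2 M g)\<^sup>2"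
  proof (rule quad_nonneg_discr)
    fix t
    have "0 \<le> (\<integral>x. (norm (f x - t *\<^sub>R g x))\<^sup>2 \<partial>M)" by simp
    also have "\<dots> = (\<integral>x. (norm (f x))\<^sup>2 - 2 * t * (f x \<bullet> g x) + t\<^sup>2 * (norm (g x))\<^sup>2 \<partial>M)"
      unfolding power2_norm_eq_inner
      by (simp add: inner_diff algebra_simps power2_eq_square inner_commute)
    also have "\<dots> = (nrm2 M f)\<^sup>2 - 2 * t * (\<integral>x. f x \<bullet> g x \<partial>M) + t\<^sup>2 * (nrm2 M g)\<^sup>2"
      using sqi_inner_integrable[OF f g] sqi_integrable[OF f] sqi_integrable[OF g]
      by (simp add: nrm2_sq)
    finally show "0 \<le> (nrm2 M f)\<^sup>2 - 2 * t * (\<integral>x. f x \<bullet> g x \<partial>M) + t\<^sup>2 * (nrm2 M g)\<^sup>2" .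
  qed simp
  then have "(\<integral>x. f x \<bullet> g x \<partial>M)\<^sup>2 \<le> (nrm2 M f * nrm2 M g)\<^sup>2" by (simp add: power_mult_distrib)
  then show ?thesis by (simp add: abs_le_square_iff[symmetric])
qed

lemma nrm2_triangle:
  assumes f: "sqi M f" and g: "sqi M g"
  shows "nrm2 M (\<lambda>x. f x + g x) \<le> nrm2 M f + nrm2 M g"
proof -
  have "(nrm2 M (\<lambda>x. f x + g x))\<^sup>2 = (\<integral>x. (norm (f x))\<^sup>2 + 2 * (f x \<bullet> g x) + (norm (g x))\<^sup>2 \<partial>M)"
    unfolding nrm2_sq power2_norm_eq_inner by (simp add: inner_add algebra_simps inner_commute)
  also have "\<dots> = (nrm2 M f)\<^sup>2 + 2 * (\<integral>x. f x \<bullet> g x \<partial>M) + (nrm2 M g)\<^sup>2"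
    using sqi_inner_integrable[OF f g] sqi_integrable[OF f] sqi_integrable[OF g]
    by (simp add: nrm2_sq)
  also have "\<dots> \<le> (nrm2 M f + nrm2 M g)\<^sup>2"
    using sqi_cs[OF f g] by (simp add: power2_sum)
  finally show ?thesis by (rule power2_le_imp_le) simp
qed

lemma nrm2_triangle_diff:
  assumes f: "sqi M f" and g: "sqi M g"
  shows "nrm2 M (\<lambda>x. f x - g x) \<le> nrm2 M f + nrm2 M g"
  using nrm2_triangle[OF f sqi_scaleR[OF g, of "-1"]] nrm2_scaleR[of M "-1" g] by simp

lemma nrm2_triangle3:
  assumes f: "sqi M f" and g: "sqi M g" and h: "sqi M h"
  shows "nrm2 M (\<lambda>x. f x - h x) \<le> nrm2 M (\<lambda>x. f x - g x) + nrm2 M (\<lambda>x. g x - h x)"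
  using nrm2_triangle[OF sqi_diff[OF f g] sqi_diff[OF g h]] by simp

lemma nrm2_diff_ge:
  assumes f: "sqi M f" and g: "sqi M g"
  shows "\<bar>nrm2 M f - nrm2 M g\<bar> \<le> nrm2 M (\<lambda>x. f x - g x)"
  using nrm2_triangle[OF sqi_diff[OF f g] g] nrm2_triangle[OF sqi_diff[OF g f] f] nrm2_minus[of M f g]
  by simp

lemma nrm2_tendsto0_iff:
  "(\<lambda>n. nrm2 M (u n)) \<longlonglongrightarrow> 0 \<longleftrightarrow> (\<lambda>n. \<integral>x. (norm (u n x))\<^sup>2 \<partial>M) \<longlonglongrightarrow> 0"
proof
  assume "(\<lambda>n. nrm2 M (u n)) \<longlonglongrightarrow> 0"
  from tendsto_power[OF this, of 2] show "(\<lambda>n. \<integral>x. (norm (u n x))\<^sup>2 \<partial>M) \<longlonglongrightarrow> 0"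
    by (simp add: nrm2_sq)
next
  assume "(\<lambda>n. \<integral>x. (norm (u n x))\<^sup>2 \<partial>M) \<longlonglongrightarrow> 0"
  from tendsto_real_sqrt[OF this] show "(\<lambda>n. nrm2 M (u n)) \<longlonglongrightarrow> 0"
    by (simp add: nrm2_def)
qed

lemma sqi_tendsto_inner:
  assumes u: "\<And>n. sqi M (u n)" and f: "sqi M f" and g: "sqi M g"
    and lim: "(\<lambda>n. nrm2 M (\<lambda>x. u n x - f x)) \<longlonglongrightarrow> 0"
  shows "(\<lambda>n. \<integral>x. u n x \<bullet> g x \<partial>M) \<longlonglongrightarrow> (\<integral>x. f x \<bullet> g x \<partial>M)"
proof -
  have "(\<lambda>n. (\<integral>x. u n x \<bullet> g x \<partial>M) - (\<integral>x. f x \<bullet> g x \<partial>M)) \<longlonglongrightarrow> 0"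
  proof (rule Lim_null_comparison)
    show "\<forall>\<^sub>F n in sequentially. norm ((\<integral>x. u n x \<bullet> g x \<partial>M) - (\<integral>x. f x \<bullet> g x \<partial>M))
        \<le> nrm2 M (\<lambda>x. u n x - f x) * nrm2 M g"
    proof (rule always_eventually, rule allI)
      fix n
      have "(\<integral>x. u n x \<bullet> g x \<partial>M) - (\<integral>x. f x \<bullet> g x \<partial>M) = (\<integral>x. (u n x - f x) \<bullet> g x \<partial>M)"
        using sqi_inner_integrable[OF u[of n] g] sqi_inner_integrable[OF f g] by (simp add: inner_diff_left)
      then show "norm ((\<integral>x. u n x \<bullet> g x \<partial>M) - (\<integral>x. f x \<bullet> g x \<partial>M)) \<le> nrm2 M (\<lambda>x. u n x - f x) * nrm2 M g"
        using sqi_cs[OF sqi_diff[OF u[of n] f] g] by simp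
    qed
    show "(\<lambda>n. nrm2 M (\<lambda>x. u n x - f x) * nrm2 M g) \<longlonglongrightarrow> 0"
      using tendsto_mult_left_zero[OF lim] by simp
  qed
  then show ?thesis by (simp add: LIM_zero_iff)
qed

lemma nrm2_tendsto:
  assumes u: "\<And>n. sqi M (u n)" and f: "sqi M f"
    and lim: "(\<lambda>n. nrm2 M (\<lambda>x. u n x - f x)) \<longlonglongrightarrow> 0"
  shows "(\<lambda>n. nrm2 M (u n)) \<longlonglongrightarrow> nrm2 M f"
proof -
  have "(\<lambda>n. nrm2 M (u n) - nrm2 M f) \<longlonglongrightarrow> 0"
    by (rule Lim_null_comparison[OF _ lim]) (use nrm2_diff_ge[OF u f] in auto)
  then show ?thesis by (simp add: LIM_zero_iff)
qed

lemma sqi_indicator: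
  fixes v :: "'b::euclidean_space"
  assumes "E \<in> sets M" "emeasure M E < \<infinity>"
  shows "sqi M (\<lambda>x. indicator E x *\<^sub>R v)" "nrm2 M (\<lambda>x. indicator E x *\<^sub>R v) = norm v * sqrt (measure M E)"
proof -
  have eq: "(norm (indicator E x *\<^sub>R v))\<^sup>2 = (norm v)\<^sup>2 * indicator E x" for x :: 'a
    by (auto simp: indicator_def)
  show "sqi M (\<lambda>x. indicator E x *\<^sub>R v)"
    using assms unfolding sqi_def eq by (auto intro!: integrable_real_indicator borel_measurable_scaleR)
  have "E \<inter> space M = E" using assms(1) sets.sets_into_space by blast
  then show "nrm2 M (\<lambda>x. indicator E x *\<^sub>R v) = norm v * sqrt (measure M E)"
    unfolding nrm2_def eq using assms by (simp add: real_sqrt_mult)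
qed


section \<open>Completeness of L^2\<close>

lemma sqi_nn_integral:
  "sqi M f \<Longrightarrow> (\<integral>\<^sup>+x. ennreal ((norm (f x))\<^sup>2) \<partial>M) = ennreal ((nrm2 M f)\<^sup>2)"
  by (simp add: nrm2_sq sqi_def nn_integral_eq_integral)

text \<open>Fatou's lemma and Tonelli's theorem bound nonnegative integrals before integrability is
  known; this turns such a bound into membership and a norm estimate.\<close>

lemma sqiI_nn:
  fixes f :: "'a \<Rightarrow> 'b::euclidean_space"
  assumes f: "f \<in> borel_measurable M" and le: "(\<integral>\<^sup>+x. ennreal ((norm (f x))\<^sup>2) \<partial>M) \<le> ennreal (K\<^sup>2)" and K: "K \<ge> 0"
  shows "sqi M f" "nrm2 M f \<le> K"
proof -
  have "integrable M (\<lambda>x. (norm (f x))\<^sup>2)"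
    using f le by (intro integrableI_bounded) (auto simp: top_unique less_top[symmetric])
  then show s: "sqi M f" using f by (simp add: sqi_def)
  have "(nrm2 M f)\<^sup>2 \<le> K\<^sup>2" using le unfolding sqi_nn_integral[OF s] by simp
  then show "nrm2 M f \<le> K" by (rule power2_le_imp_le) (rule K)
qed

lemma ennreal_le_suminf: "(f :: nat \<Rightarrow> ennreal) k \<le> suminf f"
  using sum_le_suminf[of f "{k}"] by simp

text \<open>Riesz-Fischer: a subsequence with geometrically small increments converges almost
  everywhere, and Fatou's lemma carries the Cauchy estimate of the whole sequence to the pointwise
  limit.\<close>

lemma sqi_complete:
  fixes u :: "nat \<Rightarrow> 'a \<Rightarrow> 'b::euclidean_space"
  assumes u: "\<And>n. sqi M (u n)"
    and cauchy: "\<And>e. e > 0 \<Longrightarrow> \<exists>N. \<forall>m\<ge>N. \<forall>n\<ge>N. nrm2 M (\<lambda>x. u m x - u n x) \<le> e"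
  shows "\<exists>f. sqi M f \<and> (\<lambda>n. nrm2 M (\<lambda>x. u n x - f x)) \<longlonglongrightarrow> 0"
proof -
  have [measurable]: "u n \<in> borel_measurable M" for n using u by (rule sqi_measurable)
  \<comment> \<open>The rate 4^-k for the norms survives the weight 4^k below: 4^k (4^-k)^2 = 4^-k
    is summable, and a bounded weighted sum forces pointwise increments of order 2^-k.\<close>
  obtain N where N: "\<And>k m n. m \<ge> N k \<Longrightarrow> n \<ge> N k \<Longrightarrow> nrm2 M (\<lambda>x. u m x - u n x) \<le> (1/4)^k"
    using cauchy[of "(1/4)^k" for k] by (metis zero_less_power zero_less_divide_1_iff zero_less_numeral)
  \<comment> \<open>Summing the thresholds makes every index \<open>s j\<close> with j >= k at least
    \<open>N k\<close>; the summand k sends s to infinity.\<close>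
  define s where "s k = (\<Sum>i\<le>k. N i) + k" for k
  have sN: "N k \<le> s j" if "k \<le> j" for k j
    unfolding s_def using that by (meson atMost_iff finite_atMost le_add1 le_trans member_le_sum zero_le)
  have sk: "k \<le> s k" for k by (simp add: s_def)
  define d where "d k x = u (s (Suc k)) x - u (s k) x" for k x
  have [measurable]: "d k \<in> borel_measurable M" for k unfolding d_def by measurable
  have dn: "(\<integral>\<^sup>+x. ennreal (4^k * (norm (d k x))\<^sup>2) \<partial>M) \<le> ennreal ((1/4)^k)" for k
  proof -
    have "nrm2 M (d k) \<le> (1/4)^k" unfolding d_def by (intro N sN) auto
    then have "(nrm2 M (d k))\<^sup>2 \<le> ((1/4)^k)\<^sup>2" by (rule power_mono) simp
    moreover have "(4::real)^k * ((1/4)^k)\<^sup>2 = (1/4)^k"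
      by (simp add: power2_eq_square power_mult_distrib[symmetric] flip: mult.assoc)
    ultimately have le: "4^k * (nrm2 M (d k))\<^sup>2 \<le> (1/4)^k"
      by (metis mult_le_cancel_left_pos zero_less_numeral zero_less_power)
    have "(\<integral>\<^sup>+x. ennreal (4^k * (norm (d k x))\<^sup>2) \<partial>M) = ennreal (4^k) * (\<integral>\<^sup>+x. ennreal ((norm (d k x))\<^sup>2) \<partial>M)"
      by (subst nn_integral_cmult[symmetric]) (auto simp: ennreal_mult)
    also have "\<dots> = ennreal (4^k * (nrm2 M (d k))\<^sup>2)"
      using sqi_nn_integral[of M "d k"] u unfolding d_def by (simp add: sqi_diff ennreal_mult)
    finally show ?thesis using le by (simp add: ennreal_leI)
  qed
  have "(\<integral>\<^sup>+x. (\<Sum>k. ennreal (4^k * (norm (d k x))\<^sup>2)) \<partial>M) = (\<Sum>k. \<integral>\<^sup>+x. ennreal (4^k * (norm (d k x))\<^sup>2) \<partial>M)"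
    by (rule nn_integral_suminf) measurable
  also have "\<dots> \<le> (\<Sum>k. ennreal ((1/4)^k))" by (intro suminf_le dn) auto
  also have "\<dots> = ennreal (\<Sum>k. (1/4)^k)" by (intro suminf_ennreal_eq) (auto intro: summable_sums summable_geometric)
  finally have "(\<integral>\<^sup>+x. (\<Sum>k. ennreal (4^k * (norm (d k x))\<^sup>2)) \<partial>M) \<noteq> \<infinity>" by (auto simp: top_unique)
  then have "AE x in M. (\<Sum>k. ennreal (4^k * (norm (d k x))\<^sup>2)) \<noteq> \<infinity>"
    by (intro nn_integral_PInf_AE) auto
  then have conv: "AE x in M. convergent (\<lambda>k. u (s k) x)"
  proof eventually_elim
    case (elim x)
    have "\<exists>C\<ge>0. X = ennreal C" if "X \<noteq> \<infinity>" for X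
      using that by (cases X) auto
    from this[OF elim] obtain C where C: "(\<Sum>k. ennreal (4^k * (norm (d k x))\<^sup>2)) = ennreal C" "C \<ge> 0"
      by blast
    have bd: "norm (d k x) \<le> sqrt C * (1/2)^k" for k
    proof -
      have "ennreal (4^k * (norm (d k x))\<^sup>2) \<le> ennreal C" unfolding C(1)[symmetric]
        by (rule ennreal_le_suminf)
      then have "4^k * (norm (d k x))\<^sup>2 \<le> C" using C(2) by (simp only: ennreal_le_iff)
      then have "(2^k * norm (d k x))\<^sup>2 \<le> C" 
        by (simp add: power_mult_distrib) (simp add: power2_eq_square flip: power_mult_distrib)
      then have "2^k * norm (d k x) \<le> sqrt C" by (rule real_le_rsqrt)
      then show ?thesis by (simp add: field_simps)
    qed
    have "summable (\<lambda>k. d k x)"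
      by (rule summable_comparison_test'[where g="\<lambda>k. sqrt C * (1/2)^k" and N=0])
         (use bd in \<open>auto intro!: summable_mult summable_geometric\<close>)
    moreover have "(\<Sum>i<k. d i x) = u (s k) x - u (s 0) x" for k
      unfolding d_def by (rule sum_lessThan_telescope)
    ultimately have "convergent (\<lambda>k. u (s k) x - u (s 0) x)" by (simp add: summable_iff_convergent)
    then show ?case using convergent_diff_const_right_iff[of "\<lambda>k. u (s k) x"] by simp
  qed
  define f where "f x = lim (\<lambda>k. u (s k) x)" for x
  have fm[measurable]: "f \<in> borel_measurable M" unfolding f_def by (rule borel_measurable_lim_metric) measurable
  \<comment> \<open>Membership and distance come together: \<open>f\<close> is not yet known to be
    square-integrable, but \<open>u n - f\<close> is, by Fatou's lemma along the
    subsequence.\<close>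
  have est: "sqi M (\<lambda>x. u n x - f x) \<and> nrm2 M (\<lambda>x. u n x - f x) \<le> e"
    if e: "e > 0" and M: "\<And>m n. m \<ge> K \<Longrightarrow> n \<ge> K \<Longrightarrow> nrm2 M (\<lambda>x. u m x - u n x) \<le> e" and n: "n \<ge> K" for e K n
  proof -
    have "(\<integral>\<^sup>+x. ennreal ((norm (u n x - f x))\<^sup>2) \<partial>M) = (\<integral>\<^sup>+x. liminf (\<lambda>k. ennreal ((norm (u n x - u (s k) x))\<^sup>2)) \<partial>M)"
    proof (rule nn_integral_cong_AE)
      show "AE x in M. ennreal ((norm (u n x - f x))\<^sup>2) = liminf (\<lambda>k. ennreal ((norm (u n x - u (s k) x))\<^sup>2))"
        using conv
      proof eventually_elim
        case (elim x)
        then have "(\<lambda>k. u (s k) x) \<longlonglongrightarrow> f x" unfolding f_def by (simp add: convergent_LIMSEQ_iff)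
        then have "(\<lambda>k. ennreal ((norm (u n x - u (s k) x))\<^sup>2)) \<longlonglongrightarrow> ennreal ((norm (u n x - f x))\<^sup>2)"
          by (intro tendsto_intros)
        from lim_imp_Liminf[OF _ this] show ?case by simp
      qed
    qed
    also have "\<dots> \<le> liminf (\<lambda>k. \<integral>\<^sup>+x. ennreal ((norm (u n x - u (s k) x))\<^sup>2) \<partial>M)"
      by (rule nn_integral_liminf) measurable
    also have "\<dots> \<le> ennreal (e\<^sup>2)"
    proof -
      have "\<forall>\<^sub>F k in sequentially. (\<integral>\<^sup>+x. ennreal ((norm (u n x - u (s k) x))\<^sup>2) \<partial>M) \<le> ennreal (e\<^sup>2)"
        using eventually_ge_at_top[of K]
      proof eventually_elim
        case (elim k)
        have "s k \<ge> K" using sk[of k] elim by simp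
        then have "(nrm2 M (\<lambda>x. u n x - u (s k) x))\<^sup>2 \<le> e\<^sup>2" by (intro power_mono M n) auto
        then show ?case using sqi_nn_integral[OF sqi_diff[OF u u, of n "s k"]] by (simp add: ennreal_leI)
      qed
      then have "liminf (\<lambda>k. \<integral>\<^sup>+x. ennreal ((norm (u n x - u (s k) x))\<^sup>2) \<partial>M) \<le> liminf (\<lambda>k::nat. ennreal (e\<^sup>2))"
        by (rule Liminf_mono)
      then show ?thesis by (simp add: Liminf_const)
    qed
    finally show ?thesis using e by (auto intro: sqiI_nn(1)[where K=e] sqiI_nn(2)[where K=e])
  qed
  obtain K where "\<And>m n. m \<ge> K \<Longrightarrow> n \<ge> K \<Longrightarrow> nrm2 M (\<lambda>x. u m x - u n x) \<le> 1" using cauchy[of 1] by auto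
  from est[OF _ this, of K] have "sqi M (\<lambda>x. u K x - f x)" by auto
  from sqi_diff[OF u[of K] this] have "sqi M f" by simp
  moreover have "(\<lambda>n. nrm2 M (\<lambda>x. u n x - f x)) \<longlonglongrightarrow> 0"
  proof (rule LIMSEQ_I)
    fix r :: real assume "r > 0"
    then obtain K where "\<And>m n. m \<ge> K \<Longrightarrow> n \<ge> K \<Longrightarrow> nrm2 M (\<lambda>x. u m x - u n x) \<le> r/2"
      using cauchy[of "r/2"] by auto
    from est[OF _ this] \<open>r > 0\<close> have "\<forall>n\<ge>K. nrm2 M (\<lambda>x. u n x - f x) \<le> r/2" by auto
    then show "\<exists>no. \<forall>n\<ge>no. norm (nrm2 M (\<lambda>x. u n x - f x) - 0) < r"
      using \<open>r > 0\<close> by (intro exI[of _ K]) (auto intro: le_less_trans)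
  qed
  ultimately show ?thesis by blast
qed

section \<open>Smooth functions and test functions\<close>

text \<open>\<open>pd\<close> goes through the choice operator \<open>frechet_derivative\<close>, so
  gradients are computed by exhibiting a derivative and invoking its uniqueness.\<close>

lemma has_derivative_gradI:
  fixes \<phi> :: "real^'n::finite \<Rightarrow> real"
  assumes "(\<phi> has_derivative (\<lambda>h. G \<bullet> h)) (at x)"
  shows "grad \<phi> x = G"
proof -
  have "frechet_derivative \<phi> (at x) = (\<lambda>h. G \<bullet> h)"
    using frechet_derivative_at[OF assms] by simp
  then show ?thesis
    by (simp add: grad_def pd_def vec_eq_iff inner_axis)
qed

lemma differentiable_has_derivative_grad:
  fixes \<phi> :: "real^'n::finite \<Rightarrow> real"
  assumes "\<phi> differentiable (at x)"
  shows "(\<phi> has_derivative (\<lambda>h. grad \<phi> x \<bullet> h)) (at x)"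
proof -
  let ?D = "frechet_derivative \<phi> (at x)"
  have D: "(\<phi> has_derivative ?D) (at x)" using assms by (simp add: frechet_derivative_works)
  then interpret D: bounded_linear ?D by (rule has_derivative_bounded_linear)
  have "?D h = grad \<phi> x \<bullet> h" for h
  proof -
    have "?D h = ?D (\<Sum>i\<in>UNIV. h $ i *\<^sub>R axis i 1)"
      using basis_expansion[of h] by (simp add: scalar_mult_eq_scaleR)
    also have "\<dots> = (\<Sum>i\<in>UNIV. h $ i * ?D (axis i 1))"
      by (simp add: D.sum D.scaleR)
    also have "\<dots> = grad \<phi> x \<bullet> h"
      by (simp add: grad_def pd_def inner_vec_def mult.commute)
    finally show ?thesis .
  qed
  then have "?D = (\<lambda>h. grad \<phi> x \<bullet> h)" by (rule ext)
  with D show ?thesis by simp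
qed

lemma pd_grad: "pd i \<phi> x = grad \<phi> x $ i"
  by (simp add: grad_def)

lemma Ck_continuous: "Ck k \<phi> \<Longrightarrow> continuous_on UNIV \<phi>"
  by (cases k) auto

lemma Ck_SucD: "Ck (Suc k) \<phi> \<Longrightarrow> Ck k \<phi>"
proof (induction k arbitrary: \<phi>)
  case (Suc k)
  then have "Ck k (pd i \<phi>)" if "Ck (Suc k) (pd i \<phi>)" for i using that by blast
  with Suc.prems show ?case by (metis Ck.simps(2) Suc.IH)
qed simp

text \<open>An explicit gradient formula lowers the order by one; the closure properties below are
  inductions on k through this rule.\<close>

lemma Ck_SucI:
  fixes \<phi> :: "real^'n::finite \<Rightarrow> real"
  assumes "\<And>x. (\<phi> has_derivative (\<lambda>h. G x \<bullet> h)) (at x)" and "\<And>i. Ck k (\<lambda>x. G x $ i)"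
  shows "Ck (Suc k) \<phi>"
proof -
  have "pd i \<phi> = (\<lambda>x. G x $ i)" for i
    using has_derivative_gradI[OF assms(1)] by (auto simp: pd_grad)
  moreover have "\<phi> differentiable_on UNIV"
    using assms(1) by (auto simp: differentiable_on_def intro: differentiableI)
  ultimately show ?thesis using assms(2) by (simp add: differentiable_imp_continuous_on)
qed

lemma Ck_Suc_has_derivative:
  fixes \<phi> :: "real^'n::finite \<Rightarrow> real"
  assumes "Ck (Suc k) \<phi>"
  shows "(\<phi> has_derivative (\<lambda>h. grad \<phi> x \<bullet> h)) (at x)"
  using assms by (intro differentiable_has_derivative_grad) (simp add: differentiable_on_def)

lemma Ck_Suc_pd: "Ck (Suc k) \<phi> \<Longrightarrow> Ck k (\<lambda>x. grad \<phi> x $ i)"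
  by (simp add: pd_grad[symmetric])

section \<open>Closure properties of the classes C^k\<close>

lemma Ck_const: "Ck k (\<lambda>x::real^'n::finite. c)"
proof (induction k arbitrary: c)
  case (Suc k)
  show ?case by (rule Ck_SucI[where G="\<lambda>x. 0"]) (use Suc in \<open>auto intro!: derivative_eq_intros\<close>)
qed simp

lemma Ck_inner: "Ck k (\<lambda>x::real^'n::finite. x \<bullet> v)"
proof (cases k)
  case (Suc k)
  show ?thesis unfolding Suc
    by (rule Ck_SucI[where G="\<lambda>x. v"]) (auto intro!: derivative_eq_intros Ck_const simp: inner_commute)
qed (simp add: continuous_on_inner)

lemma Ck_add: "Ck k \<phi> \<Longrightarrow> Ck k \<psi> \<Longrightarrow> Ck k (\<lambda>x. \<phi> x + \<psi> x)"
proof (induction k arbitrary: \<phi> \<psi>)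
  case (Suc k)
  show ?case
  proof (rule Ck_SucI[where G="\<lambda>x. grad \<phi> x + grad \<psi> x"])
    show "((\<lambda>x. \<phi> x + \<psi> x) has_derivative (\<bullet>) (grad \<phi> x + grad \<psi> x)) (at x)" for x
      by (rule has_derivative_eq_rhs[OF has_derivative_add[OF Ck_Suc_has_derivative[OF Suc.prems(1)] Ck_Suc_has_derivative[OF Suc.prems(2)]]])
        (simp add: fun_eq_iff inner_add_left)
    show "Ck k (\<lambda>x. (grad \<phi> x + grad \<psi> x) $ i)" for i
      using Suc.IH[OF Ck_Suc_pd[OF Suc.prems(1)] Ck_Suc_pd[OF Suc.prems(2)]] by simp
  qed
qed (auto intro: continuous_on_add)

lemma Ck_mult: "Ck k \<phi> \<Longrightarrow> Ck k \<psi> \<Longrightarrow> Ck k (\<lambda>x. \<phi> x * \<psi> x)"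
proof (induction k arbitrary: \<phi> \<psi>)
  case (Suc k)
  show ?case
  proof (rule Ck_SucI[where G="\<lambda>x. \<phi> x *\<^sub>R grad \<psi> x + \<psi> x *\<^sub>R grad \<phi> x"])
    show "((\<lambda>x. \<phi> x * \<psi> x) has_derivative (\<bullet>) (\<phi> x *\<^sub>R grad \<psi> x + \<psi> x *\<^sub>R grad \<phi> x)) (at x)" for x
      by (rule has_derivative_eq_rhs[OF has_derivative_mult[OF Ck_Suc_has_derivative[OF Suc.prems(1)] Ck_Suc_has_derivative[OF Suc.prems(2)]]])
        (simp add: fun_eq_iff inner_add_left mult.commute)
    show "Ck k (\<lambda>x. (\<phi> x *\<^sub>R grad \<psi> x + \<psi> x *\<^sub>R grad \<phi> x) $ i)" for i
      using Ck_add[OF Suc.IH[OF Ck_SucD[OF Suc.prems(1)] Ck_Suc_pd[OF Suc.prems(2)]]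
          Suc.IH[OF Ck_SucD[OF Suc.prems(2)] Ck_Suc_pd[OF Suc.prems(1)]]] by simp
  qed
qed (auto intro: continuous_on_mult)

text \<open>The outer derivative enters only after composition. For the families \<open>powr\<close>
  and \<open>flat_exp\<close> it is built from members of the same family, so the last hypothesis
  follows from the induction hypothesis.\<close>

lemma Ck_compose_Suc:
  assumes F: "\<And>x. (F has_real_derivative F' (\<phi> x)) (at (\<phi> x))"
    and \<phi>: "Ck (Suc k) \<phi>" and F': "Ck k (\<lambda>x. F' (\<phi> x))"
  shows "Ck (Suc k) (\<lambda>x. F (\<phi> x))"
proof (rule Ck_SucI[where G="\<lambda>x. F' (\<phi> x) *\<^sub>R grad \<phi> x"])
  show "((\<lambda>x. F (\<phi> x)) has_derivative (\<bullet>) (F' (\<phi> x) *\<^sub>R grad \<phi> x)) (at x)" for x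
    by (rule has_derivative_eq_rhs[OF has_derivative_compose[OF Ck_Suc_has_derivative[OF \<phi>] F[THEN has_field_derivative_imp_has_derivative]]])
      (simp add: fun_eq_iff)
  show "Ck k (\<lambda>x. (F' (\<phi> x) *\<^sub>R grad \<phi> x) $ i)" for i
    using Ck_mult[OF F' Ck_Suc_pd[OF \<phi>]] by simp
qed

lemma Ck_powr: "(\<And>x. \<phi> x > 0) \<Longrightarrow> Ck k \<phi> \<Longrightarrow> Ck k (\<lambda>x. \<phi> x powr s)"
proof (induction k arbitrary: s)
  case 0
  then show ?case by (auto intro!: continuous_intros simp: less_imp_neq[symmetric])
next
  case (Suc k)
  show ?case
  proof (rule Ck_compose_Suc[where F="\<lambda>u. u powr s" and F'="\<lambda>u. s * u powr (s - 1)"])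
    show "((\<lambda>u. u powr s) has_real_derivative s * \<phi> x powr (s - 1)) (at (\<phi> x))" for x
      using Suc.prems(1) by (rule has_real_derivative_powr)
    show "Ck k (\<lambda>x. s * \<phi> x powr (s - 1))"
      by (rule Ck_mult[OF Ck_const Suc.IH[OF Suc.prems(1) Ck_SucD[OF Suc.prems(2)]]])
  qed fact
qed

text \<open>The functions s^-n exp (-1/s) extended by 0; n = 0 is the classical smooth function that
  is flat at 0. The index is there because derivatives are linear combinations of members of the
  family.\<close>

definition flat_exp :: "nat \<Rightarrow> real \<Rightarrow> real" where
  "flat_exp n s = (if s > 0 then (1 / s) ^ n * exp (- (1 / s)) else 0)"

lemma flat_exp_tendsto_0: "(flat_exp n \<longlongrightarrow> 0) (at 0)"
proof -
  have "((\<lambda>u::real. u ^ n / exp u) \<longlongrightarrow> 0) at_top" by (rule tendsto_power_div_exp_0)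
  then have "((\<lambda>s::real. (inverse s) ^ n / exp (inverse s)) \<longlongrightarrow> 0) (at_right 0)"
    by (rule filterlim_compose[OF _ filterlim_inverse_at_top_right])
  moreover have "\<forall>\<^sub>F s::real in at_right 0. (inverse s) ^ n / exp (inverse s) = flat_exp n s"
    unfolding eventually_at_right_field by (auto simp: flat_exp_def exp_minus divide_simps intro!: exI[of _ 1])
  ultimately have "(flat_exp n \<longlongrightarrow> 0) (at_right 0)" by (rule Lim_transform_eventually)
  moreover have "(flat_exp n \<longlongrightarrow> 0) (at_left 0)"
    by (rule Lim_transform_eventually[OF tendsto_const])
      (auto simp: eventually_at_left_field flat_exp_def intro!: exI[of _ "-1"])
  ultimately show ?thesis by (simp add: filterlim_at_split)
qed

lemma flat_exp_deriv: "(flat_exp n has_real_derivative flat_exp (n + 2) s - n * flat_exp (n + 1) s) (at s)"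
proof -
  consider "s > 0" | "s = 0" | "s < 0" by linarith
  then show ?thesis
  proof cases
    case 1
    have "((\<lambda>s. (1 / s) ^ n * exp (- (1 / s))) has_real_derivative flat_exp (n + 2) s - n * flat_exp (n + 1) s) (at s)"
    proof (rule DERIV_cong)
      define u where "u = 1 / s"
      have d: "((\<lambda>s. 1 / s) has_real_derivative - (u\<^sup>2)) (at s)"
        using 1 by (auto intro!: derivative_eq_intros simp: u_def power2_eq_square)
      show "((\<lambda>s. (1 / s) ^ n * exp (- (1 / s))) has_real_derivative
          (real n * (- (u\<^sup>2) * u ^ (n - Suc 0))) * exp (- u) + (exp (- u) * - (- (u\<^sup>2))) * u ^ n) (at s)"
        using DERIV_mult[OF DERIV_power[OF d, of n] DERIV_fun_exp[OF DERIV_minus[OF d]]] by (simp add: u_def)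
      show "(real n * (- (u\<^sup>2) * u ^ (n - Suc 0))) * exp (- u) + (exp (- u) * - (- (u\<^sup>2))) * u ^ n
          = flat_exp (n + 2) s - n * flat_exp (n + 1) s"
        using 1 unfolding flat_exp_def u_def[symmetric]
        by (cases n) (simp_all add: algebra_simps power2_eq_square)
    qed
    then show ?thesis
      by (rule has_field_derivative_transform_within[where d=s]) (use 1 in \<open>auto simp: flat_exp_def dist_real_def\<close>)
  next
    case 2
    \<comment> \<open>At 0 the difference quotient of \<open>flat_exp n\<close> is
      \<open>flat_exp (n + 1)\<close> itself, whose limit is already known.\<close>
    have "((\<lambda>h. (flat_exp n (0 + h) - flat_exp n 0) / h) \<longlongrightarrow> 0) (at 0)"
    proof (rule Lim_transform_eventually[OF flat_exp_tendsto_0[of "n + 1"]])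
      show "\<forall>\<^sub>F h in at 0. flat_exp (n + 1) h = (flat_exp n (0 + h) - flat_exp n 0) / h"
        by (rule always_eventually) (auto simp: flat_exp_def)
    qed
    then show ?thesis unfolding 2 DERIV_def by (simp add: flat_exp_def)
  next
    case 3
    have "((\<lambda>s. 0) has_real_derivative flat_exp (n + 2) s - n * flat_exp (n + 1) s) (at s)"
      using 3 by (simp add: flat_exp_def)
    then show ?thesis
      by (rule has_field_derivative_transform_within[where d="-s"]) (use 3 in \<open>auto simp: flat_exp_def dist_real_def\<close>)
  qed
qed

lemma Ck_flat_exp: "Ck k \<phi> \<Longrightarrow> Ck k (\<lambda>x. flat_exp n (\<phi> x))"
proof (induction k arbitrary: n)
  case 0
  have "continuous_on UNIV (flat_exp n)"
    using flat_exp_deriv by (intro continuous_at_imp_continuous_on) (blast intro: DERIV_isCont)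
  then show ?case using 0 by (auto intro: continuous_on_compose2)
next
  case (Suc k)
  show ?case
  proof (rule Ck_compose_Suc[OF flat_exp_deriv Suc.prems])
    have c: "Ck k \<phi>" by (rule Ck_SucD[OF Suc.prems])
    show "Ck k (\<lambda>x. flat_exp (n + 2) (\<phi> x) - n * flat_exp (n + 1) (\<phi> x))"
      using Ck_add[OF Suc.IH[OF c, of "n + 2"] Ck_mult[OF Ck_const[of k "- real n"] Suc.IH[OF c, of "n + 1"]]]
      by simp
  qed
qed

lemma smooth_const: "smooth (\<lambda>x. c)"
  and smooth_inner: "smooth (\<lambda>x. x \<bullet> v)"
  and smooth_add: "smooth \<phi> \<Longrightarrow> smooth \<psi> \<Longrightarrow> smooth (\<lambda>x. \<phi> x + \<psi> x)"
  and smooth_mult: "smooth \<phi> \<Longrightarrow> smooth \<psi> \<Longrightarrow> smooth (\<lambda>x. \<phi> x * \<psi> x)"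
  and smooth_powr: "(\<And>x. \<phi> x > 0) \<Longrightarrow> smooth \<phi> \<Longrightarrow> smooth (\<lambda>x. \<phi> x powr s)"
  and smooth_flat_exp: "smooth \<phi> \<Longrightarrow> smooth (\<lambda>x. flat_exp n (\<phi> x))"
  by (auto simp: smooth_def Ck_const Ck_inner Ck_add Ck_mult Ck_powr Ck_flat_exp)

lemma smooth_cmult: "smooth \<phi> \<Longrightarrow> smooth (\<lambda>x. c * \<phi> x)"
  by (rule smooth_mult[OF smooth_const])

lemma smooth_diff: "smooth \<phi> \<Longrightarrow> smooth \<psi> \<Longrightarrow> smooth (\<lambda>x. \<phi> x - \<psi> x)"
  using smooth_add[OF _ smooth_cmult[of \<psi> "-1"]] by simp

lemma smooth_sqrt:
  assumes "\<And>x. \<phi> x > 0" "smooth \<phi>" shows "smooth (\<lambda>x. sqrt (\<phi> x))"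
  using smooth_powr[OF assms, of "1/2"] assms(1) by (simp add: powr_half_sqrt less_imp_le)

text \<open>A polynomial in the coordinates. The norm itself is not differentiable at the centre, so
  bumps are built from its square.\<close>

lemma smooth_sq_dist: "smooth (\<lambda>x::real^'n::finite. (norm (x - c))\<^sup>2)"
proof -
  have "smooth (\<lambda>x::real^'n. \<Sum>i\<in>A. (x \<bullet> axis i 1 - c \<bullet> axis i 1) * (x \<bullet> axis i 1 - c \<bullet> axis i 1))" if "finite A" for A
    using that by induction (auto intro!: smooth_const smooth_add smooth_mult smooth_diff smooth_inner)
  from this[of UNIV] show ?thesis
    by (simp add: power2_norm_eq_inner inner_vec_def[of "_ - c"] inner_axis)
qed

lemma smooth_continuous: "smooth \<phi> \<Longrightarrow> continuous_on UNIV \<phi>"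
  by (auto simp: smooth_def intro: Ck_continuous)

lemma smooth_has_derivative: "smooth \<phi> \<Longrightarrow> (\<phi> has_derivative (\<lambda>h. grad \<phi> x \<bullet> h)) (at x)"
  by (rule Ck_Suc_has_derivative[of 0]) (simp add: smooth_def)

lemma smooth_grad_continuous:
  assumes "smooth \<phi>" shows "continuous_on UNIV (grad \<phi>)"
proof -
  have "continuous_on UNIV (\<lambda>x. pd i \<phi> x)" for i
    using assms Ck_continuous[of 0 "pd i \<phi>"] unfolding smooth_def by (metis Ck.simps(1) Ck.simps(2))
  then show ?thesis unfolding grad_def by (rule continuous_on_vec_lambda)
qed

lemma grad_add: "smooth \<phi> \<Longrightarrow> smooth \<psi> \<Longrightarrow> grad (\<lambda>x. \<phi> x + \<psi> x) x = grad \<phi> x + grad \<psi> x"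
  by (rule has_derivative_gradI, rule has_derivative_eq_rhs[OF has_derivative_add[OF smooth_has_derivative smooth_has_derivative]])
    (simp_all add: fun_eq_iff inner_add_left)

lemma grad_cmult: "smooth \<phi> \<Longrightarrow> grad (\<lambda>x. c * \<phi> x) x = c *\<^sub>R grad \<phi> x"
  by (rule has_derivative_gradI, rule has_derivative_eq_rhs[OF has_derivative_mult_right[OF smooth_has_derivative]])
    (simp_all add: fun_eq_iff)

section \<open>Test functions\<close>

lemma test_funI:
  assumes "smooth \<phi>" "compact K" "K \<subseteq> \<Omega>" "\<And>x. x \<notin> K \<Longrightarrow> \<phi> x = 0"
  shows "test_fun \<Omega> \<phi>"
proof -
  have "closure {x. \<phi> x \<noteq> 0} \<subseteq> K"
    by (rule closure_minimal) (use assms in \<open>auto intro: compact_imp_closed\<close>)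
  moreover have "compact (closure {x. \<phi> x \<noteq> 0})"
    using compact_Int_closed[OF assms(2) closed_closure, of "{x. \<phi> x \<noteq> 0}"] calculation by (simp add: Int_absorb1)
  ultimately show ?thesis using assms by (auto simp: test_fun_def)
qed

lemma test_funE:
  assumes "test_fun \<Omega> \<phi>"
  obtains K where "compact K" "K \<subseteq> \<Omega>" "\<And>x. x \<notin> K \<Longrightarrow> \<phi> x = 0" "\<And>x. x \<notin> K \<Longrightarrow> grad \<phi> x = 0"
proof
  let ?K = "closure {x. \<phi> x \<noteq> 0}"
  show "compact ?K" "?K \<subseteq> \<Omega>" using assms by (auto simp: test_fun_def)
  show z: "\<phi> x = 0" if "x \<notin> ?K" for x using that closure_subset[of "{x. \<phi> x \<noteq> 0}"] by blast
  show "grad \<phi> x = 0" if "x \<notin> ?K" for x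
  proof (rule has_derivative_gradI)
    have "((\<lambda>x. 0) has_derivative (\<bullet>) 0) (at x)" by (auto intro!: derivative_eq_intros)
    then show "(\<phi> has_derivative (\<bullet>) 0) (at x)"
    proof (rule has_derivative_transform_within_open)
      show "open (- ?K)" by (rule open_Compl[OF closed_closure])
      show "x \<in> - ?K" using that by simp
      show "\<And>w. w \<in> - ?K \<Longrightarrow> 0 = \<phi> w" using z by (metis ComplD)
    qed
  qed
qed

lemma test_fun_smooth: "test_fun \<Omega> \<phi> \<Longrightarrow> smooth \<phi>"
  by (simp add: test_fun_def)

lemma test_fun_add: assumes "test_fun \<Omega> \<phi>" "test_fun \<Omega> \<psi>" shows "test_fun \<Omega> (\<lambda>x. \<phi> x + \<psi> x)"
proof -
  obtain K L where "compact K" "K \<subseteq> \<Omega>" "\<And>x. x \<notin> K \<Longrightarrow> \<phi> x = 0" "compact L" "L \<subseteq> \<Omega>" "\<And>x. x \<notin> L \<Longrightarrow> \<psi> x = 0"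
    using assms by (metis test_funE)
  then show ?thesis using assms
    by (intro test_funI[of _ "K \<union> L"]) (auto intro: smooth_add test_fun_smooth)
qed

lemma test_fun_cmult: assumes "test_fun \<Omega> \<phi>" shows "test_fun \<Omega> (\<lambda>x. c * \<phi> x)"
proof -
  obtain K where "compact K" "K \<subseteq> \<Omega>" "\<And>x. x \<notin> K \<Longrightarrow> \<phi> x = 0" using assms by (metis test_funE)
  then show ?thesis using assms
    by (intro test_funI[of _ "K"]) (auto intro: smooth_cmult test_fun_smooth)
qed

lemma test_fun_mono: "test_fun S \<phi> \<Longrightarrow> S \<subseteq> \<Omega> \<Longrightarrow> test_fun \<Omega> \<phi>"
  by (auto simp: test_fun_def)

section \<open>Difference quotients\<close>

lemma continuous_compact_support_bounded:
  fixes f :: "'a::euclidean_space \<Rightarrow> 'b::real_normed_vector"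
  assumes "continuous_on UNIV f" "compact K" "\<And>x. x \<notin> K \<Longrightarrow> f x = 0"
  obtains B where "B \<ge> 0" "\<And>x. norm (f x) \<le> B"
proof -
  have "bounded (f ` K)"
    by (intro compact_imp_bounded compact_continuous_image continuous_on_subset[OF assms(1)] assms(2)) simp
  then obtain B where "\<And>x. x \<in> K \<Longrightarrow> norm (f x) \<le> B" by (auto simp: bounded_iff)
  then have "norm (f x) \<le> max B 0" for x using assms(3)[of x] by (cases "x \<in> K") (auto simp: le_max_iff_disj)
  then show thesis using that[of "max B 0"] by simp
qed

lemma sqi_compact_support:
  fixes f :: "'a::euclidean_space \<Rightarrow> 'b::euclidean_space"
  assumes "continuous_on UNIV f" "compact K" "\<And>x. x \<notin> K \<Longrightarrow> f x = 0"
  shows "sqi lborel f"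
proof -
  have "integrable lborel (\<lambda>x. indicator K x *\<^sub>R (norm (f x))\<^sup>2)"
    by (intro borel_integrable_compact assms continuous_intros continuous_on_subset[OF assms(1)]) simp
  moreover have "(\<lambda>x. indicator K x *\<^sub>R (norm (f x))\<^sup>2) = (\<lambda>x. (norm (f x))\<^sup>2)"
    using assms(3) by (auto simp: indicator_def fun_eq_iff)
  ultimately have "integrable lborel (\<lambda>x. (norm (f x))\<^sup>2)" by (simp only:)
  then show ?thesis
    using assms(1) by (simp add: sqi_def borel_measurable_continuous_onI)
qed

lemma sqi_test_fun: "test_fun \<Omega> \<phi> \<Longrightarrow> sqi lborel \<phi>" "test_fun \<Omega> \<phi> \<Longrightarrow> sqi lborel (grad \<phi>)"
  by (metis test_funE test_fun_smooth smooth_continuous sqi_compact_support)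
     (metis test_funE test_fun_smooth smooth_grad_continuous sqi_compact_support)

lemma test_fun_lipschitz:
  assumes "test_fun \<Omega> \<phi>"
  obtains L where "L \<ge> 0" "\<And>x y. \<bar>\<phi> x - \<phi> y\<bar> \<le> L * norm (x - y)"
proof -
  obtain K where K: "compact K" "\<And>x. x \<notin> K \<Longrightarrow> grad \<phi> x = 0" using assms by (metis test_funE)
  obtain L where L: "L \<ge> 0" "\<And>x. norm (grad \<phi> x) \<le> L"
    using continuous_compact_support_bounded[OF smooth_grad_continuous[OF test_fun_smooth[OF assms]] K] by metis
  have "norm (\<phi> x - \<phi> y) \<le> L * norm (x - y)" for x y
  proof (rule differentiable_bound[of UNIV])
    show "(\<phi> has_derivative (\<bullet>) (grad \<phi> x)) (at x within UNIV)" for x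
      using smooth_has_derivative[OF test_fun_smooth[OF assms]] by simp
    show "onorm ((\<bullet>) (grad \<phi> x)) \<le> L" for x
    proof (rule onorm_le)
      fix h show "norm (grad \<phi> x \<bullet> h) \<le> L * norm h"
        using Cauchy_Schwarz_ineq2[of "grad \<phi> x" h] mult_right_mono[OF L(2)[of x] norm_ge_zero[of h]] by simp
    qed
  qed auto
  then show thesis using that L(1) by simp
qed

definition dquot :: "nat \<Rightarrow> real^'n::finite \<Rightarrow> (real^'n \<Rightarrow> real) \<Rightarrow> real^'n \<Rightarrow> real" where
  "dquot n h \<phi> x = (\<phi> (x + (1 / real (Suc n)) *\<^sub>R h) - \<phi> x) * real (Suc n)"

lemma dquot_tendsto:
  assumes "smooth \<phi>"
  shows "(\<lambda>n. dquot n h \<phi> x) \<longlonglongrightarrow> grad \<phi> x \<bullet> h"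
proof -
  have "((\<lambda>t. \<phi> (x + t *\<^sub>R h)) has_derivative (\<lambda>t. grad \<phi> x \<bullet> (t *\<^sub>R h))) (at 0)"
    by (rule has_derivative_compose[where g=\<phi>]) (use smooth_has_derivative[OF assms, of x] in \<open>auto intro!: derivative_eq_intros\<close>)
  then have "((\<lambda>t. \<phi> (x + t *\<^sub>R h)) has_real_derivative (grad \<phi> x \<bullet> h)) (at 0)"
    by (rule has_derivative_imp_has_field_derivative) simp
  then have l: "((\<lambda>t. (\<phi> (x + t *\<^sub>R h) - \<phi> x) / t) \<longlongrightarrow> grad \<phi> x \<bullet> h) (at 0)"
    by (simp add: DERIV_def)
  have "filterlim (\<lambda>n. 1 / real (Suc n)) (at 0) sequentially"
    using LIMSEQ_inverse_real_of_nat by (auto simp: filterlim_at inverse_eq_divide)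
  from filterlim_compose[OF l this] show ?thesis by (simp add: dquot_def mult.commute)
qed

text \<open>Provides one integrable majorant for all n. Steps have length at most
  \<open>norm h\<close>, so outside the support radius enlarged by \<open>norm h\<close> both
  evaluation points miss the support; inside, a Lipschitz constant bounds the quotient.\<close>

lemma dquot_bound:
  fixes \<phi> :: "real^'n::finite \<Rightarrow> real"
  assumes "test_fun \<Omega> \<phi>"
  obtains B R where "B \<ge> 0" "\<And>n x. \<bar>dquot n h \<phi> x\<bar> \<le> B * indicator (cball 0 R) x"
proof -
  obtain L where L: "L \<ge> 0" "\<And>x y. \<bar>\<phi> x - \<phi> y\<bar> \<le> L * norm (x - y)"
    by (rule test_fun_lipschitz[OF assms]) blast
  obtain K where K: "compact K" "\<And>x. x \<notin> K \<Longrightarrow> \<phi> x = 0" using assms by (metis test_funE)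
  obtain R where R: "\<And>x. x \<in> K \<Longrightarrow> norm x \<le> R" using compact_imp_bounded[OF K(1)] by (auto simp: bounded_iff)
  show thesis
  proof
    show "L * norm h \<ge> 0" using L by simp
    fix n x
    let ?t = "1 / real (Suc n)"
    show "\<bar>dquot n h \<phi> x\<bar> \<le> L * norm h * indicator (cball 0 (R + norm h)) x"
    proof (cases "x \<in> cball 0 (R + norm h)")
      case True
      have "\<bar>dquot n h \<phi> x\<bar> = \<bar>\<phi> (x + ?t *\<^sub>R h) - \<phi> x\<bar> * real (Suc n)" by (simp add: dquot_def abs_mult)
      also have "\<dots> \<le> (L * norm (x + ?t *\<^sub>R h - x)) * real (Suc n)" by (intro mult_right_mono L) simp
      also have "\<dots> = L * norm h" by simp
      finally show ?thesis using True by simp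
    next
      case False
      then have "norm x > R + norm h" by simp
      moreover have "norm (?t *\<^sub>R h) \<le> norm h" by (simp add: field_simps)
      ultimately have "norm (x + ?t *\<^sub>R h) > R" "norm x > R"
        using norm_triangle_ineq2[of x "- (?t *\<^sub>R h)"] norm_ge_zero[of h] by (simp_all del: norm_scaleR norm_ge_zero)
      then have "\<phi> (x + ?t *\<^sub>R h) = 0" "\<phi> x = 0" using R K(2) by (meson not_le)+
      then show ?thesis using L(1) by (simp add: dquot_def)
    qed
  qed
qed

lemma lborel_integral_translate:
  fixes f :: "'a::euclidean_space \<Rightarrow> real"
  assumes "f \<in> borel_measurable borel"
  shows "(\<integral>x. f (x + c) \<partial>lborel) = (\<integral>x. f x \<partial>lborel)"
proof -
  have "(\<integral>x. f x \<partial>lborel) = (\<integral>x. f x \<partial>(distr lborel borel ((+) c)))" by (simp add: lborel_distr_plus)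
  also have "\<dots> = (\<integral>x. f (c + x) \<partial>lborel)" by (rule integral_distr) (use assms in simp_all)
  finally show ?thesis by (simp add: add.commute)
qed

lemma integrable_indicator_cball: "integrable lborel (\<lambda>x::'a::euclidean_space. c * indicator (cball a R) x :: real)"
  using emeasure_lborel_cball_finite[of a R] by (intro integrable_mult_right integrable_real_indicator) simp_all

text \<open>A translation by h is a chain of n + 1 translations by h / (n + 1), whose increments
  have equal norms by translation invariance. Hence the norm is at most that of every difference
  quotient, and letting n grow gives grad \<phi> . h without integration along segments.\<close>

lemma nrm2_translation_le:
  fixes \<phi> :: "real^'n::finite \<Rightarrow> real"
  assumes t: "test_fun \<Omega> \<phi>"
  shows "sqi lborel (\<lambda>x. \<phi> (x + h) - \<phi> x)"
    and "nrm2 lborel (\<lambda>x. \<phi> (x + h) - \<phi> x) \<le> norm h * nrm2 lborel (grad \<phi>)"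
proof -
  have c: "continuous_on UNIV \<phi>" by (rule smooth_continuous[OF test_fun_smooth[OF t]])
  then have [measurable]: "\<phi> \<in> borel_measurable borel" by (rule borel_measurable_continuous_onI)
  obtain K where K: "compact K" "\<And>x. x \<notin> K \<Longrightarrow> \<phi> x = 0" using t by (metis test_funE)
  have tr: "sqi lborel (\<lambda>x. \<phi> (x + h))" for h
  proof (rule sqi_compact_support)
    show "continuous_on UNIV (\<lambda>x. \<phi> (x + h))" by (rule continuous_on_compose2[OF c]) (auto intro!: continuous_intros)
    show "compact ((\<lambda>x. x - h) ` K)" by (intro compact_continuous_image K continuous_intros)
    show "\<phi> (x + h) = 0" if "x \<notin> (\<lambda>x. x - h) ` K" for x
      using that K(2)[of "x + h"] by (metis add_diff_cancel_right' imageI)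
  qed
  show s: "sqi lborel (\<lambda>x. \<phi> (x + h) - \<phi> x)" for h
    using sqi_diff[OF tr[of h] tr[of 0]] by simp
  have mult: "nrm2 lborel (\<lambda>x. \<phi> (x + real k *\<^sub>R u) - \<phi> x) \<le> real k * nrm2 lborel (\<lambda>x. \<phi> (x + u) - \<phi> x)" for k u
  proof (induction k)
    case 0
    then show ?case by (simp add: nrm2_def)
  next
    case (Suc k)
    have "nrm2 lborel (\<lambda>x. \<phi> (x + real (Suc k) *\<^sub>R u) - \<phi> x)
      \<le> nrm2 lborel (\<lambda>x. \<phi> (x + real (Suc k) *\<^sub>R u) - \<phi> (x + real k *\<^sub>R u)) + nrm2 lborel (\<lambda>x. \<phi> (x + real k *\<^sub>R u) - \<phi> x)"
      using nrm2_triangle3[OF tr[of "real (Suc k) *\<^sub>R u"] tr[of "real k *\<^sub>R u"] tr[of 0]] by simp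
    also have "nrm2 lborel (\<lambda>x. \<phi> (x + real (Suc k) *\<^sub>R u) - \<phi> (x + real k *\<^sub>R u)) = nrm2 lborel (\<lambda>x. \<phi> (x + u) - \<phi> x)"
      using lborel_integral_translate[of "\<lambda>x. (norm (\<phi> (x + u) - \<phi> x))\<^sup>2" "real k *\<^sub>R u"]
      unfolding nrm2_def by (simp add: algebra_simps)
    finally show ?case using Suc.IH by (simp add: algebra_simps)
  qed
  obtain B R where B: "B \<ge> 0" "\<And>n x. \<bar>dquot n h \<phi> x\<bar> \<le> B * indicator (cball 0 R) x"
    by (rule dquot_bound[OF t]) blast
  have gm: "grad \<phi> \<in> borel_measurable borel"
    by (rule borel_measurable_continuous_onI[OF smooth_grad_continuous[OF test_fun_smooth[OF t]]])
  have "(\<lambda>n. \<integral>x. (norm (dquot n h \<phi> x))\<^sup>2 \<partial>lborel) \<longlonglongrightarrow> (\<integral>x. (norm (grad \<phi> x \<bullet> h))\<^sup>2 \<partial>lborel)"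
  proof (rule integral_dominated_convergence[where w="\<lambda>x. B\<^sup>2 * indicator (cball 0 R) x"])
    show "(\<lambda>x. (norm (grad \<phi> x \<bullet> h))\<^sup>2) \<in> borel_measurable lborel" using gm by measurable
    show "(\<lambda>x. (norm (dquot n h \<phi> x))\<^sup>2) \<in> borel_measurable lborel" for n unfolding dquot_def by measurable
    show "integrable lborel (\<lambda>x::real^'n. B\<^sup>2 * indicator (cball 0 R) x)" by (rule integrable_indicator_cball)
    show "AE x in lborel. (\<lambda>n. (norm (dquot n h \<phi> x))\<^sup>2) \<longlonglongrightarrow> (norm (grad \<phi> x \<bullet> h))\<^sup>2"
      by (intro AE_I2 tendsto_intros dquot_tendsto test_fun_smooth[OF t])
    show "AE x in lborel. norm ((norm (dquot n h \<phi> x))\<^sup>2) \<le> B\<^sup>2 * indicator (cball 0 R) x" for n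
    proof (rule AE_I2)
      fix x
      show "norm ((norm (dquot n h \<phi> x))\<^sup>2) \<le> B\<^sup>2 * indicator (cball 0 R) x"
        using power_mono[OF B(2)[of n x], of 2] by (auto simp: indicator_def split: if_splits)
    qed
  qed
  from tendsto_real_sqrt[OF this] have lim: "(\<lambda>n. nrm2 lborel (dquot n h \<phi>)) \<longlonglongrightarrow> nrm2 lborel (\<lambda>x. grad \<phi> x \<bullet> h)"
    by (simp add: nrm2_def)
  have "nrm2 lborel (\<lambda>x. \<phi> (x + h) - \<phi> x) \<le> nrm2 lborel (dquot n h \<phi>)" for n
  proof -
    have "nrm2 lborel (dquot n h \<phi>) = real (Suc n) * nrm2 lborel (\<lambda>x. \<phi> (x + (1 / real (Suc n)) *\<^sub>R h) - \<phi> x)"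
      unfolding dquot_def using nrm2_scaleR[of lborel "real (Suc n)" "\<lambda>x. \<phi> (x + (1 / real (Suc n)) *\<^sub>R h) - \<phi> x"]
      by (simp add: mult.commute)
    then show ?thesis using mult[of "Suc n" "(1 / real (Suc n)) *\<^sub>R h"] by simp
  qed
  then have "nrm2 lborel (\<lambda>x. \<phi> (x + h) - \<phi> x) \<le> nrm2 lborel (\<lambda>x. grad \<phi> x \<bullet> h)"
    by (intro LIMSEQ_le_const[OF lim]) auto
  also have "\<dots> \<le> norm h * nrm2 lborel (grad \<phi>)"
  proof (rule nrm2_bound[OF sqi_test_fun(2)[OF t]])
    show "(\<lambda>x. grad \<phi> x \<bullet> h) \<in> borel_measurable lborel" using gm by measurable
    show "AE x in lborel. norm (grad \<phi> x \<bullet> h) \<le> norm h * norm (grad \<phi> x)"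
      by (rule AE_I2) (metis Cauchy_Schwarz_ineq2 mult.commute real_norm_def)
  qed simp
  finally show "nrm2 lborel (\<lambda>x. \<phi> (x + h) - \<phi> x) \<le> norm h * nrm2 lborel (grad \<phi>)" .
qed

lemma dquot_inner_tendsto:
  fixes \<phi> \<psi> :: "real^'n::finite \<Rightarrow> real"
  assumes t: "test_fun \<Omega> \<phi>" "test_fun \<Omega> \<psi>"
  shows "(\<lambda>n. \<integral>x. dquot n h \<phi> x * dquot n k \<psi> x \<partial>lborel) \<longlonglongrightarrow> (\<integral>x. (grad \<phi> x \<bullet> h) * (grad \<psi> x \<bullet> k) \<partial>lborel)"
proof -
  obtain B R where B: "B \<ge> 0" "\<And>n x. \<bar>dquot n h \<phi> x\<bar> \<le> B * indicator (cball 0 R) x"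
    by (rule dquot_bound[OF t(1)]) blast
  obtain B' R' where B': "B' \<ge> 0" "\<And>n x. \<bar>dquot n k \<psi> x\<bar> \<le> B' * indicator (cball 0 R') x"
    by (rule dquot_bound[OF t(2)]) blast
  note sm = t[THEN test_fun_smooth]
  note [measurable] = borel_measurable_continuous_onI[OF smooth_continuous[OF sm(1)]]
    borel_measurable_continuous_onI[OF smooth_continuous[OF sm(2)]]
    borel_measurable_continuous_onI[OF smooth_grad_continuous[OF sm(1)]]
    borel_measurable_continuous_onI[OF smooth_grad_continuous[OF sm(2)]]
  show ?thesis
  proof (rule integral_dominated_convergence[where w="\<lambda>x. (B * B') * indicator (cball 0 R) x"])
    show "(\<lambda>x. (grad \<phi> x \<bullet> h) * (grad \<psi> x \<bullet> k)) \<in> borel_measurable lborel" by measurable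
    show "(\<lambda>x. dquot n h \<phi> x * dquot n k \<psi> x) \<in> borel_measurable lborel" for n unfolding dquot_def by measurable
    show "integrable lborel (\<lambda>x::real^'n. (B * B') * indicator (cball 0 R) x)" by (rule integrable_indicator_cball)
    show "AE x in lborel. (\<lambda>n. dquot n h \<phi> x * dquot n k \<psi> x) \<longlonglongrightarrow> (grad \<phi> x \<bullet> h) * (grad \<psi> x \<bullet> k)"
      by (intro AE_I2 tendsto_intros dquot_tendsto sm)
    show "AE x in lborel. norm (dquot n h \<phi> x * dquot n k \<psi> x) \<le> (B * B') * indicator (cball 0 R) x" for n
    proof (rule AE_I2)
      fix x
      have "\<bar>dquot n h \<phi> x\<bar> * \<bar>dquot n k \<psi> x\<bar> \<le> (B * indicator (cball 0 R) x) * (B' * indicator (cball 0 R') x)"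
        by (intro mult_mono B B') (use B in auto)
      also have "\<dots> \<le> (B * B') * indicator (cball 0 R) x" using B(1) B'(1) by (auto simp: indicator_def)
      finally show "norm (dquot n h \<phi> x * dquot n k \<psi> x) \<le> (B * B') * indicator (cball 0 R) x" by (simp add: abs_mult)
    qed
  qed
qed

text \<open>Discrete derivatives can be moved between the factors by translation invariance, so no second
  derivatives are needed.\<close>
lemma integral_grad_swap:
  fixes \<phi> \<psi> :: "real^'n::finite \<Rightarrow> real"
  assumes t: "test_fun \<Omega> \<phi>" "test_fun \<Omega> \<psi>"
  shows "(\<integral>x. (grad \<phi> x \<bullet> h) * (grad \<psi> x \<bullet> k) \<partial>lborel) = (\<integral>x. (grad \<phi> x \<bullet> k) * (grad \<psi> x \<bullet> h) \<partial>lborel)"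
proof -
  note sm = t[THEN test_fun_smooth]
  note [measurable] = borel_measurable_continuous_onI[OF smooth_continuous[OF sm(1)]]
    borel_measurable_continuous_onI[OF smooth_continuous[OF sm(2)]]
  \<comment> \<open>The correlation function of \<phi> and \<psi>: by translation invariance every
    product of increments integrates to a combination of its values.\<close>
  define C where "C a = (\<integral>x. \<phi> (x + a) * \<psi> x \<partial>lborel)" for a
  have shift: "sqi lborel (\<lambda>x. \<eta> (x + a))" if "test_fun \<Omega> \<eta>" for \<eta> :: "real^'n \<Rightarrow> real" and a
    using sqi_add[OF nrm2_translation_le(1)[OF that, of a] sqi_test_fun(1)[OF that]] by simp
  have int: "integrable lborel (\<lambda>x. \<phi> (x + a) * \<psi> (x + b))" for a b
    using sqi_inner_integrable[OF shift[OF t(1)] shift[OF t(2)], of a b] by simp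
  have C: "(\<integral>x. \<phi> (x + a) * \<psi> (x + b) \<partial>lborel) = C (a - b)" for a b
    using lborel_integral_translate[of "\<lambda>x. \<phi> (x + (a - b)) * \<psi> x" b] unfolding C_def by (simp add: algebra_simps)
  have prod: "(\<integral>x. (\<phi> (x + a) - \<phi> x) * (\<psi> (x + b) - \<psi> x) \<partial>lborel) = C (a - b) - C a - C (- b) + C 0" for a b
  proof -
    have "(\<integral>x. (\<phi> (x + a) - \<phi> x) * (\<psi> (x + b) - \<psi> x) \<partial>lborel)
      = (\<integral>x. \<phi> (x + a) * \<psi> (x + b) - \<phi> (x + a) * \<psi> (x + 0) - \<phi> (x + 0) * \<psi> (x + b) + \<phi> (x + 0) * \<psi> (x + 0) \<partial>lborel)"
      by (simp add: algebra_simps)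
    also have "\<dots> = C (a - b) - C a - C (- b) + C 0"
      using int[of a b] int[of a 0] int[of 0 b] int[of 0 0] C[of a b] C[of a 0] C[of 0 b] C[of 0 0] by simp
    finally show ?thesis .
  qed
  \<comment> \<open>Replacing (a, b) by (-b, -a) keeps a - b and exchanges C a with C (-b). The two
    sign changes cancel in the limit, where the quotients become linear in the directions.\<close>
  have eq: "(\<integral>x. dquot n h \<phi> x * dquot n k \<psi> x \<partial>lborel) = (\<integral>x. dquot n (- k) \<phi> x * dquot n (- h) \<psi> x \<partial>lborel)" for n
  proof -
    have "(\<integral>x. dquot n h \<phi> x * dquot n k \<psi> x \<partial>lborel)
      = (real (Suc n))\<^sup>2 * (\<integral>x. (\<phi> (x + (1 / real (Suc n)) *\<^sub>R h) - \<phi> x) * (\<psi> (x + (1 / real (Suc n)) *\<^sub>R k) - \<psi> x) \<partial>lborel)" for h k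
      unfolding integral_mult_right_zero[symmetric] dquot_def by (simp add: power2_eq_square mult_ac)
    note P = this[unfolded prod]
    show ?thesis unfolding P[of h k] P[of "- k" "- h"] by (simp add: algebra_simps)
  qed
  have "(\<lambda>n. \<integral>x. dquot n h \<phi> x * dquot n k \<psi> x \<partial>lborel) \<longlonglongrightarrow> (\<integral>x. (grad \<phi> x \<bullet> (- k)) * (grad \<psi> x \<bullet> (- h)) \<partial>lborel)"
    unfolding eq by (rule dquot_inner_tendsto[OF t])
  from LIMSEQ_unique[OF dquot_inner_tendsto[OF t] this] show ?thesis by simp
qed

section \<open>The space H10 and weak solutions\<close>

text \<open>The bridge between the domain and the whole space, where translations are available.
  Borel measurability allows the completed measure to be replaced by \<open>lborel\<close>.\<close>

lemma lebesgue_on_vanishing: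
  fixes f :: "real^'n::finite \<Rightarrow> 'b::euclidean_space"
  assumes S: "S \<in> sets lebesgue" and f: "f \<in> borel_measurable borel" and z: "\<And>x. x \<notin> S \<Longrightarrow> f x = 0"
  shows "integral\<^sup>L (lebesgue_on S) f = integral\<^sup>L lborel f"
    and "integrable (lebesgue_on S) f \<longleftrightarrow> integrable lborel f"
proof -
  have eq: "(\<lambda>x. indicator S x *\<^sub>R f x) = f" using z by (auto simp: indicator_def fun_eq_iff)
  have S': "S \<inter> space lebesgue \<in> sets lebesgue" using S by simp
  show "integral\<^sup>L (lebesgue_on S) f = integral\<^sup>L lborel f"
    using integral_restrict_space[OF S', of f] integral_completion[of f lborel] f by (simp add: eq)
  show "integrable (lebesgue_on S) f \<longleftrightarrow> integrable lborel f"
    using integrable_restrict_space[OF S', of f] integrable_completion[of f lborel] f by (simp add: eq)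
qed

lemma sqi_lebesgue_on_vanishing:
  fixes f :: "real^'n::finite \<Rightarrow> 'b::euclidean_space"
  assumes S: "S \<in> sets lebesgue" and f: "sqi lborel f" and z: "\<And>x. x \<notin> S \<Longrightarrow> f x = 0"
  shows "sqi (lebesgue_on S) f" "nrm2 (lebesgue_on S) f = nrm2 lborel f"
proof -
  have m: "f \<in> borel_measurable borel" using sqi_measurable[OF f] by simp
  then have m2: "(\<lambda>x. (norm (f x))\<^sup>2) \<in> borel_measurable borel" by measurable
  have "f \<in> borel_measurable (lebesgue_on S)"
    using m by (intro measurable_restrict_space1 measurable_completion) simp
  with lebesgue_on_vanishing(2)[OF S m2] f z show "sqi (lebesgue_on S) f" by (simp add: sqi_def)
  show "nrm2 (lebesgue_on S) f = nrm2 lborel f"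
    using lebesgue_on_vanishing(1)[OF S m2] z by (simp add: nrm2_def)
qed

lemma L2_iff_sqi: "L2 S f \<longleftrightarrow> sqi (lebesgue_on S) f" and L2v_iff_sqi: "L2v S G \<longleftrightarrow> sqi (lebesgue_on S) G"
  by (simp_all add: L2_def L2v_def sqi_def)

lemma H10_iff:
  "H10 \<Omega> y G \<longleftrightarrow> sqi (lebesgue_on \<Omega>) y \<and> sqi (lebesgue_on \<Omega>) G \<and>
     (\<exists>\<phi>. (\<forall>n. test_fun \<Omega> (\<phi> n)) \<and> (\<lambda>n. nrm2 (lebesgue_on \<Omega>) (\<lambda>x. \<phi> n x - y x)) \<longlonglongrightarrow> 0 \<and>
        (\<lambda>n. nrm2 (lebesgue_on \<Omega>) (\<lambda>x. grad (\<phi> n) x - G x)) \<longlonglongrightarrow> 0)"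
  by (simp add: H10_def L2_iff_sqi L2v_iff_sqi nrm2_tendsto0_iff)

lemma H10D: "H10 \<Omega> y G \<Longrightarrow> sqi (lebesgue_on \<Omega>) y" "H10 \<Omega> y G \<Longrightarrow> sqi (lebesgue_on \<Omega>) G"
  by (simp_all add: H10_iff)

lemma sqi_test_fun_on:
  assumes "open \<Omega>" "test_fun \<Omega> \<phi>"
  shows "sqi (lebesgue_on \<Omega>) \<phi>" "sqi (lebesgue_on \<Omega>) (grad \<phi>)"
    "nrm2 (lebesgue_on \<Omega>) \<phi> = nrm2 lborel \<phi>" "nrm2 (lebesgue_on \<Omega>) (grad \<phi>) = nrm2 lborel (grad \<phi>)"
proof -
  have S: "\<Omega> \<in> sets lebesgue" using borel_open[OF assms(1)] by (simp add: sets_completionI_sets)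
  obtain K where "K \<subseteq> \<Omega>" "\<And>x. x \<notin> K \<Longrightarrow> \<phi> x = 0" "\<And>x. x \<notin> K \<Longrightarrow> grad \<phi> x = 0" using assms by (metis test_funE)
  then have z: "\<And>x. x \<notin> \<Omega> \<Longrightarrow> \<phi> x = 0" "\<And>x. x \<notin> \<Omega> \<Longrightarrow> grad \<phi> x = 0" by blast+
  show "sqi (lebesgue_on \<Omega>) \<phi>" "nrm2 (lebesgue_on \<Omega>) \<phi> = nrm2 lborel \<phi>"
    using sqi_lebesgue_on_vanishing[OF S sqi_test_fun(1)[OF assms(2)] z(1)] by auto
  show "sqi (lebesgue_on \<Omega>) (grad \<phi>)" "nrm2 (lebesgue_on \<Omega>) (grad \<phi>) = nrm2 lborel (grad \<phi>)"
    using sqi_lebesgue_on_vanishing[OF S sqi_test_fun(2)[OF assms(2)] z(2)] by auto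
qed

lemma H10_test_fun: "open \<Omega> \<Longrightarrow> test_fun \<Omega> \<phi> \<Longrightarrow> H10 \<Omega> \<phi> (grad \<phi>)"
  unfolding H10_iff using sqi_test_fun_on[of \<Omega> \<phi>]
  by (auto intro!: exI[of _ "\<lambda>n. \<phi>"] simp: nrm2_def)

lemma H10_approx:
  assumes "H10 \<Omega> y G"
  obtains \<phi> where "\<And>n. test_fun \<Omega> (\<phi> n)" "(\<lambda>n. nrm2 (lebesgue_on \<Omega>) (\<lambda>x. \<phi> n x - y x)) \<longlonglongrightarrow> 0"
    "(\<lambda>n. nrm2 (lebesgue_on \<Omega>) (\<lambda>x. grad (\<phi> n) x - G x)) \<longlonglongrightarrow> 0"
  using assms unfolding H10_iff by blast

lemma H10_add_scaled:
  assumes o: "open \<Omega>" and u: "H10 \<Omega> u Gu" and v: "H10 \<Omega> v Gv"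
  shows "H10 \<Omega> (\<lambda>x. u x + c * v x) (\<lambda>x. Gu x + c *\<^sub>R Gv x)"
proof -
  let ?M = "lebesgue_on \<Omega>"
  obtain \<phi> where \<phi>: "\<And>n. test_fun \<Omega> (\<phi> n)" "(\<lambda>n. nrm2 ?M (\<lambda>x. \<phi> n x - u x)) \<longlonglongrightarrow> 0"
    "(\<lambda>n. nrm2 ?M (\<lambda>x. grad (\<phi> n) x - Gu x)) \<longlonglongrightarrow> 0" by (rule H10_approx[OF u]) blast
  obtain \<psi> where \<psi>: "\<And>n. test_fun \<Omega> (\<psi> n)" "(\<lambda>n. nrm2 ?M (\<lambda>x. \<psi> n x - v x)) \<longlonglongrightarrow> 0"
    "(\<lambda>n. nrm2 ?M (\<lambda>x. grad (\<psi> n) x - Gv x)) \<longlonglongrightarrow> 0" by (rule H10_approx[OF v]) blast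
  note s = sqi_test_fun_on(1)[OF o \<phi>(1)] sqi_test_fun_on(2)[OF o \<phi>(1)] sqi_test_fun_on(1)[OF o \<psi>(1)] sqi_test_fun_on(2)[OF o \<psi>(1)]
  have comb: "(\<lambda>n. nrm2 ?M (\<lambda>x. (a n x + c *\<^sub>R b n x) - (f x + c *\<^sub>R g x))) \<longlonglongrightarrow> 0"
    if "\<And>n. sqi ?M (\<lambda>x. a n x - f x)" "\<And>n. sqi ?M (\<lambda>x. b n x - g x)"
      "(\<lambda>n. nrm2 ?M (\<lambda>x. a n x - f x)) \<longlonglongrightarrow> 0" "(\<lambda>n. nrm2 ?M (\<lambda>x. b n x - g x)) \<longlonglongrightarrow> 0"
    for a b :: "nat \<Rightarrow> real^'a \<Rightarrow> 'b::euclidean_space" and f g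
  proof (rule Lim_null_comparison)
    have "nrm2 ?M (\<lambda>x. (a n x + c *\<^sub>R b n x) - (f x + c *\<^sub>R g x)) \<le> nrm2 ?M (\<lambda>x. a n x - f x) + \<bar>c\<bar> * nrm2 ?M (\<lambda>x. b n x - g x)" for n
      using nrm2_triangle[OF that(1)[of n] sqi_scaleR[OF that(2)[of n], of c]] nrm2_scaleR[of ?M c "\<lambda>x. b n x - g x"]
      by (simp add: algebra_simps)
    then show "\<forall>\<^sub>F n in sequentially. norm (nrm2 ?M (\<lambda>x. (a n x + c *\<^sub>R b n x) - (f x + c *\<^sub>R g x)))
      \<le> nrm2 ?M (\<lambda>x. a n x - f x) + \<bar>c\<bar> * nrm2 ?M (\<lambda>x. b n x - g x)" by simp
    show "(\<lambda>n. nrm2 ?M (\<lambda>x. a n x - f x) + \<bar>c\<bar> * nrm2 ?M (\<lambda>x. b n x - g x)) \<longlonglongrightarrow> 0"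
      using tendsto_add[OF that(3) tendsto_mult_right_zero[OF that(4)]] by simp
  qed
  have g: "grad (\<lambda>x. \<phi> n x + c * \<psi> n x) x = grad (\<phi> n) x + c *\<^sub>R grad (\<psi> n) x" for n x
    using \<phi>(1)[of n] \<psi>(1)[of n] by (simp add: grad_add grad_cmult test_fun_smooth smooth_cmult)
  show ?thesis unfolding H10_iff
  proof (intro conjI exI allI)
    show "sqi ?M (\<lambda>x. u x + c * v x)" using sqi_add[OF H10D(1)[OF u] sqi_scaleR[OF H10D(1)[OF v], of c]] by simp
    show "sqi ?M (\<lambda>x. Gu x + c *\<^sub>R Gv x)" by (intro sqi_add sqi_scaleR H10D(2)[OF u] H10D(2)[OF v])
    show "test_fun \<Omega> (\<lambda>x. \<phi> n x + c * \<psi> n x)" for n by (intro test_fun_add test_fun_cmult \<phi> \<psi>)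
    show "(\<lambda>n. nrm2 ?M (\<lambda>x. \<phi> n x + c * \<psi> n x - (u x + c * v x))) \<longlonglongrightarrow> 0"
      using comb[OF sqi_diff[OF s(1) H10D(1)[OF u]] sqi_diff[OF s(3) H10D(1)[OF v]] \<phi>(2) \<psi>(2)] by simp
    show "(\<lambda>n. nrm2 ?M (\<lambda>x. grad (\<lambda>x. \<phi> n x + c * \<psi> n x) x - (Gu x + c *\<^sub>R Gv x))) \<longlonglongrightarrow> 0"
      unfolding g by (rule comb[OF sqi_diff[OF s(2) H10D(2)[OF u]] sqi_diff[OF s(4) H10D(2)[OF v]] \<phi>(3) \<psi>(3)])
  qed
qed

lemma H10_diff:
  assumes "open \<Omega>" "H10 \<Omega> u Gu" "H10 \<Omega> v Gv"
  shows "H10 \<Omega> (\<lambda>x. u x - v x) (\<lambda>x. Gu x - Gv x)"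
  using H10_add_scaled[OF assms, of "-1"] by simp

text \<open>A translation by more than the diameter moves the support off itself, so the translation
  estimate contains the Poincare inequality.\<close>
lemma poincare_test_fun:
  fixes \<Omega> :: "(real^'n::finite) set"
  assumes "open \<Omega>" "bounded \<Omega>"
  obtains P where "P > 0" "\<And>\<phi>. test_fun \<Omega> \<phi> \<Longrightarrow> nrm2 (lebesgue_on \<Omega>) \<phi> \<le> P * nrm2 (lebesgue_on \<Omega>) (grad \<phi>)"
proof -
  obtain R where R: "R > 0" "\<And>x. x \<in> \<Omega> \<Longrightarrow> norm x \<le> R" using assms(2) by (auto simp: bounded_pos)
  \<comment> \<open>A vector longer than the diameter bound 2 R, in an arbitrary coordinate
    direction: if \<phi> x is nonzero, then x + h has norm at least R + 1.\<close>
  define h :: "real^'n" where "h = (2 * R + 1) *\<^sub>R axis undefined 1"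
  have nh: "norm h = 2 * R + 1" using R(1) by (simp add: h_def norm_axis_1)
  have "nrm2 (lebesgue_on \<Omega>) \<phi> \<le> (2 * R + 1) * nrm2 (lebesgue_on \<Omega>) (grad \<phi>)" if t: "test_fun \<Omega> \<phi>" for \<phi>
  proof -
    have z: "\<phi> x = 0" if "x \<notin> \<Omega>" for x using t that by (metis test_funE subsetD)
    have "nrm2 lborel \<phi> \<le> 1 * nrm2 lborel (\<lambda>x. \<phi> (x + h) - \<phi> x)"
    proof (rule nrm2_bound[OF nrm2_translation_le(1)[OF t]])
      show "\<phi> \<in> borel_measurable lborel" using sqi_test_fun(1)[OF t] by (rule sqi_measurable)
      show "AE x in lborel. norm (\<phi> x) \<le> 1 * norm (\<phi> (x + h) - \<phi> x)"
      proof (rule AE_I2)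
        fix x
        show "norm (\<phi> x) \<le> 1 * norm (\<phi> (x + h) - \<phi> x)"
        proof (cases "\<phi> x = 0")
          case False
          then have "norm x \<le> R" using z R by blast
          then have "norm (x + h) > R" using norm_triangle_ineq2[of h "-x"] nh by (simp add: add.commute)
          then have "\<phi> (x + h) = 0" using z R by (meson not_le)
          then show ?thesis by simp
        qed simp
      qed
    qed simp
    also have "\<dots> \<le> (2 * R + 1) * nrm2 lborel (grad \<phi>)" using nrm2_translation_le(2)[OF t, of h] nh by simp
    finally show ?thesis using sqi_test_fun_on[OF assms(1) t] by simp
  qed
  then show thesis using that[of "2 * R + 1"] R by simp
qed

text \<open>Poincare's inequality makes the functions a Cauchy sequence as soon as their gradients
  are one, so the two limits satisfy the closure definition of \<open>H10\<close> with the same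
  approximating sequence.\<close>

lemma H10_complete:
  fixes \<Omega> :: "(real^'n::finite) set"
  assumes o: "open \<Omega>" and b: "bounded \<Omega>" and t: "\<And>n. test_fun \<Omega> (\<phi> n)"
    and cauchy: "\<And>e. e > 0 \<Longrightarrow> \<exists>N. \<forall>m\<ge>N. \<forall>n\<ge>N. nrm2 (lebesgue_on \<Omega>) (\<lambda>x. grad (\<phi> m) x - grad (\<phi> n) x) \<le> e"
  obtains u G where "H10 \<Omega> u G" "(\<lambda>n. nrm2 (lebesgue_on \<Omega>) (\<lambda>x. grad (\<phi> n) x - G x)) \<longlonglongrightarrow> 0"
proof -
  let ?M = "lebesgue_on \<Omega>"
  obtain P where P: "P > 0" "\<And>\<phi>. test_fun \<Omega> \<phi> \<Longrightarrow> nrm2 ?M \<phi> \<le> P * nrm2 ?M (grad \<phi>)"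
    by (rule poincare_test_fun[OF o b]) blast
  have "nrm2 ?M (\<lambda>x. \<phi> m x - \<phi> n x) \<le> P * nrm2 ?M (\<lambda>x. grad (\<phi> m) x - grad (\<phi> n) x)" for m n
  proof -
    have "grad (\<lambda>x. \<phi> m x + (-1) * \<phi> n x) x = grad (\<phi> m) x + (-1) *\<^sub>R grad (\<phi> n) x" for x
      unfolding grad_add[OF test_fun_smooth[OF t] smooth_cmult[OF test_fun_smooth[OF t]]] grad_cmult[OF test_fun_smooth[OF t]] ..
    then have "grad (\<lambda>x. \<phi> m x - \<phi> n x) = (\<lambda>x. grad (\<phi> m) x - grad (\<phi> n) x)" by (simp add: fun_eq_iff)
    then show ?thesis using P(2)[OF test_fun_add[OF t test_fun_cmult[OF t, of "-1"]], of m n] by simp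
  qed note le = this
  have "\<exists>f. sqi ?M f \<and> (\<lambda>n. nrm2 ?M (\<lambda>x. \<phi> n x - f x)) \<longlonglongrightarrow> 0"
  proof (rule sqi_complete[OF sqi_test_fun_on(1)[OF o t]])
    fix e :: real assume "e > 0"
    then obtain N where "\<forall>m\<ge>N. \<forall>n\<ge>N. nrm2 ?M (\<lambda>x. grad (\<phi> m) x - grad (\<phi> n) x) \<le> e / P"
      using cauchy[of "e / P"] P(1) by auto
    then have "P * nrm2 ?M (\<lambda>x. grad (\<phi> m) x - grad (\<phi> n) x) \<le> e" if "m \<ge> N" "n \<ge> N" for m n
      using that P(1) by (simp add: pos_le_divide_eq mult.commute)
    then have "\<forall>m\<ge>N. \<forall>n\<ge>N. nrm2 ?M (\<lambda>x. \<phi> m x - \<phi> n x) \<le> e"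
      using order_trans[OF le] by blast
    then show "\<exists>N. \<forall>m\<ge>N. \<forall>n\<ge>N. nrm2 ?M (\<lambda>x. \<phi> m x - \<phi> n x) \<le> e" by blast
  qed
  moreover have "\<exists>f. sqi ?M f \<and> (\<lambda>n. nrm2 ?M (\<lambda>x. grad (\<phi> n) x - f x)) \<longlonglongrightarrow> 0"
    by (rule sqi_complete[OF sqi_test_fun_on(2)[OF o t] cauchy])
  ultimately obtain u G where "sqi ?M u" "(\<lambda>n. nrm2 ?M (\<lambda>x. \<phi> n x - u x)) \<longlonglongrightarrow> 0"
    "sqi ?M G" "(\<lambda>n. nrm2 ?M (\<lambda>x. grad (\<phi> n) x - G x)) \<longlonglongrightarrow> 0" by blast
  then show thesis using that[of u G] t unfolding H10_iff by blast
qed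

lemma poincare_H10:
  fixes \<Omega> :: "(real^'n::finite) set"
  assumes o: "open \<Omega>" and b: "bounded \<Omega>"
  obtains P where "P > 0" "\<And>v G. H10 \<Omega> v G \<Longrightarrow> nrm2 (lebesgue_on \<Omega>) v \<le> P * nrm2 (lebesgue_on \<Omega>) G"
proof -
  let ?M = "lebesgue_on \<Omega>"
  obtain P where P: "P > 0" "\<And>\<phi>. test_fun \<Omega> \<phi> \<Longrightarrow> nrm2 ?M \<phi> \<le> P * nrm2 ?M (grad \<phi>)"
    by (rule poincare_test_fun[OF o b]) blast
  have "nrm2 ?M v \<le> P * nrm2 ?M G" if v: "H10 \<Omega> v G" for v G
  proof -
    obtain \<phi> where \<phi>: "\<And>n. test_fun \<Omega> (\<phi> n)" "(\<lambda>n. nrm2 ?M (\<lambda>x. \<phi> n x - v x)) \<longlonglongrightarrow> 0"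
      "(\<lambda>n. nrm2 ?M (\<lambda>x. grad (\<phi> n) x - G x)) \<longlonglongrightarrow> 0" by (rule H10_approx[OF v]) blast
    show ?thesis
    proof (rule LIMSEQ_le)
      show "(\<lambda>n. nrm2 ?M (\<phi> n)) \<longlonglongrightarrow> nrm2 ?M v"
        by (rule nrm2_tendsto[OF sqi_test_fun_on(1)[OF o \<phi>(1)] H10D(1)[OF v] \<phi>(2)])
      show "(\<lambda>n. P * nrm2 ?M (grad (\<phi> n))) \<longlonglongrightarrow> P * nrm2 ?M G"
        by (intro tendsto_intros nrm2_tendsto[OF sqi_test_fun_on(2)[OF o \<phi>(1)] H10D(2)[OF v] \<phi>(3)])
    qed (use P(2)[OF \<phi>(1)] in blast)
  qed
  with P(1) that show thesis by blast
qed


text \<open>The energy is minimised over test functions; the limit of a minimising sequence is the solution.\<close>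
theorem H10_weak_solution_exists:
  fixes \<Omega> :: "(real^'n::finite) set"
  assumes o: "open \<Omega>" and b: "bounded \<Omega>" and \<alpha>: "\<alpha> > 0"
    and c: "c \<in> borel_measurable (lebesgue_on \<Omega>)" "AE x in lebesgue_on \<Omega>. \<bar>c x\<bar> \<le> C" "AE x in lebesgue_on \<Omega>. \<alpha> \<le> c x"
    and q: "sqi (lebesgue_on \<Omega>) q"
  shows "\<exists>u G. H10 \<Omega> u G \<and> (\<forall>v Gv. H10 \<Omega> v Gv \<longrightarrow>
    (\<integral>x. c x * (G x \<bullet> Gv x) \<partial>lebesgue_on \<Omega>) = (\<integral>x. q x * v x \<partial>lebesgue_on \<Omega>))"
proof -
  let ?M = "lebesgue_on \<Omega>"
  define B where "B F G = (\<integral>x. c x * (F x \<bullet> G x) \<partial>?M)" for F G :: "real^'n \<Rightarrow> real^'n"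
  define l where "l v = (\<integral>x. q x * v x \<partial>?M)" for v
  obtain P where P: "P > 0" "\<And>\<phi>. test_fun \<Omega> \<phi> \<Longrightarrow> nrm2 ?M \<phi> \<le> P * nrm2 ?M (grad \<phi>)"
    by (rule poincare_test_fun[OF o b]) blast
  note st = sqi_test_fun_on(1)[OF o] note sg = sqi_test_fun_on(2)[OF o]
  have cs: "sqi ?M (\<lambda>x. c x *\<^sub>R F x)" if "sqi ?M F" for F :: "real^'n \<Rightarrow> real^'n" by (rule sqi_mult[OF that c(1,2)])
  have Bi: "integrable ?M (\<lambda>x. c x * (F x \<bullet> G x))" if "sqi ?M F" "sqi ?M G" for F G :: "real^'n \<Rightarrow> real^'n"
    using sqi_inner_integrable[OF cs[OF that(1)] that(2)] by simp
  have li: "integrable ?M (\<lambda>x. q x * v x)" if "sqi ?M v" for v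
    using sqi_inner_integrable[OF q that] by simp
  have Bcoer: "\<alpha> * (nrm2 ?M F)\<^sup>2 \<le> B F F" if "sqi ?M F" for F :: "real^'n \<Rightarrow> real^'n"
  proof -
    have "(\<integral>x. \<alpha> * (norm (F x))\<^sup>2 \<partial>?M) \<le> B F F" unfolding B_def
    proof (rule integral_mono_AE)
      show "integrable ?M (\<lambda>x. \<alpha> * (norm (F x))\<^sup>2)" using sqi_integrable[OF that] by simp
      show "AE x in ?M. \<alpha> * (norm (F x))\<^sup>2 \<le> c x * (F x \<bullet> F x)"
        using c(3) by eventually_elim (simp add: power2_norm_eq_inner mult_right_mono)
    qed (rule Bi[OF that that])
    then show ?thesis by (simp add: nrm2_sq)
  qed
  \<comment> \<open>The form is symmetric, so the weak equation is the Euler equation of this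
    energy.\<close>
  define Q where "Q \<phi> = B (grad \<phi>) (grad \<phi>) / 2 - l \<phi>" for \<phi>
  have Qexp: "Q (\<lambda>x. \<phi> x + t * \<psi> x) = Q \<phi> + t * (B (grad \<phi>) (grad \<psi>) - l \<psi>) + t\<^sup>2 * (B (grad \<psi>) (grad \<psi>) / 2)"
    if "test_fun \<Omega> \<phi>" "test_fun \<Omega> \<psi>" for \<phi> \<psi> t
  proof -
    have g: "grad (\<lambda>x. \<phi> x + t * \<psi> x) = (\<lambda>x. grad \<phi> x + t *\<^sub>R grad \<psi> x)"
      using that by (simp add: fun_eq_iff grad_add grad_cmult test_fun_smooth smooth_cmult)
    note i = Bi[OF sg[OF that(1)] sg[OF that(1)]] Bi[OF sg[OF that(1)] sg[OF that(2)]] Bi[OF sg[OF that(2)] sg[OF that(2)]]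
    have "B (grad (\<lambda>x. \<phi> x + t * \<psi> x)) (grad (\<lambda>x. \<phi> x + t * \<psi> x))
      = (\<integral>x. c x * (grad \<phi> x \<bullet> grad \<phi> x) + 2 * t * (c x * (grad \<phi> x \<bullet> grad \<psi> x)) + t\<^sup>2 * (c x * (grad \<psi> x \<bullet> grad \<psi> x)) \<partial>?M)"
      unfolding B_def g by (rule Bochner_Integration.integral_cong) (simp_all add: inner_add inner_commute algebra_simps power2_eq_square)
    also have "\<dots> = B (grad \<phi>) (grad \<phi>) + 2 * t * B (grad \<phi>) (grad \<psi>) + t\<^sup>2 * B (grad \<psi>) (grad \<psi>)"
      using i unfolding B_def by simp
    finally have 1: "B (grad (\<lambda>x. \<phi> x + t * \<psi> x)) (grad (\<lambda>x. \<phi> x + t * \<psi> x)) = \<dots>" .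
    have "l (\<lambda>x. \<phi> x + t * \<psi> x) = (\<integral>x. q x * \<phi> x + t * (q x * \<psi> x) \<partial>?M)"
      unfolding l_def by (rule Bochner_Integration.integral_cong) (simp_all add: algebra_simps)
    also have "\<dots> = l \<phi> + t * l \<psi>" using li[OF st[OF that(1)]] li[OF st[OF that(2)]] unfolding l_def by simp
    finally show ?thesis unfolding Q_def 1 by (simp add: field_simps)
  qed
  have bdd: "- ((nrm2 ?M q * P)\<^sup>2 / (2 * \<alpha>)) \<le> Q \<phi>" if t: "test_fun \<Omega> \<phi>" for \<phi>
  proof -
    let ?n = "nrm2 ?M (grad \<phi>)" and ?k = "nrm2 ?M q * P"
    have "l \<phi> \<le> nrm2 ?M q * nrm2 ?M \<phi>" using sqi_cs[OF q st[OF t]] by (simp add: l_def)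
    also have "\<dots> \<le> ?k * ?n" using mult_left_mono[OF P(2)[OF t], of "nrm2 ?M q"] by (simp add: mult.assoc)
    finally have "Q \<phi> \<ge> \<alpha> * ?n\<^sup>2 / 2 - ?k * ?n" using Bcoer[OF sg[OF t]] by (simp add: Q_def)
    \<comment> \<open>Completing the square bounds the energy from below.\<close>
    moreover have "\<alpha> * ?n\<^sup>2 / 2 - ?k * ?n + ?k\<^sup>2 / (2 * \<alpha>) = (\<alpha> * ?n - ?k)\<^sup>2 / (2 * \<alpha>)"
      using \<alpha> by (simp add: field_simps power2_eq_square)
    moreover have "(\<alpha> * ?n - ?k)\<^sup>2 / (2 * \<alpha>) \<ge> 0" using \<alpha> by simp
    ultimately show ?thesis by linarith
  qed
  define m where "m = Inf (Q ` {\<phi>. test_fun \<Omega> \<phi>})"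
  have ne: "test_fun \<Omega> (\<lambda>x. 0)" by (rule test_funI[of _ "{}"]) (auto intro: smooth_const)
  have below: "bdd_below (Q ` {\<phi>. test_fun \<Omega> \<phi>})" using bdd by (auto intro!: bdd_belowI)
  have m: "m \<le> Q \<phi>" if "test_fun \<Omega> \<phi>" for \<phi> unfolding m_def using that below by (auto intro: cInf_lower)
  have "\<exists>\<phi>. test_fun \<Omega> \<phi> \<and> Q \<phi> < m + 1 / real (Suc n)" for n
    using cInf_lessD[of "Q ` {\<phi>. test_fun \<Omega> \<phi>}" "m + 1 / real (Suc n)"] ne unfolding m_def by auto
  then obtain \<phi> where t: "\<And>n. test_fun \<Omega> (\<phi> n)" and Q\<phi>: "\<And>n. Q (\<phi> n) < m + 1 / real (Suc n)" by metis
  \<comment> \<open>Parallelogram argument: a quarter of B applied to the gradient of the difference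
    is Q (\<phi> i) + Q (\<phi> j) minus twice the energy of the midpoint, and the midpoint has
    energy at least m.\<close>
  have cau: "\<alpha> * (nrm2 ?M (\<lambda>x. grad (\<phi> j) x - grad (\<phi> i) x))\<^sup>2 \<le> 4 * (1 / real (Suc i) + 1 / real (Suc j))" for i j
  proof -
    define d where "d x = \<phi> j x + (-1) * \<phi> i x" for x
    have td: "test_fun \<Omega> d" unfolding d_def by (intro test_fun_add test_fun_cmult t)
    have gd: "grad d = (\<lambda>x. grad (\<phi> j) x - grad (\<phi> i) x)"
      using t[of i] t[of j] unfolding d_def fun_eq_iff
      by (simp only: grad_add grad_cmult test_fun_smooth smooth_cmult) simp
    have "Q (\<phi> j) = Q (\<lambda>x. \<phi> i x + 1 * d x)" by (simp add: d_def)
    also have "\<dots> = Q (\<phi> i) + 1 * (B (grad (\<phi> i)) (grad d) - l d) + 1\<^sup>2 * (B (grad d) (grad d) / 2)"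
      by (rule Qexp[OF t td])
    finally have "B (grad d) (grad d) / 4 = Q (\<phi> i) + Q (\<phi> j) - 2 * Q (\<lambda>x. \<phi> i x + (1/2) * d x)"
      using Qexp[OF t[of i] td, of "1/2"] by (simp add: field_simps power2_eq_square)
    also have "\<dots> \<le> 1 / real (Suc i) + 1 / real (Suc j)"
      using Q\<phi>[of i] Q\<phi>[of j] m[OF test_fun_add[OF t[of i] test_fun_cmult[OF td, of "1/2"]]] by linarith
    finally have le: "B (grad d) (grad d) / 4 \<le> 1 / real (Suc i) + 1 / real (Suc j)" .
    have "z \<le> 4 * y" if "x / 4 \<le> y" "z \<le> x" for x y z :: real using that by simp
    from this[OF le Bcoer[OF sg[OF td]]] show ?thesis unfolding gd .
  qed
  have "\<exists>N. \<forall>i\<ge>N. \<forall>j\<ge>N. nrm2 ?M (\<lambda>x. grad (\<phi> i) x - grad (\<phi> j) x) \<le> e" if e: "e > 0" for e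
  proof -
    \<comment> \<open>With this N both reciprocals in \<open>cau\<close> are at most \<alpha> e^2 /
      8, and 4 (1/8 + 1/8) = 1.\<close>
    obtain N where N: "8 / (\<alpha> * e\<^sup>2) < real N" using reals_Archimedean2 by blast
    have "nrm2 ?M (\<lambda>x. grad (\<phi> j) x - grad (\<phi> i) x) \<le> e" if "i \<ge> N" "j \<ge> N" for i j
    proof (rule power2_le_imp_le)
      have ae: "\<alpha> * e\<^sup>2 > 0" using \<alpha> e by simp
      have "8 < real (Suc k) * (\<alpha> * e\<^sup>2)" if "k \<ge> N" for k
      proof -
        have "8 < real N * (\<alpha> * e\<^sup>2)" using N ae by (simp add: pos_divide_less_eq)
        also have "\<dots> \<le> real (Suc k) * (\<alpha> * e\<^sup>2)" using that ae by (intro mult_right_mono) auto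
        finally show ?thesis .
      qed
      then have "1 / real (Suc k) \<le> (\<alpha> * e\<^sup>2) / 8" if "k \<ge> N" for k
        using that[THEN \<open>\<And>k. k \<ge> N \<Longrightarrow> 8 < real (Suc k) * (\<alpha> * e\<^sup>2)\<close>] by (simp add: field_simps)
      note small = this
      have "z \<le> w" if "z \<le> 4 * (x + y)" "x \<le> w / 8" "y \<le> w / 8" for x y z w :: real using that by simp
      from this[OF cau small[OF that(1)] small[OF that(2)]]
      have "\<alpha> * (nrm2 ?M (\<lambda>x. grad (\<phi> j) x - grad (\<phi> i) x))\<^sup>2 \<le> \<alpha> * e\<^sup>2" .
      then show "(nrm2 ?M (\<lambda>x. grad (\<phi> j) x - grad (\<phi> i) x))\<^sup>2 \<le> e\<^sup>2" using \<alpha> by simp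
    qed (use e in simp)
    then show ?thesis by blast
  qed
  obtain u G where u: "H10 \<Omega> u G"
    and lim: "(\<lambda>n. nrm2 ?M (\<lambda>x. grad (\<phi> n) x - G x)) \<longlonglongrightarrow> 0"
    by (rule H10_complete[OF o b t \<open>\<And>e. e > 0 \<Longrightarrow> \<exists>N. \<forall>i\<ge>N. \<forall>j\<ge>N. nrm2 ?M (\<lambda>x. grad (\<phi> i) x - grad (\<phi> j) x) \<le> e\<close>]) blast+
  have Bt: "(\<lambda>n. B (F n) H) \<longlonglongrightarrow> B F' H" if "\<And>n. sqi ?M (F n)" "sqi ?M F'" "sqi ?M H" "(\<lambda>n. nrm2 ?M (\<lambda>x. F n x - F' x)) \<longlonglongrightarrow> 0" for F F' H
    using sqi_tendsto_inner[OF that(1,2) cs[OF that(3)] that(4)] unfolding B_def by (simp add: mult.commute)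
  have eq_test: "B G (grad \<psi>) = l \<psi>" if \<psi>: "test_fun \<Omega> \<psi>" for \<psi>
  proof -
    let ?C = "B (grad \<psi>) (grad \<psi>) / 2"
    have "0 \<le> \<alpha> * (nrm2 ?M (grad \<psi>))\<^sup>2" using \<alpha> by simp
    from order_trans[OF this Bcoer[OF sg[OF \<psi>]]] have C0: "?C \<ge> 0" by simp
    \<comment> \<open>The parabola Q (\<phi> n - s \<psi>) - m in s is nonnegative, so its
      discriminant bounds the square of half the first variation by the gap Q (\<phi> n) - m times
      \<open>?C\<close>.\<close>
    have bound: "((B (grad (\<phi> n)) (grad \<psi>) - l \<psi>) / 2)\<^sup>2 \<le> 1 / real (Suc n) * ?C" for n
    proof -
      have "((B (grad (\<phi> n)) (grad \<psi>) - l \<psi>) / 2)\<^sup>2 \<le> (Q (\<phi> n) - m) * ?C"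
      proof (rule quad_nonneg_discr)
        fix s
        have "m \<le> Q (\<lambda>x. \<phi> n x + (- s) * \<psi> x)" by (intro m test_fun_add test_fun_cmult t \<psi>)
        also have "\<dots> = Q (\<phi> n) + (- s) * (B (grad (\<phi> n)) (grad \<psi>) - l \<psi>) + (- s)\<^sup>2 * ?C" by (rule Qexp[OF t \<psi>])
        finally show "0 \<le> Q (\<phi> n) - m - 2 * s * ((B (grad (\<phi> n)) (grad \<psi>) - l \<psi>) / 2) + s\<^sup>2 * ?C" by simp
      qed (rule C0)
      also have "\<dots> \<le> 1 / real (Suc n) * ?C" using Q\<phi>[of n] C0 by (intro mult_right_mono) auto
      finally show ?thesis .
    qed
    have "(\<lambda>n. ((B (grad (\<phi> n)) (grad \<psi>) - l \<psi>) / 2)\<^sup>2) \<longlonglongrightarrow> ((B G (grad \<psi>) - l \<psi>) / 2)\<^sup>2"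
      by (intro tendsto_intros Bt[OF sg[OF t] H10D(2)[OF u] sg[OF \<psi>] lim]) simp
    moreover have "(\<lambda>n. 1 / real (Suc n) * ?C) \<longlonglongrightarrow> 0"
      using tendsto_mult_left_zero[OF LIMSEQ_inverse_real_of_nat, of ?C] by (simp add: inverse_eq_divide)
    ultimately have "((B G (grad \<psi>) - l \<psi>) / 2)\<^sup>2 \<le> 0" using bound by (intro LIMSEQ_le) auto
    then show ?thesis by simp
  qed
  have "B G Gv = l v" if v: "H10 \<Omega> v Gv" for v Gv
  proof -
    obtain \<psi> where \<psi>: "\<And>n. test_fun \<Omega> (\<psi> n)" "(\<lambda>n. nrm2 ?M (\<lambda>x. \<psi> n x - v x)) \<longlonglongrightarrow> 0"
      "(\<lambda>n. nrm2 ?M (\<lambda>x. grad (\<psi> n) x - Gv x)) \<longlonglongrightarrow> 0" by (rule H10_approx[OF v]) blast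
    \<comment> \<open>Convergence of the form was shown in the first argument; symmetry moves the
      approximated test function there.\<close>
    have sym: "B F H = B H F" for F H unfolding B_def by (simp add: inner_commute)
    have "(\<lambda>n. B (grad (\<psi> n)) G) \<longlonglongrightarrow> B Gv G"
      by (rule Bt[OF sg[OF \<psi>(1)] H10D(2)[OF v] H10D(2)[OF u] \<psi>(3)])
    moreover have "(\<lambda>n. l (\<psi> n)) \<longlonglongrightarrow> l v"
      using sqi_tendsto_inner[OF st[OF \<psi>(1)] H10D(1)[OF v] q \<psi>(2)] unfolding l_def by (simp add: mult.commute)
    moreover have "B (grad (\<psi> n)) G = l (\<psi> n)" for n using eq_test[OF \<psi>(1)] sym[of "grad (\<psi> n)" G] by simp
    ultimately have "B Gv G = l v" by (simp add: LIMSEQ_unique)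
    then show ?thesis using sym[of G Gv] by simp
  qed
  with u show ?thesis unfolding B_def l_def by blast
qed

section \<open>Lebesgue points along a sequence of radii\<close>

lemma open_bounded_lebesgue_on:
  fixes \<Omega> :: "(real^'n::finite) set"
  assumes "open \<Omega>" "bounded \<Omega>"
  shows "\<Omega> \<in> sets lebesgue" "finite_measure (lebesgue_on \<Omega>)"
    "pair_sigma_finite (lebesgue_on \<Omega>) (lebesgue_on \<Omega>)"
proof -
  have "\<Omega> \<in> lmeasurable" using lmeasurable_open[OF assms(2,1)] .
  then show "\<Omega> \<in> sets lebesgue" and f: "finite_measure (lebesgue_on \<Omega>)"
    by (auto intro: finite_measure_lebesgue_on)
  interpret finite_measure "lebesgue_on \<Omega>" by (rule f)
  show "pair_sigma_finite (lebesgue_on \<Omega>) (lebesgue_on \<Omega>)"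
    by (simp add: pair_sigma_finite_def sigma_finite_measure_axioms)
qed

lemma borel_measurable_lebesgue_on:
  "f \<in> borel_measurable borel \<Longrightarrow> f \<in> borel_measurable (lebesgue_on S)"
  by (intro measurable_restrict_space1 measurable_completion) simp

lemma measure_ball_eq: "measure lborel (ball (x::'a) r) = measure lborel (ball (0::'a::euclidean_space) r)"
  by (cases "r \<ge> 0") (simp_all add: content_ball ball_empty)

lemma nn_integral_indicator_ball:
  fixes \<Omega> :: "(real^'n::finite) set"
  assumes "open \<Omega>" "bounded \<Omega>"
  shows "(\<integral>\<^sup>+x. indicator (ball z r) x \<partial>lebesgue_on \<Omega>) \<le> ennreal (measure lborel (ball (0::real^'n) r))"
proof -
  have "(\<integral>\<^sup>+x. indicator (ball z r) x \<partial>lebesgue_on \<Omega>) = (\<integral>\<^sup>+x. indicator (ball z r) x * indicator \<Omega> x \<partial>lebesgue)"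
    using open_bounded_lebesgue_on(1)[OF assms] by (subst nn_integral_restrict_space) auto
  also have "\<dots> \<le> (\<integral>\<^sup>+x. indicator (ball z r) x \<partial>lebesgue)"
    by (intro nn_integral_mono) (auto simp: indicator_def)
  also have "\<dots> = emeasure lborel (ball z r)" by simp
  also have "\<dots> = ennreal (measure lborel (ball z r))"
    by (rule emeasure_eq_ennreal_measure) (use emeasure_lborel_ball_finite[of z r] in auto)
  finally show ?thesis by (simp only: measure_ball_eq[of z r])
qed

text \<open>Measurability yields continuous functions converging almost everywhere, but without a
  majorant. A continuous truncation applied to both the function and its approximants bounds them,
  which suffices on a finite measure; the truncation level is fixed beforehand by dominated
  convergence with majorant |F|^2.\<close>

lemma sqi_continuous_approx:
  fixes F :: "real^'n::finite \<Rightarrow> 'b::euclidean_space"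
  assumes \<Omega>: "open \<Omega>" "bounded \<Omega>" and F: "sqi (lebesgue_on \<Omega>) F" and e: "e > 0"
  shows "\<exists>G. continuous_on UNIV G \<and> sqi (lebesgue_on \<Omega>) G \<and> nrm2 (lebesgue_on \<Omega>) (\<lambda>x. F x - G x) < e"
proof -
  let ?M = "lebesgue_on \<Omega>"
  interpret finite_measure ?M by (rule open_bounded_lebesgue_on[OF \<Omega>])
  note Fm[measurable] = sqi_measurable[OF F]
  \<comment> \<open>Radial projection onto the ball of radius N + 1: continuous, bounded, and the
    identity on that ball.\<close>
  define T where "T N v = (1 / max 1 (norm v / real (Suc N))) *\<^sub>R v" for N and v :: 'b
  have mx: "max 1 (norm v / real (Suc N)) > 0" for N and v :: 'b by (simp add: less_max_iff_disj)
  have Tc: "continuous_on UNIV (T N)" for N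
    unfolding T_def using mx by (intro continuous_intros) (auto simp: less_imp_neq[symmetric] simp del: of_nat_Suc)
  have Tb: "norm (T N v) \<le> real (Suc N)" for N v
  proof -
    have "norm v \<le> real (Suc N) * max 1 (norm v / real (Suc N))"
    proof (cases "norm v / real (Suc N) \<le> 1")
      case True then show ?thesis by (simp add: max_def field_simps)
    next
      case False then show ?thesis by (simp add: max_def field_simps)
    qed
    then show ?thesis using mx[of v N] by (simp add: T_def pos_divide_le_eq mult.commute)
  qed
  have T1: "norm (v - T N v) \<le> norm v" for N v
  proof -
    have "v - T N v = (1 - 1 / max 1 (norm v / real (Suc N))) *\<^sub>R v" by (simp add: T_def scaleR_diff_left)
    moreover have "0 \<le> 1 - 1 / max 1 (norm v / real (Suc N))" "1 - 1 / max 1 (norm v / real (Suc N)) \<le> 1"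
      using mx[of v N] by (auto simp: divide_simps)
    ultimately show ?thesis by (simp add: mult_left_le_one_le)
  qed
  have Tl: "(\<lambda>N. T N v) \<longlonglongrightarrow> v" for v
  proof -
    obtain K where K: "norm v \<le> real K" using real_arch_simple by blast
    have TK: "T N v = v" if "N \<ge> K" for N
    proof -
      have "norm v / real (Suc N) \<le> 1" using K that by (simp add: field_simps)
      then show ?thesis by (simp add: T_def max_def)
    qed
    then have "(\<lambda>N. T (N + K) v) \<longlonglongrightarrow> v" by simp
    then show ?thesis by (rule LIMSEQ_offset)
  qed
  have Tm[measurable]: "T N \<in> borel_measurable borel" for N by (rule borel_measurable_continuous_onI[OF Tc])
  have TF: "(\<lambda>x. T N (F x)) \<in> borel_measurable ?M" for N by measurable
  have "(\<lambda>N. \<integral>x. (norm (F x - T N (F x)))\<^sup>2 \<partial>?M) \<longlonglongrightarrow> (\<integral>x. 0 \<partial>?M)"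
  proof (rule integral_dominated_convergence[where w="\<lambda>x. (norm (F x))\<^sup>2"])
    show "(\<lambda>x. (norm (F x - T N (F x)))\<^sup>2) \<in> borel_measurable ?M" for N using TF[of N] by measurable
    show "AE x in ?M. (\<lambda>N. (norm (F x - T N (F x)))\<^sup>2) \<longlonglongrightarrow> 0"
      by (rule AE_I2, rule tendsto_eq_intros) (auto intro!: tendsto_eq_intros Tl)
    show "AE x in ?M. norm ((norm (F x - T N (F x)))\<^sup>2) \<le> (norm (F x))\<^sup>2" for N
      by (rule AE_I2) (simp add: T1 power_mono)
  qed (use sqi_integrable[OF F] in auto)
  then have "(\<lambda>N. nrm2 ?M (\<lambda>x. F x - T N (F x))) \<longlonglongrightarrow> 0" by (simp add: nrm2_tendsto0_iff)
  from order_tendstoD(2)[OF this, of "e/2"] obtain N where N: "nrm2 ?M (\<lambda>x. F x - T N (F x)) < e/2"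
    using e by (auto simp: eventually_at_top_linorder)
  have "F measurable_on \<Omega>" using Fm measurable_on_iff_borel_measurable open_bounded_lebesgue_on(1)[OF \<Omega>] by blast
  then obtain S g where S: "negligible S" and g: "\<And>n. continuous_on UNIV (g n)"
    and gl: "\<And>x. x \<notin> S \<Longrightarrow> (\<lambda>n. g n x) \<longlonglongrightarrow> (if x \<in> \<Omega> then F x else 0)" unfolding measurable_on_def by metis
  have TN: "continuous_on UNIV (\<lambda>x. T N (g n x))" for n by (rule continuous_on_compose2[OF Tc g]) auto
  have gm: "(\<lambda>x. T N (g n x)) \<in> borel_measurable ?M" for n
    by (rule borel_measurable_lebesgue_on[OF borel_measurable_continuous_onI[OF TN]])
  have bdd: "sqi ?M h" if "h \<in> borel_measurable ?M" "\<And>x. norm (h x) \<le> K" for h :: "real^'n \<Rightarrow> 'b" and K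
  proof -
    have "integrable ?M (\<lambda>x. (norm (h x))\<^sup>2)"
      by (rule integrable_const_bound[where B="K\<^sup>2"]) (use that in \<open>auto intro!: power_mono\<close>)
    with that show ?thesis by (simp add: sqi_def)
  qed
  have AES: "AE x in ?M. x \<notin> S"
    using S open_bounded_lebesgue_on(1)[OF \<Omega>]
    by (subst AE_restrict_space_iff) (auto simp: negligible_iff_null_sets intro: AE_not_in AE_mp)
  have "(\<lambda>n. \<integral>x. (norm (T N (F x) - T N (g n x)))\<^sup>2 \<partial>?M) \<longlonglongrightarrow> (\<integral>x. 0 \<partial>?M)"
  proof (rule integral_dominated_convergence[where w="\<lambda>x. (2 * real (Suc N))\<^sup>2"])
    show "(\<lambda>x. (norm (T N (F x) - T N (g n x)))\<^sup>2) \<in> borel_measurable ?M" for n using TF[of N] gm by measurable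
    show "AE x in ?M. (\<lambda>n. (norm (T N (F x) - T N (g n x)))\<^sup>2) \<longlonglongrightarrow> 0"
      using AES AE_space
    proof eventually_elim
      case (elim x)
      then have "(\<lambda>n. g n x) \<longlonglongrightarrow> F x" using gl[of x] by simp
      then have "(\<lambda>n. T N (g n x)) \<longlonglongrightarrow> T N (F x)"
        by (rule continuous_on_tendsto_compose[OF Tc]) auto
      from tendsto_power[OF tendsto_norm[OF tendsto_diff[OF tendsto_const[of "T N (F x)"] this]], of 2]
      show ?case by simp
    qed
    show "AE x in ?M. norm ((norm (T N (F x) - T N (g n x)))\<^sup>2) \<le> (2 * real (Suc N))\<^sup>2" for n
    proof (rule AE_I2)
      fix x
      have "norm (T N (F x) - T N (g n x)) \<le> real (Suc N) + real (Suc N)"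
        by (rule order_trans[OF norm_triangle_ineq4 add_mono[OF Tb Tb]])
      then have "(norm (T N (F x) - T N (g n x)))\<^sup>2 \<le> (2 * real (Suc N))\<^sup>2" by (intro power_mono) auto
      then show "norm ((norm (T N (F x) - T N (g n x)))\<^sup>2) \<le> (2 * real (Suc N))\<^sup>2" by simp
    qed
  qed auto
  then have "(\<lambda>n. nrm2 ?M (\<lambda>x. T N (F x) - T N (g n x))) \<longlonglongrightarrow> 0" by (simp add: nrm2_tendsto0_iff)
  from order_tendstoD(2)[OF this, of "e/2"] obtain n where n: "nrm2 ?M (\<lambda>x. T N (F x) - T N (g n x)) < e/2"
    using e by (auto simp: eventually_at_top_linorder)
  have s: "sqi ?M (\<lambda>x. T N (F x))" "sqi ?M (\<lambda>x. T N (g n x))"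
    by (rule bdd[OF TF Tb], rule bdd[OF gm Tb])
  from nrm2_triangle3[OF F s] N n have "nrm2 ?M (\<lambda>x. F x - T N (g n x)) < e" by simp
  then show ?thesis using TN s(2) by blast
qed

lemma measurable_indicator_ball_pair:
  fixes \<Omega> \<Omega>' :: "(real^'n::finite) set"
  shows "(\<lambda>(x, z). indicator (ball x r) z :: real) \<in> borel_measurable (lebesgue_on \<Omega> \<Otimes>\<^sub>M lebesgue_on \<Omega>')"
proof -
  have id: "(\<lambda>x. x) \<in> borel_measurable (lebesgue_on S)" for S :: "(real^'n) set"
    by (rule borel_measurable_lebesgue_on) simp
  have [measurable]: "(\<lambda>p. fst p) \<in> borel_measurable (lebesgue_on \<Omega> \<Otimes>\<^sub>M lebesgue_on \<Omega>')"
    "(\<lambda>p. snd p) \<in> borel_measurable (lebesgue_on \<Omega> \<Otimes>\<^sub>M lebesgue_on \<Omega>')"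
    using measurable_compose[OF measurable_fst id, of \<Omega> "lebesgue_on \<Omega>'"]
      measurable_compose[OF measurable_snd id, of "lebesgue_on \<Omega>" \<Omega>'] by simp_all
  have "(\<lambda>p. if dist (fst p) (snd p) < r then 1 else 0 :: real) \<in> borel_measurable (lebesgue_on \<Omega> \<Otimes>\<^sub>M lebesgue_on \<Omega>')"
    by measurable
  then show ?thesis by (simp add: case_prod_beta indicator_def)
qed

text \<open>By Tonelli's theorem and the symmetry between x and z in
  \<open>z \<in> ball x r\<close>, the weight of h z is the volume of a ball around z intersected
  with \<Omega>, which is bounded uniformly in z.\<close>

lemma nn_integral_ball_average_le:
  fixes \<Omega> :: "(real^'n::finite) set" and h :: "real^'n \<Rightarrow> real"
  assumes \<Omega>: "open \<Omega>" "bounded \<Omega>" and h: "h \<in> borel_measurable (lebesgue_on \<Omega>)"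
  shows "(\<lambda>x. \<integral>\<^sup>+z. ennreal (indicator (ball x r) z * h z) \<partial>lebesgue_on \<Omega>) \<in> borel_measurable (lebesgue_on \<Omega>)"
    and "(\<integral>\<^sup>+x. (\<integral>\<^sup>+z. ennreal (indicator (ball x r) z * h z) \<partial>lebesgue_on \<Omega>) \<partial>lebesgue_on \<Omega>)
      \<le> ennreal (measure lborel (ball (0::real^'n) r)) * (\<integral>\<^sup>+z. ennreal (h z) \<partial>lebesgue_on \<Omega>)"
proof -
  let ?M = "lebesgue_on \<Omega>"
  interpret finite_measure ?M by (rule open_bounded_lebesgue_on[OF \<Omega>])
  have sf: "sigma_finite_measure ?M" by (rule sigma_finite_measure_axioms)
  interpret pair_sigma_finite ?M ?M by (rule open_bounded_lebesgue_on[OF \<Omega>])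
  note [measurable] = measurable_indicator_ball_pair[of r \<Omega> \<Omega>, unfolded case_prod_beta] h
  have m: "(\<lambda>(x, z). ennreal (indicator (ball x r) z * h z)) \<in> borel_measurable (?M \<Otimes>\<^sub>M ?M)"
    unfolding case_prod_beta by measurable
  show "(\<lambda>x. \<integral>\<^sup>+z. ennreal (indicator (ball x r) z * h z) \<partial>?M) \<in> borel_measurable ?M"
    by (rule sigma_finite_measure.borel_measurable_nn_integral[OF sf m])
  have "(\<integral>\<^sup>+x. (\<integral>\<^sup>+z. ennreal (indicator (ball x r) z * h z) \<partial>?M) \<partial>?M)
    = (\<integral>\<^sup>+z. (\<integral>\<^sup>+x. ennreal (indicator (ball x r) z * h z) \<partial>?M) \<partial>?M)"
    by (rule Fubini'[OF m, symmetric])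
  also have "\<dots> \<le> (\<integral>\<^sup>+z. ennreal (measure lborel (ball (0::real^'n) r)) * ennreal (h z) \<partial>?M)"
  proof (rule nn_integral_mono)
    fix z
    have "(\<integral>\<^sup>+x. ennreal (indicator (ball x r) z * h z) \<partial>?M) = (\<integral>\<^sup>+x. indicator (ball z r) x * ennreal (h z) \<partial>?M)"
      by (intro nn_integral_cong) (auto simp: indicator_def dist_commute)
    also have "\<dots> = (\<integral>\<^sup>+x. indicator (ball z r) x \<partial>?M) * ennreal (h z)"
      by (rule nn_integral_multc) (intro borel_measurable_lebesgue_on borel_measurable_indicator, simp)
    also have "\<dots> \<le> ennreal (measure lborel (ball (0::real^'n) r)) * ennreal (h z)"
      by (intro mult_right_mono nn_integral_indicator_ball \<Omega>) simp
    finally show "(\<integral>\<^sup>+x. ennreal (indicator (ball x r) z * h z) \<partial>?M) \<le> \<dots>" .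
  qed
  also have "\<dots> = ennreal (measure lborel (ball (0::real^'n) r)) * (\<integral>\<^sup>+z. ennreal (h z) \<partial>?M)"
    by (rule nn_integral_cmult) measurable
  finally show "(\<integral>\<^sup>+x. (\<integral>\<^sup>+z. ennreal (indicator (ball x r) z * h z) \<partial>lebesgue_on \<Omega>) \<partial>lebesgue_on \<Omega>)
      \<le> ennreal (measure lborel (ball (0::real^'n) r)) * (\<integral>\<^sup>+z. ennreal (h z) \<partial>lebesgue_on \<Omega>)" .
qed

text \<open>The sum of the functions has finite integral, hence is finite almost everywhere, and the
  terms of a convergent series tend to 0.\<close>

lemma AE_tendsto_0_of_summable_integrals:
  fixes u :: "nat \<Rightarrow> 'a \<Rightarrow> ennreal"
  assumes u: "\<And>n. u n \<in> borel_measurable M" and le: "\<And>n. (\<integral>\<^sup>+x. u n x \<partial>M) \<le> ennreal (c * (1/2)^n)" and c: "c \<ge> 0"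
  shows "AE x in M. (\<lambda>n. u n x) \<longlonglongrightarrow> 0"
proof -
  have "(\<integral>\<^sup>+x. (\<Sum>n. u n x) \<partial>M) = (\<Sum>n. \<integral>\<^sup>+x. u n x \<partial>M)" by (rule nn_integral_suminf[OF u])
  also have "\<dots> \<le> (\<Sum>n. ennreal (c * (1/2)^n))" by (intro suminf_le le) auto
  also have "\<dots> = ennreal (\<Sum>n. c * (1/2)^n)"
    by (intro suminf_ennreal_eq) (use c in \<open>auto intro!: summable_sums summable_mult summable_geometric\<close>)
  finally have "(\<integral>\<^sup>+x. (\<Sum>n. u n x) \<partial>M) \<noteq> \<infinity>" by (auto simp: top_unique)
  then have "AE x in M. (\<Sum>n. u n x) \<noteq> \<infinity>" using u by (intro nn_integral_PInf_AE) auto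
  then show ?thesis
  proof eventually_elim
    case (elim x)
    have "\<And>n. u n x \<noteq> \<infinity>" using ennreal_le_suminf[of "\<lambda>n. u n x"] elim by (metis infinity_ennreal_def top_unique)
    then have eq: "\<And>n. u n x = ennreal (enn2real (u n x))" by (simp add: less_top[symmetric])
    have "summable (\<lambda>n. enn2real (u n x))"
    proof (rule summable_suminf_not_top)
      show "(\<Sum>n. ennreal (enn2real (u n x))) \<noteq> top" using elim eq by simp
    qed simp
    then have "(\<lambda>n. enn2real (u n x)) \<longlonglongrightarrow> 0" by (rule summable_LIMSEQ_zero)
    then have "(\<lambda>n. ennreal (enn2real (u n x))) \<longlonglongrightarrow> ennreal 0" by (rule tendsto_ennrealI)
    then show ?case using eq by simp
  qed
qed

text \<open>A substitute for Lebesgue's differentiation theorem that needs no covering argument: along a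
  suitable sequence of radii the averages are controlled by Tonelli's theorem alone.\<close>
lemma lebesgue_points_along_sequence:
  fixes F :: "real^'n::finite \<Rightarrow> 'b::euclidean_space"
  assumes \<Omega>: "open \<Omega>" "bounded \<Omega>" and F: "sqi (lebesgue_on \<Omega>) F"
  shows "\<exists>r. (\<forall>k. r k > 0) \<and> r \<longlonglongrightarrow> (0::real) \<and> (AE x in lebesgue_on \<Omega>.
    (\<lambda>k. (\<integral>z. indicator (ball x (r k)) z * (norm (F z - F x))\<^sup>2 \<partial>lebesgue_on \<Omega>) / measure lborel (ball x (r k))) \<longlonglongrightarrow> 0)"
proof -
  let ?M = "lebesgue_on \<Omega>"
  interpret finite_measure ?M by (rule open_bounded_lebesgue_on[OF \<Omega>])
  note Fm[measurable] = sqi_measurable[OF F]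
  have "\<exists>G. continuous_on UNIV G \<and> sqi ?M G \<and> nrm2 ?M (\<lambda>x. F x - G x) < (1/2)^n" for n
    by (rule sqi_continuous_approx[OF \<Omega> F]) simp
  then obtain G where Gc: "\<And>n. continuous_on UNIV (G n)" and Gs: "\<And>n. sqi ?M (G n)"
    and G: "\<And>n. nrm2 ?M (\<lambda>x. F x - G n x) < (1/2)^n" by metis
  obtain R where R: "\<And>x. x \<in> \<Omega> \<Longrightarrow> norm x \<le> R" using \<Omega>(2) by (auto simp: bounded_iff)
  have "\<exists>d>0. \<forall>x\<in>cball 0 R. \<forall>z\<in>cball 0 R. dist z x < d \<longrightarrow> dist (G n z) (G n x) < (1/2)^n" for n
    using compact_uniformly_continuous[OF continuous_on_subset[OF Gc[of n]] compact_cball[of 0 R]]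
    unfolding uniformly_continuous_on_def by (metis subset_UNIV zero_less_divide_1_iff zero_less_numeral zero_less_power)
  then obtain d where d: "\<And>n. d n > 0" "\<And>n x z. x \<in> cball 0 R \<Longrightarrow> z \<in> cball 0 R \<Longrightarrow> dist z x < d n \<Longrightarrow> dist (G n z) (G n x) < (1/2)^n"
    by metis
  \<comment> \<open>The modulus \<open>d n\<close> keeps the oscillation of \<open>G n\<close> on a
    ball of radius \<open>r n\<close> below 2^-n; the other bound makes the radii tend to 0.\<close>
  define r where "r n = min (d n) (1 / real (Suc n))" for n
  have r: "r n > 0" "r n \<le> d n" "r n \<le> 1 / real (Suc n)" for n using d(1)[of n] by (auto simp: r_def)
  have rl: "r \<longlonglongrightarrow> 0"
    using LIMSEQ_inverse_real_of_nat r(1,3)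
    by (intro tendsto_sandwich[of "\<lambda>_. 0" r sequentially "\<lambda>n. 1 / real (Suc n)" 0]) (auto simp: inverse_eq_divide intro!: always_eventually intro: less_imp_le)
  define V where "V n = measure lborel (ball (0::real^'n) (r n))" for n
  have Vp: "V n > 0" for n unfolding V_def using r(1)[of n] by (simp add: content_ball)
  define h where "h n z = (norm (F z - G n z))\<^sup>2" for n z
  have Gm[measurable]: "G n \<in> borel_measurable ?M" for n by (rule sqi_measurable[OF Gs])
  have hm[measurable]: "h n \<in> borel_measurable ?M" for n unfolding h_def by measurable
  have h0: "h n z \<ge> 0" for n z by (simp add: h_def)
  have hi: "integrable ?M (h n)" for n unfolding h_def using sqi_integrable[OF sqi_diff[OF F Gs]] .
  have hle: "(\<integral>\<^sup>+z. ennreal (h n z) \<partial>?M) \<le> ennreal ((1/2)^n)" for n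
  proof -
    have "(\<integral>\<^sup>+z. ennreal (h n z) \<partial>?M) = ennreal ((nrm2 ?M (\<lambda>x. F x - G n x))\<^sup>2)"
      unfolding h_def by (rule sqi_nn_integral[OF sqi_diff[OF F Gs]])
    also have "\<dots> \<le> ennreal (((1/2)^n)\<^sup>2)" using G[of n] by (intro ennreal_leI power_mono) auto
    also have "((1/2::real)^n)\<^sup>2 \<le> (1/2)^n" unfolding power2_eq_square by (intro mult_left_le) (auto simp: power_le_one)
    then have "ennreal (((1/2)^n)\<^sup>2) \<le> ennreal ((1/2)^n)" by (rule ennreal_leI)
    finally show ?thesis .
  qed
  have l1: "AE x in ?M. (\<lambda>n. ennreal (h n x)) \<longlonglongrightarrow> 0"
    by (rule AE_tendsto_0_of_summable_integrals[where c=1]) (use hle in auto)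
  let ?A = "\<lambda>n x. \<integral>\<^sup>+z. ennreal (indicator (ball x (r n)) z * h n z) \<partial>?M"
  \<comment> \<open>The error F - G n must be small at the centre, which is \<open>l1\<close>, and
    in mean over the ball. Averaging over balls does not increase the integral, so the same summable
    bound serves for both.\<close>
  have l2: "AE x in ?M. (\<lambda>n. ennreal (1 / V n) * ?A n x) \<longlonglongrightarrow> 0"
  proof (rule AE_tendsto_0_of_summable_integrals[where c=1])
    note Am[measurable] = nn_integral_ball_average_le(1)[OF \<Omega> hm]
    show "(\<lambda>x. ennreal (1 / V n) * ?A n x) \<in> borel_measurable ?M" for n by measurable
    show "(\<integral>\<^sup>+x. ennreal (1 / V n) * ?A n x \<partial>?M) \<le> ennreal (1 * (1/2)^n)" for n
    proof -
      have "(\<integral>\<^sup>+x. ennreal (1 / V n) * ?A n x \<partial>?M) = ennreal (1 / V n) * (\<integral>\<^sup>+x. ?A n x \<partial>?M)"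
        by (rule nn_integral_cmult) measurable
      also have "\<dots> \<le> ennreal (1 / V n) * (ennreal (V n) * ennreal ((1/2)^n))"
        unfolding V_def
        by (intro mult_left_mono order_trans[OF nn_integral_ball_average_le(2)[OF \<Omega> hm]] hle) auto
      also have "\<dots> = ennreal ((1/2)^n)"
        using Vp[of n] by (simp add: ennreal_mult[symmetric] mult.assoc[symmetric])
      finally show ?thesis by simp
    qed
  qed simp
  have "AE x in ?M. (\<lambda>k. (\<integral>z. indicator (ball x (r k)) z * (norm (F z - F x))\<^sup>2 \<partial>?M) / measure lborel (ball x (r k))) \<longlonglongrightarrow> 0"
    using l1 l2 AE_space
  proof eventually_elim
    case (elim x)
    then have x: "x \<in> \<Omega>" by simp
    let ?B = "\<lambda>n. \<integral>z. indicator (ball x (r n)) z * h n z \<partial>?M"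
    have indm: "(\<lambda>z. indicator (ball x s) z :: real) \<in> borel_measurable ?M" for s
      by (intro borel_measurable_lebesgue_on borel_measurable_indicator) simp
    have Bi: "integrable ?M (\<lambda>z. indicator (ball x (r n)) z * h n z)" for n
      by (rule Bochner_Integration.integrable_bound[OF hi[of n]]) (use indm h0 in \<open>auto simp: indicator_def intro!: borel_measurable_times\<close>)
    have AB: "?A n x = ennreal (?B n)" for n
      by (rule nn_integral_eq_integral[OF Bi]) (simp add: h0)
    have B0: "?B n \<ge> 0" for n by (intro integral_nonneg_AE AE_I2) (simp add: h0)
    have "(\<lambda>n. ennreal (1 / V n * ?B n)) \<longlonglongrightarrow> ennreal 0"
    proof -
      have e: "ennreal (1 / V n) * ennreal (?B n) = ennreal (1 / V n * ?B n)" for n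
        by (rule ennreal_mult[symmetric]) (use B0 Vp in \<open>auto simp: less_imp_le\<close>)
      show ?thesis using elim(2) unfolding AB e by (simp only: ennreal_0)
    qed
    then have c2: "(\<lambda>n. 1 / V n * ?B n) \<longlonglongrightarrow> 0"
      using Vp B0 by (subst (asm) tendsto_ennreal_iff) (auto intro!: always_eventually simp: less_imp_le)
    have c1: "(\<lambda>n. h n x) \<longlonglongrightarrow> 0"
      using elim(1) h0 tendsto_ennreal_iff[of "\<lambda>n. h n x" sequentially 0] by simp
    have ii: "integrable ?M (\<lambda>z. indicator (ball x s) z :: real)" for s
      by (rule integrable_const_bound[where B=1]) (use indm in \<open>auto simp: indicator_def\<close>)
    have iV: "(\<integral>z. indicator (ball x (r n)) z \<partial>?M) \<le> V n" for n
    proof -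
      have "ennreal (\<integral>z. indicator (ball x (r n)) z \<partial>?M) = (\<integral>\<^sup>+z. ennreal (indicator (ball x (r n)) z) \<partial>?M)"
        by (rule nn_integral_eq_integral[symmetric]) (use ii in auto)
      also have "\<dots> = (\<integral>\<^sup>+z. indicator (ball x (r n)) z \<partial>?M)" by (intro nn_integral_cong) (auto simp: indicator_def)
      also have "\<dots> \<le> ennreal (V n)" unfolding V_def by (rule nn_integral_indicator_ball[OF \<Omega>])
      finally show ?thesis using Vp[of n] by (simp add: ennreal_le_iff)
    qed
    have bound: "(\<integral>z. indicator (ball x (r n)) z * (norm (F z - F x))\<^sup>2 \<partial>?M) / V n
      \<le> 3 * (1 / V n * ?B n) + 3 * (((1/2)^n)\<^sup>2 + h n x)" for n
    proof -
      \<comment> \<open>F z - F x passes through G n z and G n x; the factor 3 comes from squaring a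
        sum of three terms.\<close>
      have pt: "indicator (ball x (r n)) z * (norm (F z - F x))\<^sup>2
        \<le> 3 * (indicator (ball x (r n)) z * h n z) + 3 * (((1/2)^n)\<^sup>2 + h n x) * indicator (ball x (r n)) z" if z: "z \<in> \<Omega>" for z
      proof (cases "z \<in> ball x (r n)")
        case True
        then have "dist (G n z) (G n x) < (1/2)^n"
          using d(2)[of x z n] R[OF z] R[OF x] r(2)[of n] by (simp add: dist_commute)
        then have g: "norm (G n z - G n x) \<le> (1/2)^n" by (simp add: dist_norm)
        have "norm (F z - F x) \<le> norm (F z - G n z) + norm (G n z - G n x) + norm (F x - G n x)"
          using norm_triangle_ineq[of "F z - G n z" "G n z - G n x"] norm_triangle_ineq4[of "F z - G n x" "F x - G n x"] by simp
        then have "(norm (F z - F x))\<^sup>2 \<le> (norm (F z - G n z) + (1/2)^n + norm (F x - G n x))\<^sup>2"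
          using g by (intro power_mono) auto
        also have "\<dots> \<le> 3 * h n z + 3 * (((1/2)^n)\<^sup>2 + h n x)"
        proof -
          have "(a + b + c)\<^sup>2 \<le> 3 * a\<^sup>2 + 3 * (b\<^sup>2 + c\<^sup>2)" for a b c :: real
          proof -
            have "0 \<le> (a - b)\<^sup>2 + (b - c)\<^sup>2 + (a - c)\<^sup>2" by simp
            then show ?thesis by (simp add: power2_eq_square algebra_simps)
          qed
          then show ?thesis unfolding h_def .
        qed
        finally show ?thesis using True by simp
      qed simp
      have "(\<integral>z. indicator (ball x (r n)) z * (norm (F z - F x))\<^sup>2 \<partial>?M)
        \<le> (\<integral>z. 3 * (indicator (ball x (r n)) z * h n z) + 3 * (((1/2)^n)\<^sup>2 + h n x) * indicator (ball x (r n)) z \<partial>?M)"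
      proof (rule integral_mono_AE)
        show i2: "integrable ?M (\<lambda>z. 3 * (indicator (ball x (r n)) z * h n z) + 3 * (((1/2)^n)\<^sup>2 + h n x) * indicator (ball x (r n)) z)"
          using Bi[of n] ii by (intro Bochner_Integration.integrable_add integrable_mult_right) auto
        show "AE z in ?M. indicator (ball x (r n)) z * (norm (F z - F x))\<^sup>2
          \<le> 3 * (indicator (ball x (r n)) z * h n z) + 3 * (((1/2)^n)\<^sup>2 + h n x) * indicator (ball x (r n)) z"
          using pt by (intro AE_I2) simp
        show "integrable ?M (\<lambda>z. indicator (ball x (r n)) z * (norm (F z - F x))\<^sup>2)"
        proof (rule Bochner_Integration.integrable_bound[OF i2])
          show "(\<lambda>z. indicator (ball x (r n)) z * (norm (F z - F x))\<^sup>2) \<in> borel_measurable ?M" using indm[of "r n"] by measurable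
          have gen: "norm L \<le> norm U" if "0 \<le> L" "L \<le> U" for L U :: real using that by simp
          show "AE z in ?M. norm (indicator (ball x (r n)) z * (norm (F z - F x))\<^sup>2)
            \<le> norm (3 * (indicator (ball x (r n)) z * h n z) + 3 * (((1/2)^n)\<^sup>2 + h n x) * indicator (ball x (r n)) z)"
          proof (rule AE_I2)
            fix z assume "z \<in> space ?M"
            then show "norm (indicator (ball x (r n)) z * (norm (F z - F x))\<^sup>2)
            \<le> norm (3 * (indicator (ball x (r n)) z * h n z) + 3 * (((1/2)^n)\<^sup>2 + h n x) * indicator (ball x (r n)) z)"
              using pt[of z] by (intro gen) simp_all
          qed
        qed
      qed
      also have "\<dots> = 3 * ?B n + 3 * (((1/2)^n)\<^sup>2 + h n x) * (\<integral>z. indicator (ball x (r n)) z \<partial>?M)"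
        using Bi[of n] ii[of "r n"] by simp
      also have "\<dots> \<le> 3 * ?B n + 3 * (((1/2)^n)\<^sup>2 + h n x) * V n"
        by (intro add_left_mono mult_left_mono iV) (simp add: h0)
      finally show ?thesis using Vp[of n] by (simp add: field_simps)
    qed
    have "(\<lambda>n. (\<integral>z. indicator (ball x (r n)) z * (norm (F z - F x))\<^sup>2 \<partial>?M) / V n) \<longlonglongrightarrow> 0"
    proof (rule tendsto_sandwich[OF _ _ tendsto_const])
      have "(\<lambda>n. (1/2::real)^n) \<longlonglongrightarrow> 0" by (rule LIMSEQ_power_zero) simp
      then have "(\<lambda>n. 3 * (1 / V n * ?B n) + 3 * (((1/2)^n)\<^sup>2 + h n x)) \<longlonglongrightarrow> 3 * 0 + 3 * (0\<^sup>2 + 0)"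
        by (intro tendsto_add tendsto_mult tendsto_const tendsto_power c1 c2)
      then show "(\<lambda>n. 3 * (1 / V n * ?B n) + 3 * (((1/2)^n)\<^sup>2 + h n x)) \<longlonglongrightarrow> 0" by simp
      show "\<forall>\<^sub>F n in sequentially. 0 \<le> (\<integral>z. indicator (ball x (r n)) z * (norm (F z - F x))\<^sup>2 \<partial>?M) / V n"
        using Vp by (intro always_eventually allI divide_nonneg_nonneg integral_nonneg_AE) (auto simp: less_imp_le)
    qed (use bound in auto)
    then show ?case by (simp only: V_def measure_ball_eq[of x])
  qed
  with r rl show ?thesis by blast
qed

section \<open>Compactness\<close>

lemma sqi_lborel_imp_lebesgue_on:
  fixes f :: "real^'n::finite \<Rightarrow> 'b::euclidean_space"
  assumes S: "S \<in> sets lebesgue" and f: "sqi lborel f"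
  shows "sqi (lebesgue_on S) f" "nrm2 (lebesgue_on S) f \<le> nrm2 lborel f"
proof -
  have m: "f \<in> borel_measurable borel" using sqi_measurable[OF f] by simp
  have le: "(\<integral>\<^sup>+x. ennreal ((norm (f x))\<^sup>2) \<partial>lebesgue_on S) \<le> ennreal ((nrm2 lborel f)\<^sup>2)"
  proof -
    have "(\<integral>\<^sup>+x. ennreal ((norm (f x))\<^sup>2) \<partial>lebesgue_on S) = (\<integral>\<^sup>+x. ennreal ((norm (f x))\<^sup>2) * indicator S x \<partial>lebesgue)"
      using S by (subst nn_integral_restrict_space) auto
    also have "\<dots> \<le> (\<integral>\<^sup>+x. ennreal ((norm (f x))\<^sup>2) \<partial>lebesgue)"
      by (intro nn_integral_mono) (auto simp: indicator_def)
    also have "\<dots> = (\<integral>\<^sup>+x. ennreal ((norm (f x))\<^sup>2) \<partial>lborel)"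
      using m by (intro nn_integral_completion) measurable
    finally show ?thesis using sqi_nn_integral[OF f] by simp
  qed
  from sqiI_nn[OF borel_measurable_lebesgue_on[OF m] le] show "sqi (lebesgue_on S) f" "nrm2 (lebesgue_on S) f \<le> nrm2 lborel f"
    by auto
qed

text \<open>Convolution with the indicator of a ball, for functions extended by 0 outside \<Omega>.
  Keeping the integral instead of the mean avoids a division; the estimates below carry the volume
  on the other side.\<close>

definition ball_integral :: "'a::euclidean_space set \<Rightarrow> real \<Rightarrow> ('a \<Rightarrow> real) \<Rightarrow> 'a \<Rightarrow> real" where
  "ball_integral \<Omega> s z x = (\<integral>w. indicator (ball x s) w * z w \<partial>lebesgue_on \<Omega>)"

lemma ball_integral_bound:
  fixes \<Omega> :: "(real^'n::finite) set"
  assumes \<Omega>: "open \<Omega>" "bounded \<Omega>" and z: "sqi (lebesgue_on \<Omega>) z"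
  shows "\<bar>ball_integral \<Omega> s z x\<bar> \<le> sqrt (measure lborel (ball (0::real^'n) s)) * nrm2 (lebesgue_on \<Omega>) z"
proof -
  let ?M = "lebesgue_on \<Omega>" and ?V = "measure lborel (ball (0::real^'n) s)"
  interpret finite_measure ?M by (rule open_bounded_lebesgue_on[OF \<Omega>])
  have m: "(\<lambda>w. indicator (ball x s) w :: real) \<in> borel_measurable ?M"
    by (intro borel_measurable_lebesgue_on borel_measurable_indicator) simp
  have "(\<integral>\<^sup>+w. ennreal ((norm (indicator (ball x s) w :: real))\<^sup>2) \<partial>?M) = (\<integral>\<^sup>+w. indicator (ball x s) w \<partial>?M)"
    by (intro nn_integral_cong) (auto simp: indicator_def)
  also have "\<dots> \<le> ennreal ((sqrt ?V)\<^sup>2)" using nn_integral_indicator_ball[OF \<Omega>, of x s] by simp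
  finally have le: "(\<integral>\<^sup>+w. ennreal ((norm (indicator (ball x s) w :: real))\<^sup>2) \<partial>?M) \<le> ennreal ((sqrt ?V)\<^sup>2)" .
  have i: "sqi ?M (\<lambda>w. indicator (ball x s) w :: real)" "nrm2 ?M (\<lambda>w. indicator (ball x s) w :: real) \<le> sqrt ?V"
    using sqiI_nn[OF m le] by auto
  have "\<bar>ball_integral \<Omega> s z x\<bar> \<le> nrm2 ?M (\<lambda>w. indicator (ball x s) w :: real) * nrm2 ?M z"
    using sqi_cs[OF i(1) z] by (simp add: ball_integral_def)
  also have "\<dots> \<le> sqrt ?V * nrm2 ?M z" by (intro mult_right_mono i) simp
  finally show ?thesis .
qed

lemma ball_integral_diff:
  fixes \<Omega> :: "(real^'n::finite) set"
  assumes \<Omega>: "open \<Omega>" "bounded \<Omega>" and z: "sqi (lebesgue_on \<Omega>) z" and w: "sqi (lebesgue_on \<Omega>) w"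
  shows "ball_integral \<Omega> s (\<lambda>x. z x - w x) x = ball_integral \<Omega> s z x - ball_integral \<Omega> s w x"
proof -
  let ?M = "lebesgue_on \<Omega>"
  interpret finite_measure ?M by (rule open_bounded_lebesgue_on[OF \<Omega>])
  have m: "(\<lambda>w. indicator (ball x s) w :: real) \<in> borel_measurable ?M"
    by (intro borel_measurable_lebesgue_on borel_measurable_indicator) simp
  have i: "sqi ?M (\<lambda>w. indicator (ball x s) w :: real)"
    unfolding sqi_def using m by (auto intro!: integrable_const_bound[where B=1] split: split_indicator)
  show ?thesis unfolding ball_integral_def
    using sqi_inner_integrable[OF i z] sqi_inner_integrable[OF i w] by (simp add: right_diff_distrib)
qed

lemma ball_integral_sqi:
  fixes \<Omega> :: "(real^'n::finite) set"
  assumes \<Omega>: "open \<Omega>" "bounded \<Omega>" and z: "sqi (lebesgue_on \<Omega>) z"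
  shows "sqi (lebesgue_on \<Omega>) (ball_integral \<Omega> s z)"
proof -
  let ?M = "lebesgue_on \<Omega>" and ?V = "measure lborel (ball (0::real^'n) s)"
  interpret finite_measure ?M by (rule open_bounded_lebesgue_on[OF \<Omega>])
  have sf: "sigma_finite_measure ?M" by (rule sigma_finite_measure_axioms)
  note [measurable] = measurable_indicator_ball_pair[of s \<Omega> \<Omega>, unfolded case_prod_beta] sqi_measurable[OF z]
  have "(\<lambda>(x, w). indicator (ball x s) w * z w) \<in> borel_measurable (?M \<Otimes>\<^sub>M ?M)"
    unfolding case_prod_beta by measurable
  from sigma_finite_measure.borel_measurable_lebesgue_integral[OF sf this]
  have m: "ball_integral \<Omega> s z \<in> borel_measurable ?M" unfolding ball_integral_def .
  have "integrable ?M (\<lambda>x. (norm (ball_integral \<Omega> s z x))\<^sup>2)"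
    by (rule integrable_const_bound[where B="(sqrt ?V * nrm2 ?M z)\<^sup>2"])
      (use m ball_integral_bound[OF \<Omega> z, of s] in \<open>auto intro!: power_mono simp: power2_eq_square[symmetric] abs_le_square_iff[symmetric]\<close>)
  with m show ?thesis by (simp add: sqi_def)
qed

text \<open>The error at x is the integral of \<phi> (x + u) - \<phi> x over |u| < s. Cauchy-Schwarz
  in u costs a factor V, the volume of the ball; Tonelli exchanges x and u; and for each u the
  translation estimate gives the square of s times the norm of grad \<phi>. Integration over u
  contributes the second V.\<close>

lemma ball_integral_approx_test_fun:
  fixes \<Omega> :: "(real^'n::finite) set"
  assumes \<Omega>: "open \<Omega>" "bounded \<Omega>" and t: "test_fun \<Omega> \<phi>" and s: "s > 0"
  shows "measure lborel (ball (0::real^'n) s) * nrm2 (lebesgue_on \<Omega>) \<phi>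
    \<le> measure lborel (ball (0::real^'n) s) * (s * nrm2 (lebesgue_on \<Omega>) (grad \<phi>)) + nrm2 (lebesgue_on \<Omega>) (ball_integral \<Omega> s \<phi>)"
proof -
  let ?M = "lebesgue_on \<Omega>" and ?B = "ball (0::real^'n) s"
  define V where "V = measure lborel ?B"
  have V0: "V \<ge> 0" by (simp add: V_def)
  have fin: "emeasure lborel ?B < \<infinity>" by (rule emeasure_lborel_ball_finite)
  have eV: "emeasure lborel ?B = ennreal V" unfolding V_def by (rule emeasure_eq_ennreal_measure) (use fin in auto)
  have c: "continuous_on UNIV \<phi>" by (rule smooth_continuous[OF test_fun_smooth[OF t]])
  note \<phi>m[measurable] = borel_measurable_continuous_onI[OF c]
  have [measurable]: "?B \<in> sets borel" by simp
  have z: "\<phi> x = 0" if "x \<notin> \<Omega>" for x using t that by (metis test_funE subsetD)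
  have sh: "sqi lborel (\<lambda>u. \<phi> (x + u))" for x
    using sqi_add[OF nrm2_translation_le(1)[OF t, of x] sqi_test_fun(1)[OF t]] by (simp add: add.commute)
  have i1: "sqi lborel (\<lambda>u. indicator ?B u :: real)" "nrm2 lborel (\<lambda>u. indicator ?B u :: real) = sqrt V"
    using sqi_indicator[of ?B lborel "1::real"] fin by (simp_all add: V_def)
  have bi: "ball_integral \<Omega> s \<phi> x = (\<integral>u. indicator ?B u * \<phi> (x + u) \<partial>lborel)" for x
  proof -
    have [measurable]: "ball x s \<in> sets borel" by simp
    have "ball_integral \<Omega> s \<phi> x = (\<integral>w. indicator (ball x s) w * \<phi> w \<partial>lborel)"
      unfolding ball_integral_def
    proof (rule lebesgue_on_vanishing(1)[OF open_bounded_lebesgue_on(1)[OF \<Omega>]])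
      show "(\<lambda>w. indicator (ball x s) w * \<phi> w) \<in> borel_measurable borel" by measurable
    qed (simp add: z)
    also have "\<dots> = (\<integral>w. indicator (ball x s) (w + x) * \<phi> (w + x) \<partial>lborel)"
      by (rule lborel_integral_translate[symmetric]) measurable
    also have "\<dots> = (\<integral>u. indicator ?B u * \<phi> (x + u) \<partial>lborel)"
      by (rule Bochner_Integration.integral_cong) (auto simp: indicator_def dist_norm add.commute)
    finally show ?thesis .
  qed
  define D where "D x u = indicator ?B u * (\<phi> (x + u) - \<phi> x)" for x u
  have Dm: "(\<lambda>(x, u). ennreal ((D x u)\<^sup>2)) \<in> borel_measurable (lborel \<Otimes>\<^sub>M lborel)"
    unfolding D_def case_prod_beta by measurable
  have sD: "sqi lborel (D x)" for x
  proof -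
    have "sqi lborel (\<lambda>u. indicator ?B u *\<^sub>R \<phi> (x + u))"
      by (rule sqi_mult[OF sh, where K=1]) (auto simp: indicator_def)
    moreover have "sqi lborel (\<lambda>u. \<phi> x *\<^sub>R (indicator ?B u :: real))" by (rule sqi_scaleR[OF i1(1)])
    ultimately have "sqi lborel (\<lambda>u. indicator ?B u *\<^sub>R \<phi> (x + u) - \<phi> x *\<^sub>R (indicator ?B u :: real))" by (rule sqi_diff)
    then show ?thesis by (simp add: D_def[abs_def] right_diff_distrib mult.commute)
  qed
  define e where "e x = ball_integral \<Omega> s \<phi> x - V * \<phi> x" for x
  have e_eq: "e x = (\<integral>u. D x u \<partial>lborel)" for x
  proof -
    have ib: "integrable lborel (\<lambda>u. indicator ?B u :: real)" using fin by simp
    have "(\<integral>u. D x u \<partial>lborel) = (\<integral>u. indicator ?B u * \<phi> (x + u) - \<phi> x * indicator ?B u \<partial>lborel)"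
      by (rule Bochner_Integration.integral_cong) (auto simp: D_def algebra_simps)
    also have "\<dots> = (\<integral>u. indicator ?B u * \<phi> (x + u) \<partial>lborel) - \<phi> x * V"
      using sqi_inner_integrable[OF i1(1) sh[of x]] ib by (simp add: V_def)
    finally show ?thesis by (simp add: e_def bi mult.commute)
  qed
  have e_sq: "(e x)\<^sup>2 \<le> V * (nrm2 lborel (D x))\<^sup>2" for x
  proof -
    have "D x = (\<lambda>u. indicator ?B u * D x u)" by (auto simp: D_def indicator_def)
    then have "e x = (\<integral>u. indicator ?B u * D x u \<partial>lborel)" unfolding e_eq by simp
    then have "\<bar>e x\<bar> \<le> sqrt V * nrm2 lborel (D x)" using sqi_cs[OF i1(1) sD[of x]] i1(2) by simp
    then have "\<bar>e x\<bar>\<^sup>2 \<le> (sqrt V * nrm2 lborel (D x))\<^sup>2" by (intro power_mono) auto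
    then show ?thesis using V0 by (simp add: power_mult_distrib)
  qed
  have em: "e \<in> borel_measurable lborel"
  proof -
    have "(\<lambda>(x, u). D x u) \<in> borel_measurable (lborel \<Otimes>\<^sub>M lborel)" unfolding D_def case_prod_beta by measurable
    from lborel.borel_measurable_lebesgue_integral[OF this] show ?thesis unfolding e_eq[abs_def] .
  qed
  let ?g = "nrm2 lborel (grad \<phi>)"
  have "(\<integral>\<^sup>+x. ennreal ((norm (e x))\<^sup>2) \<partial>lborel) \<le> (\<integral>\<^sup>+x. ennreal V * (\<integral>\<^sup>+u. ennreal ((D x u)\<^sup>2) \<partial>lborel) \<partial>lborel)"
  proof (rule nn_integral_mono)
    fix x
    have "(\<integral>\<^sup>+u. ennreal ((D x u)\<^sup>2) \<partial>lborel) = ennreal ((nrm2 lborel (D x))\<^sup>2)" using sqi_nn_integral[OF sD[of x]] by simp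
    then show "ennreal ((norm (e x))\<^sup>2) \<le> ennreal V * (\<integral>\<^sup>+u. ennreal ((D x u)\<^sup>2) \<partial>lborel)"
      using e_sq[of x] V0 by (simp add: ennreal_mult[symmetric] ennreal_leI)
  qed
  also have "\<dots> = ennreal V * (\<integral>\<^sup>+x. \<integral>\<^sup>+u. ennreal ((D x u)\<^sup>2) \<partial>lborel \<partial>lborel)"
    by (rule nn_integral_cmult) (rule lborel.borel_measurable_nn_integral[OF Dm])
  also have "\<dots> = ennreal V * (\<integral>\<^sup>+u. \<integral>\<^sup>+x. ennreal ((D x u)\<^sup>2) \<partial>lborel \<partial>lborel)"
    by (subst lborel_pair.Fubini'[OF Dm]) simp
  also have "\<dots> \<le> ennreal V * (\<integral>\<^sup>+u. ennreal ((s * ?g)\<^sup>2) * indicator ?B u \<partial>lborel)"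
  proof (intro mult_left_mono nn_integral_mono)
    fix u
    show "(\<integral>\<^sup>+x. ennreal ((D x u)\<^sup>2) \<partial>lborel) \<le> ennreal ((s * ?g)\<^sup>2) * indicator ?B u"
    proof (cases "u \<in> ?B")
      case True
      have "(\<integral>\<^sup>+x. ennreal ((D x u)\<^sup>2) \<partial>lborel) = ennreal ((nrm2 lborel (\<lambda>x. \<phi> (x + u) - \<phi> x))\<^sup>2)"
        using sqi_nn_integral[OF nrm2_translation_le(1)[OF t, of u]] True by (simp add: D_def)
      also have "\<dots> \<le> ennreal ((s * ?g)\<^sup>2)"
        using True by (intro ennreal_leI power_mono order_trans[OF nrm2_translation_le(2)[OF t]] mult_right_mono) auto
      finally show ?thesis using True by simp
    qed (simp add: D_def)
  qed simp
  also have "\<dots> = ennreal V * (ennreal ((s * ?g)\<^sup>2) * ennreal V)"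
    by (subst nn_integral_cmult_indicator) (auto simp: eV)
  also have "\<dots> = ennreal (V * ((s * ?g)\<^sup>2 * V))"
    by (simp only: ennreal_mult[OF V0 mult_nonneg_nonneg[OF zero_le_power2 V0]] ennreal_mult[OF zero_le_power2 V0])
  also have "V * ((s * ?g)\<^sup>2 * V) = (V * (s * ?g))\<^sup>2" by (simp add: power2_eq_square mult_ac)
  finally have "(\<integral>\<^sup>+x. ennreal ((norm (e x))\<^sup>2) \<partial>lborel) \<le> ennreal ((V * (s * ?g))\<^sup>2)" .
  from sqiI_nn[OF em this] have e: "sqi lborel e" "nrm2 lborel e \<le> V * (s * ?g)" using V0 s by auto
  note eM = sqi_lborel_imp_lebesgue_on[OF open_bounded_lebesgue_on(1)[OF \<Omega>] e(1)]
  note tM = sqi_test_fun_on[OF \<Omega>(1) t]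
  have "V * nrm2 ?M \<phi> = nrm2 ?M (\<lambda>x. V *\<^sub>R \<phi> x)" using V0 by (simp only: nrm2_scaleR abs_of_nonneg)
  also have "\<dots> = nrm2 ?M (\<lambda>x. ball_integral \<Omega> s \<phi> x - e x)" by (simp add: e_def)
  also have "\<dots> \<le> nrm2 ?M (ball_integral \<Omega> s \<phi>) + nrm2 ?M e"
    by (rule nrm2_triangle_diff[OF ball_integral_sqi[OF \<Omega> tM(1)] eM(1)])
  finally show ?thesis using e(2) eM(2) tM(4) by (simp add: V_def)
qed

lemma ball_integral_approx:
  fixes \<Omega> :: "(real^'n::finite) set"
  assumes \<Omega>: "open \<Omega>" "bounded \<Omega>" and v: "H10 \<Omega> v G" and s: "s > 0"
  shows "measure lborel (ball (0::real^'n) s) * nrm2 (lebesgue_on \<Omega>) v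
    \<le> measure lborel (ball (0::real^'n) s) * (s * nrm2 (lebesgue_on \<Omega>) G) + nrm2 (lebesgue_on \<Omega>) (ball_integral \<Omega> s v)"
proof -
  let ?M = "lebesgue_on \<Omega>" and ?V = "measure lborel (ball (0::real^'n) s)"
  interpret finite_measure ?M by (rule open_bounded_lebesgue_on[OF \<Omega>])
  obtain \<phi> where \<phi>: "\<And>n. test_fun \<Omega> (\<phi> n)" "(\<lambda>n. nrm2 ?M (\<lambda>x. \<phi> n x - v x)) \<longlonglongrightarrow> 0"
    "(\<lambda>n. nrm2 ?M (\<lambda>x. grad (\<phi> n) x - G x)) \<longlonglongrightarrow> 0" by (rule H10_approx[OF v]) blast
  note st = sqi_test_fun_on(1)[OF \<Omega>(1) \<phi>(1)]
  have bl: "(\<lambda>n. nrm2 ?M (\<lambda>x. ball_integral \<Omega> s (\<phi> n) x - ball_integral \<Omega> s v x)) \<longlonglongrightarrow> 0"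
  proof (rule Lim_null_comparison)
    show "(\<lambda>n. (sqrt ?V * nrm2 ?M (\<lambda>x. \<phi> n x - v x)) * nrm2 ?M (\<lambda>x. 1::real)) \<longlonglongrightarrow> 0"
      using \<phi>(2) by (auto intro!: tendsto_eq_intros)
    have one: "sqi ?M (\<lambda>x. 1::real)" by (simp add: sqi_def)
    show "\<forall>\<^sub>F n in sequentially. norm (nrm2 ?M (\<lambda>x. ball_integral \<Omega> s (\<phi> n) x - ball_integral \<Omega> s v x))
      \<le> (sqrt ?V * nrm2 ?M (\<lambda>x. \<phi> n x - v x)) * nrm2 ?M (\<lambda>x. 1::real)"
    proof (intro always_eventually allI)
      fix n
      have d: "sqi ?M (\<lambda>x. \<phi> n x - v x)" by (rule sqi_diff[OF st H10D(1)[OF v]])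
      have "nrm2 ?M (ball_integral \<Omega> s (\<lambda>x. \<phi> n x - v x)) \<le> (sqrt ?V * nrm2 ?M (\<lambda>x. \<phi> n x - v x)) * nrm2 ?M (\<lambda>x. 1::real)"
        by (rule nrm2_bound[OF one sqi_measurable[OF ball_integral_sqi[OF \<Omega> d]]])
          (use ball_integral_bound[OF \<Omega> d, of s] in auto)
      moreover have "ball_integral \<Omega> s (\<lambda>x. \<phi> n x - v x) = (\<lambda>x. ball_integral \<Omega> s (\<phi> n) x - ball_integral \<Omega> s v x)"
        by (rule ext, rule ball_integral_diff[OF \<Omega> st H10D(1)[OF v]])
      ultimately show "norm (nrm2 ?M (\<lambda>x. ball_integral \<Omega> s (\<phi> n) x - ball_integral \<Omega> s v x))
        \<le> (sqrt ?V * nrm2 ?M (\<lambda>x. \<phi> n x - v x)) * nrm2 ?M (\<lambda>x. 1::real)" by simp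
    qed
  qed
  show ?thesis
  proof (rule LIMSEQ_le)
    show "(\<lambda>n. ?V * nrm2 ?M (\<phi> n)) \<longlonglongrightarrow> ?V * nrm2 ?M v"
      by (intro tendsto_intros nrm2_tendsto[OF st H10D(1)[OF v] \<phi>(2)])
    show "(\<lambda>n. ?V * (s * nrm2 ?M (grad (\<phi> n))) + nrm2 ?M (ball_integral \<Omega> s (\<phi> n)))
      \<longlonglongrightarrow> ?V * (s * nrm2 ?M G) + nrm2 ?M (ball_integral \<Omega> s v)"
      by (intro tendsto_intros nrm2_tendsto[OF sqi_test_fun_on(2)[OF \<Omega>(1) \<phi>(1)] H10D(2)[OF v] \<phi>(3)]
          nrm2_tendsto[OF ball_integral_sqi[OF \<Omega> st] ball_integral_sqi[OF \<Omega> H10D(1)[OF v]] bl])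
  qed (use ball_integral_approx_test_fun[OF \<Omega> \<phi>(1) s] in blast)
qed

text \<open>The part of Rellich's theorem that is needed: bounded gradients turn weak convergence to zero
  into strong convergence, because a function is close to its averages over small balls.\<close>
lemma H10_weak_null_imp_strong_null:
  fixes \<Omega> :: "(real^'n::finite) set"
  assumes \<Omega>: "open \<Omega>" "bounded \<Omega>" and z: "\<And>k. H10 \<Omega> (z k) (G k)"
    and K: "\<And>k. nrm2 (lebesgue_on \<Omega>) (G k) \<le> K"
    and weak: "\<And>q. sqi (lebesgue_on \<Omega>) q \<Longrightarrow> (\<lambda>k. \<integral>x. q x * z k x \<partial>lebesgue_on \<Omega>) \<longlonglongrightarrow> 0"
  shows "(\<lambda>k. nrm2 (lebesgue_on \<Omega>) (z k)) \<longlonglongrightarrow> 0"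
proof (rule LIMSEQ_I)
  let ?M = "lebesgue_on \<Omega>"
  interpret finite_measure ?M by (rule open_bounded_lebesgue_on[OF \<Omega>])
  fix e :: real assume e: "e > 0"
  have K0: "K \<ge> 0" using K[of 0] nrm2_nonneg[of ?M "G 0"] by linarith
  obtain P where P: "P > 0" "\<And>v G. H10 \<Omega> v G \<Longrightarrow> nrm2 ?M v \<le> P * nrm2 ?M G"
    by (rule poincare_H10[OF \<Omega>]) blast
  \<comment> \<open>The radius is fixed first: s K < e / 2 controls the distance to the averages for
    all k at once, and k then makes the averages small.\<close>
  define s where "s = e / (2 * (K + 1))"
  have s: "s > 0" "s * K < e / 2" using e K0 by (auto simp: s_def field_simps)
  define V where "V = measure lborel (ball (0::real^'n) s)"
  have V: "V > 0" using s by (simp add: V_def content_ball)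
  have zb: "nrm2 ?M (z k) \<le> P * K" for k
    by (rule order_trans[OF P(2)[OF z]]) (use P(1) K in simp)
  \<comment> \<open>Testing the weak convergence with the indicator of a ball gives pointwise
    convergence of the averages, and these are uniformly bounded on a set of finite measure.\<close>
  have "(\<lambda>k. \<integral>x. (norm (ball_integral \<Omega> s (z k) x))\<^sup>2 \<partial>?M) \<longlonglongrightarrow> (\<integral>x. 0 \<partial>?M)"
  proof (rule integral_dominated_convergence[where w="\<lambda>x. (sqrt V * (P * K))\<^sup>2"])
    show "(\<lambda>x. (norm (ball_integral \<Omega> s (z k) x))\<^sup>2) \<in> borel_measurable ?M" for k
      using sqi_measurable[OF ball_integral_sqi[OF \<Omega> H10D(1)[OF z[of k]]]] by measurable
    show "AE x in ?M. (\<lambda>k. (norm (ball_integral \<Omega> s (z k) x))\<^sup>2) \<longlonglongrightarrow> 0"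
    proof (rule AE_I2)
      fix x
      have m: "(\<lambda>w. indicator (ball x s) w :: real) \<in> borel_measurable ?M"
        by (intro borel_measurable_lebesgue_on borel_measurable_indicator) simp
      have "sqi ?M (\<lambda>w. indicator (ball x s) w :: real)"
        unfolding sqi_def using m by (auto intro!: integrable_const_bound[where B=1] split: split_indicator)
      from weak[OF this] have "(\<lambda>k. ball_integral \<Omega> s (z k) x) \<longlonglongrightarrow> 0" by (simp add: ball_integral_def)
      from tendsto_power[OF tendsto_norm[OF this], of 2]
      show "(\<lambda>k. (norm (ball_integral \<Omega> s (z k) x))\<^sup>2) \<longlonglongrightarrow> 0" by simp
    qed
    show "AE x in ?M. norm ((norm (ball_integral \<Omega> s (z k) x))\<^sup>2) \<le> (sqrt V * (P * K))\<^sup>2" for k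
    proof (rule AE_I2)
      fix x
      have "\<bar>ball_integral \<Omega> s (z k) x\<bar> \<le> sqrt V * nrm2 ?M (z k)"
        unfolding V_def by (rule ball_integral_bound[OF \<Omega> H10D(1)[OF z]])
      also have "\<dots> \<le> sqrt V * (P * K)" using V by (intro mult_left_mono zb) simp
      finally have "\<bar>ball_integral \<Omega> s (z k) x\<bar>\<^sup>2 \<le> (sqrt V * (P * K))\<^sup>2" by (intro power_mono) auto
      then show "norm ((norm (ball_integral \<Omega> s (z k) x))\<^sup>2) \<le> (sqrt V * (P * K))\<^sup>2" by simp
    qed
  qed auto
  then have "(\<lambda>k. nrm2 ?M (ball_integral \<Omega> s (z k))) \<longlonglongrightarrow> 0" by (simp add: nrm2_tendsto0_iff)
  from LIMSEQ_D[OF this, of "V * (e/2)"] V e obtain N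
    where N: "\<And>k. k \<ge> N \<Longrightarrow> nrm2 ?M (ball_integral \<Omega> s (z k)) < V * (e/2)" by auto
  have "nrm2 ?M (z k) < e" if "k \<ge> N" for k
  proof -
    have "V * nrm2 ?M (z k) \<le> V * (s * nrm2 ?M (G k)) + nrm2 ?M (ball_integral \<Omega> s (z k))"
      unfolding V_def by (rule ball_integral_approx[OF \<Omega> z s(1)])
    also have "\<dots> \<le> V * (s * K) + nrm2 ?M (ball_integral \<Omega> s (z k))"
      using V s K by (intro add_right_mono mult_left_mono) auto
    also have "\<dots> < V * (e/2) + V * (e/2)" using N[OF that] V s(2) by (intro add_strict_mono) auto
    finally have "V * nrm2 ?M (z k) < V * e" by simp
    then show ?thesis using V by simp
  qed
  then show "\<exists>no. \<forall>n\<ge>no. norm (nrm2 ?M (z n) - 0) < e" by auto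
qed

section \<open>Thin inclusions\<close>

lemma grad_compose:
  assumes "(F has_real_derivative D) (at (\<phi> x))" "smooth \<phi>"
  shows "grad (\<lambda>x. F (\<phi> x)) x = D *\<^sub>R grad \<phi> x"
  by (rule has_derivative_gradI, rule has_derivative_eq_rhs[OF has_derivative_compose[OF smooth_has_derivative[OF assms(2)]
      assms(1)[THEN has_field_derivative_imp_has_derivative]]]) (simp add: fun_eq_iff)

text \<open>The regularised absolute value. Its derivative is bounded by 1 and tends pointwise to
  the sign, by the next two lemmas; this is what dominated convergence needs as e tends to
  0.\<close>

lemma smooth_abs_approx:
  fixes \<phi> :: "real^'n::finite \<Rightarrow> real"
  assumes e: "e > 0" and \<phi>: "smooth \<phi>"
  shows "smooth (\<lambda>x. sqrt ((\<phi> x)\<^sup>2 + e\<^sup>2))"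
    and "grad (\<lambda>x. sqrt ((\<phi> x)\<^sup>2 + e\<^sup>2)) x = (\<phi> x / sqrt ((\<phi> x)\<^sup>2 + e\<^sup>2)) *\<^sub>R grad \<phi> x"
proof -
  have pos: "s\<^sup>2 + e\<^sup>2 > 0" for s using e by (simp add: add_nonneg_pos)
  show "smooth (\<lambda>x. sqrt ((\<phi> x)\<^sup>2 + e\<^sup>2))"
    by (rule smooth_sqrt) (use pos smooth_add[OF smooth_mult[OF \<phi> \<phi>] smooth_const] in \<open>auto simp: power2_eq_square\<close>)
  have "((\<lambda>s. sqrt (s\<^sup>2 + e\<^sup>2)) has_real_derivative s / sqrt (s\<^sup>2 + e\<^sup>2)) (at s)" for s
    using pos[of s] by (auto intro!: derivative_eq_intros simp: field_simps)
  from grad_compose[OF this \<phi>]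
  show "grad (\<lambda>x. sqrt ((\<phi> x)\<^sup>2 + e\<^sup>2)) x = (\<phi> x / sqrt ((\<phi> x)\<^sup>2 + e\<^sup>2)) *\<^sub>R grad \<phi> x" .
qed

lemma abs_div_sqrt_le_1: "\<bar>s / sqrt (s\<^sup>2 + e\<^sup>2)\<bar> \<le> (1::real)"
proof (cases "s = 0")
  case False
  have "\<bar>s\<bar> \<le> sqrt (s\<^sup>2 + e\<^sup>2)" by (rule real_le_rsqrt) simp
  moreover have "sqrt (s\<^sup>2 + e\<^sup>2) > 0" using False by (simp add: add_pos_nonneg)
  ultimately show ?thesis by (simp add: abs_divide)
qed simp

lemma div_sqrt_tendsto_sgn: "(\<lambda>k. s / sqrt (s\<^sup>2 + (1 / real (Suc k))\<^sup>2)) \<longlonglongrightarrow> sgn (s::real)"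
proof (cases "s = 0")
  case False
  have "(\<lambda>k. 1 / real (Suc k)) \<longlonglongrightarrow> 0" using LIMSEQ_inverse_real_of_nat by (simp add: inverse_eq_divide)
  then have "(\<lambda>k. s / sqrt (s\<^sup>2 + (1 / real (Suc k))\<^sup>2)) \<longlonglongrightarrow> s / sqrt (s\<^sup>2 + 0\<^sup>2)"
    by (intro tendsto_divide tendsto_const tendsto_real_sqrt tendsto_add tendsto_power) (use False in simp_all)
  then show ?thesis using False by (simp add: sgn_real_def abs_if split: if_splits)
qed simp

text \<open>\<open>flat_exp 2\<close> is the derivative of \<open>flat_exp 0\<close>, so its bound
  controls the gradient of the lens profile; with u = 1 / s it follows from u^2 / 2 <= exp
  u.\<close>

lemma flat_exp_2_bound: "0 \<le> flat_exp n s" "flat_exp 0 s \<le> 1" "flat_exp 2 s \<le> 2"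
proof -
  show "0 \<le> flat_exp n s" by (simp add: flat_exp_def)
  show "flat_exp 0 s \<le> 1" by (simp add: flat_exp_def)
  show "flat_exp 2 s \<le> 2"
  proof (cases "s > 0")
    case True
    define u where "u = 1 / s"
    have u: "u > 0" using True by (simp add: u_def)
    have "1 + u + u\<^sup>2 / 2 \<le> exp u" using exp_lower_Taylor_quadratic[of u] u by simp
    then have "u\<^sup>2 \<le> 2 * exp u" using u by simp
    then have "u\<^sup>2 * exp (- u) \<le> 2" by (simp add: exp_minus field_simps)
    then show ?thesis using True by (simp add: flat_exp_def u_def)
  qed (simp add: flat_exp_def)
qed

text \<open>A bump of radius r / 2 whose height is proportional to r, so that its gradient bound
  does not depend on r.\<close>

definition lens_profile :: "real^'n::finite \<Rightarrow> real \<Rightarrow> real^'n \<Rightarrow> real" where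
  "lens_profile x0 r x = r * flat_exp 0 (1/4 - (1 / r\<^sup>2) * (norm (x - x0))\<^sup>2)"

text \<open>Within distance r / 4 the argument of \<open>flat_exp 0\<close> is at least 1/4 - 1/16 =
  3/16, whence the constant 16/3. The gradient has norm at most r * 2 * (2 / r^2) * (r / 2) = 2, the
  first 2 being the bound for \<open>flat_exp 2\<close>.\<close>

lemma lens_profile_props:
  fixes x x0 :: "real^'n::finite"
  assumes r: "r > 0"
  shows "smooth (lens_profile x0 r)" "lens_profile x0 r x \<ge> 0"
    "norm (x - x0) \<ge> r / 2 \<Longrightarrow> lens_profile x0 r x = 0"
    "norm (x - x0) \<le> r / 4 \<Longrightarrow> lens_profile x0 r x \<ge> r * exp (- (16/3))"
    "norm (grad (lens_profile x0 r) x) \<le> 2"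
    "norm (x - x0) \<ge> r / 2 \<Longrightarrow> grad (lens_profile x0 r) x = 0"
proof -
  let ?s = "\<lambda>x. 1/4 - (1 / r\<^sup>2) * (norm (x - x0))\<^sup>2"
  have sm: "smooth ?s" by (intro smooth_diff smooth_const smooth_cmult smooth_sq_dist)
  show "smooth (lens_profile x0 r)" unfolding lens_profile_def[abs_def] by (intro smooth_cmult smooth_flat_exp sm)
  show "lens_profile x0 r x \<ge> 0" using r flat_exp_2_bound(1) by (simp add: lens_profile_def)
  have neg: "?s x \<le> 0" if "norm (x - x0) \<ge> r / 2"
  proof -
    have "(r / 2)\<^sup>2 \<le> (norm (x - x0))\<^sup>2" using that r by (intro power_mono) auto
    then show ?thesis using r by (simp add: field_simps)
  qed
  then show "norm (x - x0) \<ge> r / 2 \<Longrightarrow> lens_profile x0 r x = 0" by (simp add: lens_profile_def flat_exp_def)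
  show "lens_profile x0 r x \<ge> r * exp (- (16/3))" if "norm (x - x0) \<le> r / 4"
  proof -
    have "(norm (x - x0))\<^sup>2 \<le> (r / 4)\<^sup>2" using that by (intro power_mono) auto
    then have s: "?s x \<ge> 3/16" using r by (simp add: field_simps)
    then have "1 / ?s x \<le> 16/3" using frac_le[of 1 1 "3/16" "?s x"] by simp
    moreover have "lens_profile x0 r x = r * exp (- (1 / ?s x))"
    proof -
      have "?s x > 0" using s by linarith
      then show ?thesis by (simp only: lens_profile_def flat_exp_def if_True power_0 mult_1_left)
    qed
    ultimately show ?thesis using r by (simp only: mult_left_mono less_imp_le exp_le_cancel_iff neg_le_iff_le)
  qed
  have g2: "grad (\<lambda>x. (norm (x - x0))\<^sup>2) x = 2 *\<^sub>R (x - x0)"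
    unfolding power2_norm_eq_inner
    by (rule has_derivative_gradI) (auto intro!: derivative_eq_intros simp: inner_commute algebra_simps inner_diff_left fun_eq_iff)
  have gs: "grad ?s x = (- (2 / r\<^sup>2)) *\<^sub>R (x - x0)"
  proof -
    have "grad ?s x = grad (\<lambda>x. 1/4 + (- (1 / r\<^sup>2)) * (norm (x - x0))\<^sup>2) x" by simp
    also have "\<dots> = grad (\<lambda>x. 1/4) x + (- (1 / r\<^sup>2)) *\<^sub>R grad (\<lambda>x. (norm (x - x0))\<^sup>2) x"
      by (simp only: grad_add[OF smooth_const smooth_cmult[OF smooth_sq_dist]] grad_cmult[OF smooth_sq_dist])
    also have "grad (\<lambda>x::real^'n. 1/4 :: real) x = 0"
      by (rule has_derivative_gradI) (auto intro!: derivative_eq_intros)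
    finally show ?thesis by (simp add: g2)
  qed
  have gp: "grad (lens_profile x0 r) x = (r * flat_exp 2 (?s x)) *\<^sub>R ((- (2 / r\<^sup>2)) *\<^sub>R (x - x0))"
  proof -
    have "(flat_exp 0 has_real_derivative flat_exp 2 (?s x)) (at (?s x))" using flat_exp_deriv[of 0 "?s x"] by (simp add: numeral_2_eq_2)
    from grad_compose[OF this sm]
    have g: "grad (\<lambda>x. flat_exp 0 (?s x)) x = flat_exp 2 (?s x) *\<^sub>R ((- (2 / r\<^sup>2)) *\<^sub>R (x - x0))" unfolding gs .
    show ?thesis
      unfolding lens_profile_def[abs_def] grad_cmult[OF smooth_flat_exp[OF sm]] g by (simp only: scaleR_scaleR mult.assoc)
  qed
  show z: "grad (lens_profile x0 r) x = 0" if "norm (x - x0) \<ge> r / 2"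
    using neg[OF that] gp by (simp add: flat_exp_def)
  show "norm (grad (lens_profile x0 r) x) \<le> 2"
  proof (cases "norm (x - x0) \<ge> r / 2")
    case False
    have "norm (grad (lens_profile x0 r) x) = r * flat_exp 2 (?s x) * (2 / r\<^sup>2) * norm (x - x0)"
      unfolding gp using r flat_exp_2_bound(1)[of 2 "?s x"] by (simp add: abs_mult)
    also have "\<dots> \<le> r * 2 * (2 / r\<^sup>2) * (r / 2)"
      using False r flat_exp_2_bound(1)[of 2 "?s x"] flat_exp_2_bound(3)[of "?s x"] by (intro mult_mono) auto
    also have "\<dots> = 2" using r by (simp add: power2_eq_square)
    finally show ?thesis .
  qed (simp add: z)
qed

definition lens :: "real^'n::finite \<Rightarrow> real^'n \<Rightarrow> real \<Rightarrow> real \<Rightarrow> (real^'n) set" where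
  "lens n x0 r \<delta> = {x. \<bar>n \<bullet> (x - x0)\<bar> < \<delta> * lens_profile x0 r x}"

text \<open>For e = 0 this is (|l + t| - |l - t|) / 2 with l = n . (x - x0) and t the half-thickness
  \<delta> times the profile, that is, l clamped to [-t, t]: it is l on the lens and t or -t
  elsewhere.\<close>

definition lens_fun :: "real^'n::finite \<Rightarrow> real^'n \<Rightarrow> real \<Rightarrow> real \<Rightarrow> real \<Rightarrow> real^'n \<Rightarrow> real" where
  "lens_fun n x0 r \<delta> e x = (1/2) * (sqrt ((n \<bullet> (x - x0) + \<delta> * lens_profile x0 r x)\<^sup>2 + e\<^sup>2)
     - sqrt ((n \<bullet> (x - x0) - \<delta> * lens_profile x0 r x)\<^sup>2 + e\<^sup>2))"

lemma lens_fun_props: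
  fixes x0 n :: "real^'n::finite"
  assumes r: "r > 0" and e: "e > 0"
  shows "test_fun (ball x0 r) (lens_fun n x0 r \<delta> e)"
    and "grad (lens_fun n x0 r \<delta> e) x = (let l = n \<bullet> (x - x0); t = \<delta> * lens_profile x0 r x; g = \<delta> *\<^sub>R grad (lens_profile x0 r) x in
      (1/2) *\<^sub>R (((l + t) / sqrt ((l + t)\<^sup>2 + e\<^sup>2)) *\<^sub>R (n + g) - ((l - t) / sqrt ((l - t)\<^sup>2 + e\<^sup>2)) *\<^sub>R (n - g)))"
proof -
  let ?p = "lens_profile x0 r"
  let ?l = "\<lambda>x. x \<bullet> n + - (x0 \<bullet> n)"
  note sp = lens_profile_props(1)[OF r, of x0]
  have sl: "smooth ?l" by (intro smooth_add smooth_inner smooth_const)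
  have gl: "grad ?l x = n" for x by (rule has_derivative_gradI) (auto intro!: derivative_eq_intros simp: inner_commute)
  have l: "n \<bullet> (x - x0) = ?l x" for x by (simp add: inner_diff_right inner_commute)
  have sa: "smooth (\<lambda>x. ?l x + c * ?p x)" for c by (intro smooth_add[OF sl] smooth_cmult sp)
  have ga: "grad (\<lambda>x. ?l x + c * ?p x) x = n + c *\<^sub>R grad ?p x" for c x
    by (simp only: grad_add[OF sl smooth_cmult[OF sp]] grad_cmult[OF sp] gl)
  have eq: "lens_fun n x0 r \<delta> e = (\<lambda>x. (1/2) * (sqrt ((?l x + \<delta> * ?p x)\<^sup>2 + e\<^sup>2) + (-1) * sqrt ((?l x + (- \<delta>) * ?p x)\<^sup>2 + e\<^sup>2)))"
    unfolding lens_fun_def l by (simp add: fun_eq_iff)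
  note ss = smooth_abs_approx[OF e sa]
  show "test_fun (ball x0 r) (lens_fun n x0 r \<delta> e)"
  proof (rule test_funI[of _ "cball x0 (r/2)"])
    show "smooth (lens_fun n x0 r \<delta> e)" unfolding eq by (intro smooth_cmult smooth_add ss)
    show "cball x0 (r/2) \<subseteq> ball x0 r" using r by auto
    show "lens_fun n x0 r \<delta> e x = 0" if "x \<notin> cball x0 (r/2)" for x
      using that lens_profile_props(3)[OF r, of x x0] by (simp add: lens_fun_def dist_norm norm_minus_commute)
  qed simp
  show "grad (lens_fun n x0 r \<delta> e) x = (let l = n \<bullet> (x - x0); t = \<delta> * lens_profile x0 r x; g = \<delta> *\<^sub>R grad (lens_profile x0 r) x in
      (1/2) *\<^sub>R (((l + t) / sqrt ((l + t)\<^sup>2 + e\<^sup>2)) *\<^sub>R (n + g) - ((l - t) / sqrt ((l - t)\<^sup>2 + e\<^sup>2)) *\<^sub>R (n - g)))"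
    unfolding eq Let_def grad_cmult[OF smooth_add[OF ss(1) smooth_cmult[OF ss(1)]]]
      grad_add[OF ss(1) smooth_cmult[OF ss(1)]] grad_cmult[OF ss(1)] ss(2) ga l
    by (simp add: scaleR_minus_left[symmetric] minus_divide_left del: scaleR_minus_left)
qed

lemma lens_subset_ball:
  assumes "r > 0" shows "lens n x0 r \<delta> \<subseteq> ball x0 r"
proof
  fix x assume "x \<in> lens n x0 r \<delta>"
  then have "lens_profile x0 r x \<noteq> 0" by (auto simp: lens_def)
  then have "norm (x - x0) < r / 2" using lens_profile_props(3)[OF assms, of x x0] by (meson not_le)
  then show "x \<in> ball x0 r" using assms by (simp add: dist_norm norm_minus_commute)
qed

lemma lens_borel: assumes "r > 0" shows "lens n x0 r \<delta> \<in> sets borel"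
proof -
  note [measurable] = borel_measurable_continuous_onI[OF smooth_continuous[OF lens_profile_props(1)[OF assms, of x0]]]
  show ?thesis unfolding lens_def by measurable
qed

text \<open>Translates of the lens in direction \<open>n\<close> cover a ball, which bounds its volume from below.\<close>
lemma lens_measure_ge:
  fixes x0 n :: "real^'n::finite"
  assumes r: "r > 0" and n: "norm n = 1" and \<delta>: "0 < \<delta>" "\<delta> \<le> 1/8"
  shows "\<delta> * ((1/8)^CARD('n) / (exp (16/3) / 4 + 5)) * measure lborel (ball x0 r) \<le> measure lborel (lens n x0 r \<delta>)"
proof -
  \<comment> \<open>A lower bound for the half-thickness of the lens within distance r / 4 of the
    centre, hence a safe spacing of the translates.\<close>
  define h where "h = \<delta> * r * exp (- (16/3))"
  have h: "h > 0" using \<delta> r by (simp add: h_def)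
  have h8: "h \<le> r / 8"
  proof -
    have "\<delta> * exp (- (16/3)) \<le> (1/8) * 1" using \<delta> by (intro mult_mono) auto
    then have "r * (\<delta> * exp (- (16/3))) \<le> r * (1/8)" using r by (intro mult_left_mono) auto
    then show ?thesis by (simp add: h_def mult_ac)
  qed
  \<comment> \<open>On the ball of radius r / 8 the normal coordinate is at most r / 8 in modulus,
    so shifts j with |j| <= r / (8 h) + 1 suffice.\<close>
  define J where "J = \<lceil>r / (8 * h)\<rceil> + 1"
  have J: "r / (8 * h) + 1 \<le> of_int J" "of_int J \<le> r / (8 * h) + 2" by (simp_all add: J_def) linarith+
  let ?L = "lens n x0 r \<delta>"
  have fin: "emeasure lborel ?L < \<infinity>"
    using emeasure_mono[OF lens_subset_ball[OF r, of n x0 \<delta>], of lborel] emeasure_lborel_ball_finite[of x0 r] lens_borel[OF r]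
    by (auto intro: le_less_trans)
  have cover: "ball x0 (r/8) \<subseteq> (\<Union>j\<in>{-J..J}. (+) ((of_int j * h) *\<^sub>R n) ` ?L)"
  proof
    fix x assume "x \<in> ball x0 (r/8)"
    then have x: "norm (x - x0) < r/8" by (simp add: dist_norm norm_minus_commute)
    define l where "l = n \<bullet> (x - x0)"
    have ll: "\<bar>l\<bar> \<le> norm (x - x0)" using Cauchy_Schwarz_ineq2[of n "x - x0"] n by (simp add: l_def)
    define j where "j = \<lfloor>l / h\<rfloor>"
    have j: "0 \<le> l - of_int j * h" "l - of_int j * h < h"
    proof -
      have "of_int j \<le> l / h" "l / h < of_int j + 1" unfolding j_def by linarith+
      then show "0 \<le> l - of_int j * h" "l - of_int j * h < h" using h by (simp_all add: field_simps)
    qed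
    have "\<bar>l / h\<bar> \<le> r / (8 * h)" using ll x h by (simp add: abs_divide field_simps)
    then have "- (r / (8 * h)) - 1 \<le> of_int j" "of_int j \<le> r / (8 * h)" unfolding j_def by linarith+
    then have "- of_int J \<le> (of_int j :: real)" "of_int j \<le> (of_int J :: real)" using J by linarith+
    then have jJ: "j \<in> {-J..J}" by simp
    define w where "w = x - (of_int j * h) *\<^sub>R n"
    have nn: "n \<bullet> n = 1" using n by (simp add: norm_eq_1)
    have nw: "n \<bullet> (w - x0) = l - of_int j * h" by (simp add: w_def l_def inner_diff_right nn algebra_simps)
    \<comment> \<open>The shift keeps the tangential part, of length below r / 8, and leaves a
      normal part in [0, h). Since h <= r / 8, the shifted point lies within r / 4 of the
      centre.\<close>
    have ww: "w - x0 = ((x - x0) - l *\<^sub>R n) + (l - of_int j * h) *\<^sub>R n" by (simp add: w_def algebra_simps)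
    have "norm (w - x0) \<le> norm ((x - x0) - l *\<^sub>R n) + norm ((l - of_int j * h) *\<^sub>R n)"
      unfolding ww by (rule norm_triangle_ineq)
    moreover have "norm ((l - of_int j * h) *\<^sub>R n) = \<bar>l - of_int j * h\<bar>" using n by simp
    moreover have "norm ((x - x0) - l *\<^sub>R n) \<le> norm (x - x0)"
    proof (rule power2_le_imp_le)
      have "(norm ((x - x0) - l *\<^sub>R n))\<^sup>2 = (norm (x - x0))\<^sup>2 - l\<^sup>2"
        unfolding power2_norm_eq_inner by (simp add: inner_diff_left inner_diff_right inner_commute l_def nn power2_eq_square algebra_simps)
      then show "(norm ((x - x0) - l *\<^sub>R n))\<^sup>2 \<le> (norm (x - x0))\<^sup>2" by simp
    qed simp
    ultimately have "norm (w - x0) \<le> r / 4" using x j h8 by linarith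
    from lens_profile_props(4)[OF r this] have "h \<le> \<delta> * lens_profile x0 r w"
      using \<delta>(1) by (simp add: h_def mult.assoc mult_left_mono)
    then have "w \<in> ?L" using nw j by (simp add: lens_def)
    moreover have "x = (of_int j * h) *\<^sub>R n + w" by (simp add: w_def)
    ultimately show "x \<in> (\<Union>j\<in>{-J..J}. (+) ((of_int j * h) *\<^sub>R n) ` ?L)" using jJ by blast
  qed
  have tr: "(+) v ` ?L \<in> sets borel" "measure lborel ((+) v ` ?L) = measure lborel ?L" "emeasure lborel ((+) v ` ?L) < \<infinity>" for v
  proof -
    have eq: "(+) v ` ?L = (\<lambda>x. x - v) -` ?L" by (auto simp: image_iff) (metis add.commute diff_add_cancel)
    have m: "(\<lambda>x. x - v) \<in> borel_measurable borel" by simp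
    show s: "(+) v ` ?L \<in> sets borel" unfolding eq using measurable_sets_borel[OF m lens_borel[OF r]] by simp
    have "emeasure lborel ((+) v ` ?L) = emeasure (distr lborel borel ((+) (- v))) ?L"
      unfolding eq by (subst emeasure_distr) (auto simp: lens_borel[OF r] vimage_def)
    then have e: "emeasure lborel ((+) v ` ?L) = emeasure lborel ?L" by (simp add: lborel_distr_plus)
    then show "measure lborel ((+) v ` ?L) = measure lborel ?L" "emeasure lborel ((+) v ` ?L) < \<infinity>" using fin by (simp_all add: measure_def)
  qed
  have "measure lborel (ball x0 (r/8)) \<le> measure lborel (\<Union>j\<in>{-J..J}. (+) ((of_int j * h) *\<^sub>R n) ` ?L)"
  proof (rule measure_mono_fmeasurable[OF cover])
    show "(\<Union>j\<in>{-J..J}. (+) ((of_int j * h) *\<^sub>R n) ` ?L) \<in> fmeasurable lborel"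
      using tr by (intro fmeasurable.finite_UN) (auto intro!: fmeasurableI)
  qed simp
  also have "\<dots> \<le> (\<Sum>j\<in>{-J..J}. measure lborel ((+) ((of_int j * h) *\<^sub>R n) ` ?L))"
    using tr by (intro measure_UNION_le) auto
  also have "\<dots> = real (card {-J..J}) * measure lborel ?L" by (simp add: tr(2))
  \<comment> \<open>There are 2 J + 1 <= r / (4 h) + 5 translates, and r / h = exp (16/3) /
    \<delta>; the 5 is absorbed because \<delta> <= 1.\<close>
  also have "real (card {-J..J}) \<le> (exp (16/3) / 4 + 5) / \<delta>"
  proof -
    have "J \<ge> 0" using J(1) h r by (smt (verit) divide_nonneg_nonneg of_int_0_le_iff)
    then have "real (card {-J..J}) = 2 * of_int J + 1" by simp
    also have "\<dots> \<le> 2 * (r / (8 * h) + 2) + 1" using J(2) by (intro add_right_mono mult_left_mono) auto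
    also have "\<dots> = (exp (16/3) / 4) / \<delta> + 5" using r \<delta> by (simp add: h_def exp_minus field_simps)
    also have "\<dots> \<le> (exp (16/3) / 4 + 5) / \<delta>" using \<delta> by (simp add: field_simps)
    finally show ?thesis .
  qed
  finally have le: "measure lborel (ball x0 (r/8)) \<le> (exp (16/3) / 4 + 5) / \<delta> * measure lborel ?L"
    by (simp add: mult_right_mono)
  have b: "measure lborel (ball x0 (r/8)) = (1/8)^CARD('n) * measure lborel (ball x0 r)"
    using r by (simp add: content_ball power_divide)
  have "exp (16/3) / 4 + 5 > (0::real)" by (simp add: add_pos_pos)
  moreover have "\<delta> * (u / C) * v \<le> w" if "u * v \<le> C / \<delta> * w" "C > 0" for u v w C :: real
  proof -
    have "\<delta> * (u / C) * v = \<delta> / C * (u * v)" by simp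
    also have "\<dots> \<le> \<delta> / C * (C / \<delta> * w)" using that \<delta> by (intro mult_left_mono) auto
    also have "\<dots> = w" using that \<delta> by simp
    finally show ?thesis .
  qed
  ultimately show ?thesis using le unfolding b by blast
qed


text \<open>In the limit \<open>e \<rightarrow> 0\<close> the gradient of the lens function is \<open>n\<close> inside the lens and of size \<open>\<delta>\<close> outside;
  the error is of order \<open>\<delta>\<^sup>2\<close> while the volume of the lens is of order \<open>\<delta>\<close>.\<close>
lemma lens_fun_grad_limit:
  fixes x0 n :: "real^'n::finite"
  assumes r: "r > 0" and n: "norm n = 1" and \<delta>: "0 < \<delta>" "\<delta> \<le> 1/8"
    and null: "emeasure lborel {x. lens_profile x0 r x > 0 \<and> \<bar>n \<bullet> (x - x0)\<bar> = \<delta> * lens_profile x0 r x} = 0"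
  shows "\<exists>e>0. (nrm2 lborel (\<lambda>x. grad (lens_fun n x0 r \<delta> e) x - indicator (lens n x0 r \<delta>) x *\<^sub>R n))\<^sup>2
    \<le> 5 * \<delta>\<^sup>2 * measure lborel (ball x0 r)"
proof -
  let ?p = "lens_profile x0 r" and ?B = "ball x0 r" and ?L = "lens n x0 r \<delta>"
  define l where "l x = n \<bullet> (x - x0)" for x
  define t where "t x = \<delta> * ?p x" for x
  define g where "g x = \<delta> *\<^sub>R grad ?p x" for x
  define W where "W s u x = (1/2) *\<^sub>R (s *\<^sub>R (n + g x) - u *\<^sub>R (n - g x))" for s u :: real and x
  define D where "D k x = grad (lens_fun n x0 r \<delta> (1 / real (Suc k))) x - indicator ?L x *\<^sub>R n" for k x
  define D0 where "D0 x = W (sgn (l x + t x)) (sgn (l x - t x)) x - indicator ?L x *\<^sub>R n" for x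
  have ep: "1 / real (Suc k) > 0" for k by simp
  have D: "D k x = W ((l x + t x) / sqrt ((l x + t x)\<^sup>2 + (1 / real (Suc k))\<^sup>2)) ((l x - t x) / sqrt ((l x - t x)\<^sup>2 + (1 / real (Suc k))\<^sup>2)) x
    - indicator ?L x *\<^sub>R n" for k x
    unfolding D_def lens_fun_props(2)[OF r ep] W_def Let_def l_def t_def g_def ..
  have gb: "norm (g x) \<le> 2 * \<delta>" for x using \<delta> lens_profile_props(5)[OF r, of x0 x] by (simp add: g_def mult.commute mult_left_mono)
  have off: "t x = 0" "g x = 0" if "x \<notin> ?B" for x
  proof -
    have h: "norm (x - x0) \<ge> r / 2" using that r by (simp add: dist_norm norm_minus_commute)
    show "t x = 0" "g x = 0" by (simp_all add: t_def g_def lens_profile_props(3)[OF r h] lens_profile_props(6)[OF r h])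
  qed
  have t0: "t x \<ge> 0" for x unfolding t_def by (intro mult_nonneg_nonneg lens_profile_props(2)[OF r]) (use \<delta> in simp)
  have inL: "x \<in> ?L \<longleftrightarrow> \<bar>l x\<bar> < t x" for x by (simp add: lens_def l_def t_def)
  have Db: "norm (D k x) \<le> 3 * indicator ?B x" for k x
  proof (cases "x \<in> ?B")
    case True
    define s where "s = (l x + t x) / sqrt ((l x + t x)\<^sup>2 + (1 / real (Suc k))\<^sup>2)"
    define u where "u = (l x - t x) / sqrt ((l x - t x)\<^sup>2 + (1 / real (Suc k))\<^sup>2)"
    have su: "\<bar>s\<bar> \<le> 1" "\<bar>u\<bar> \<le> 1" unfolding s_def u_def by (rule abs_div_sqrt_le_1)+
    have np: "norm (n + g x) \<le> 5/4" "norm (n - g x) \<le> 5/4"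
      using norm_triangle_ineq[of n "g x"] norm_triangle_ineq4[of n "g x"] gb[of x] n \<delta> by linarith+
    have "norm (s *\<^sub>R (n + g x) - u *\<^sub>R (n - g x)) \<le> norm (s *\<^sub>R (n + g x)) + norm (u *\<^sub>R (n - g x))" by (rule norm_triangle_ineq4)
    also have "\<dots> \<le> 1 * (5/4) + 1 * (5/4)" unfolding norm_scaleR using su np by (intro add_mono mult_mono) auto
    finally have "norm (W s u x) \<le> 5/4" by (simp add: W_def)
    moreover have "norm (indicator ?L x *\<^sub>R n) \<le> 1" using n by (simp add: indicator_def)
    moreover have "norm (D k x) \<le> norm (W s u x) + norm (indicator ?L x *\<^sub>R n)"
      unfolding D s_def[symmetric] u_def[symmetric] by (rule norm_triangle_ineq4)
    ultimately show ?thesis using True by simp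
  next
    case False
    then show ?thesis using off[OF False] inL[of x] by (simp add: D W_def)
  qed
  have Dl: "(\<lambda>k. D k x) \<longlonglongrightarrow> D0 x" for x
    unfolding D D0_def W_def by (intro tendsto_intros div_sqrt_tendsto_sgn)
  \<comment> \<open>The two signs agree outside the lens and differ inside, which leaves g or -g
    outside and exactly n inside. On the boundary |l| = t > 0 one sign is 0 and the limit has size
    about 1/2 instead of \<delta>; the null set hypothesis removes it.\<close>
  have D0b: "norm (D0 x) \<le> 2 * \<delta> * indicator ?B x" if ne: "\<not> (?p x > 0 \<and> \<bar>n \<bullet> (x - x0)\<bar> = \<delta> * ?p x)" for x
  proof (cases "x \<in> ?B")
    case True
    consider "\<bar>l x\<bar> < t x" | "l x > t x" | "l x < - t x" | "l x = 0" "t x = 0"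
    proof -
      have "\<bar>l x\<bar> = t x \<Longrightarrow> t x = 0"
        using ne lens_profile_props(2)[OF r, of x0 x] by (auto simp: l_def t_def)
      then show thesis using that t0[of x] by linarith
    qed
    then have "norm (D0 x) \<le> norm (g x)"
    proof cases
      case 1
      then have "sgn (l x + t x) = 1" "sgn (l x - t x) = -1" by (auto simp: sgn_if)
      then have "W (sgn (l x + t x)) (sgn (l x - t x)) x = (1/2) *\<^sub>R (2 *\<^sub>R n)" by (simp add: W_def scaleR_2)
      then show ?thesis using 1 inL[of x] by (simp add: D0_def)
    next
      case 2
      then have "sgn (l x + t x) = 1" "sgn (l x - t x) = 1" using t0[of x] by (auto simp: sgn_if)
      then have "W (sgn (l x + t x)) (sgn (l x - t x)) x = (1/2) *\<^sub>R (2 *\<^sub>R g x)" by (simp add: W_def scaleR_2)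
      moreover have "x \<notin> ?L" using 2 t0[of x] by (simp add: inL)
      ultimately show ?thesis by (simp add: D0_def)
    next
      case 3
      then have "sgn (l x + t x) = -1" "sgn (l x - t x) = -1" using t0[of x] by (auto simp: sgn_if)
      then have "W (sgn (l x + t x)) (sgn (l x - t x)) x = (1/2) *\<^sub>R ((- 2) *\<^sub>R g x)" by (simp add: W_def scaleR_2)
      moreover have "x \<notin> ?L" using 3 t0[of x] by (simp add: inL)
      ultimately show ?thesis by (simp add: D0_def)
    next
      case 4
      then show ?thesis by (simp add: D0_def W_def inL)
    qed
    then show ?thesis using gb[of x] True by simp
  next
    case False
    then show ?thesis using off[OF False] inL[of x] by (simp add: D0_def W_def)
  qed
  note tf = lens_fun_props(1)[OF r ep, of x0 n \<delta>]
  have Lb: "?L \<in> sets lborel" "emeasure lborel ?L < \<infinity>"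
    using lens_borel[OF r] emeasure_mono[OF lens_subset_ball[OF r, of n x0 \<delta>], of lborel] emeasure_lborel_ball_finite[of x0 r]
    by (auto intro: le_less_trans)
  have Dm: "D k \<in> borel_measurable lborel" for k
    unfolding D_def using sqi_diff[OF sqi_test_fun(2)[OF tf] sqi_indicator(1)[OF Lb], of k n] by (rule sqi_measurable)
  have D0m: "D0 \<in> borel_measurable lborel" by (rule borel_measurable_LIMSEQ_metric[OF Dm Dl])
  have lim: "(\<lambda>k. \<integral>x. (norm (D k x))\<^sup>2 \<partial>lborel) \<longlonglongrightarrow> (\<integral>x. (norm (D0 x))\<^sup>2 \<partial>lborel)"
  proof (rule integral_dominated_convergence[where w="\<lambda>x. 9 * indicator ?B x"])
    show "(\<lambda>x. (norm (D0 x))\<^sup>2) \<in> borel_measurable lborel" using D0m by measurable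
    show "(\<lambda>x. (norm (D k x))\<^sup>2) \<in> borel_measurable lborel" for k using Dm[of k] by measurable
    show "integrable lborel (\<lambda>x. 9 * indicator ?B x :: real)"
      using emeasure_lborel_ball_finite[of x0 r] by (intro integrable_mult_right integrable_real_indicator) simp_all
    show "AE x in lborel. (\<lambda>k. (norm (D k x))\<^sup>2) \<longlonglongrightarrow> (norm (D0 x))\<^sup>2" by (intro AE_I2 tendsto_intros Dl)
    show "AE x in lborel. norm ((norm (D k x))\<^sup>2) \<le> 9 * indicator ?B x" for k
    proof (rule AE_I2)
      fix x show "norm ((norm (D k x))\<^sup>2) \<le> 9 * indicator ?B x"
        using power_mono[OF Db[of k x], of 2] by (cases "x \<in> ?B") (simp_all add: power_mult_distrib)
    qed
  qed
  let ?N = "{x. ?p x > 0 \<and> \<bar>n \<bullet> (x - x0)\<bar> = \<delta> * ?p x}"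
  have ae: "AE x in lborel. \<not> (?p x > 0 \<and> \<bar>n \<bullet> (x - x0)\<bar> = \<delta> * ?p x)"
  proof -
    note [measurable] = borel_measurable_continuous_onI[OF smooth_continuous[OF lens_profile_props(1)[OF r, of x0]]]
    have "?N \<in> sets borel" by measurable
    then have "?N \<in> null_sets lborel" using null by (auto simp: null_sets_def)
    from AE_not_in[OF this] show ?thesis by simp
  qed
  have Bi: "integrable lborel (\<lambda>x. 4 * \<delta>\<^sup>2 * indicator ?B x :: real)"
    using emeasure_lborel_ball_finite[of x0 r] by (intro integrable_mult_right integrable_real_indicator) simp_all
  have ae2: "AE x in lborel. (norm (D0 x))\<^sup>2 \<le> 4 * \<delta>\<^sup>2 * indicator ?B x"
    using ae
  proof eventually_elim
    case (elim x)
    then show ?case using power_mono[OF D0b[of x], of 2] by (cases "x \<in> ?B") (simp_all add: power_mult_distrib)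
  qed
  have "(\<integral>x. (norm (D0 x))\<^sup>2 \<partial>lborel) \<le> (\<integral>x. 4 * \<delta>\<^sup>2 * indicator ?B x \<partial>lborel)"
  proof (rule integral_mono_AE[OF _ Bi ae2])
    show "integrable lborel (\<lambda>x. (norm (D0 x))\<^sup>2)"
      by (rule Bochner_Integration.integrable_bound[OF Bi]) (use D0m ae2 in \<open>auto elim: eventually_mono\<close>)
  qed
  also have "\<dots> = 4 * \<delta>\<^sup>2 * measure lborel ?B" using emeasure_lborel_ball_finite[of x0 r] by simp
  \<comment> \<open>Passing from 4 to 5 creates the strict slack that a single member of the
    sequence needs.\<close>
  also have "\<dots> < 5 * \<delta>\<^sup>2 * measure lborel ?B" using \<delta> r by simp
  finally have "\<forall>\<^sub>F k in sequentially. (\<integral>x. (norm (D k x))\<^sup>2 \<partial>lborel) < 5 * \<delta>\<^sup>2 * measure lborel ?B"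
    by (rule order_tendstoD(2)[OF lim])
  then obtain k where "(\<integral>x. (norm (D k x))\<^sup>2 \<partial>lborel) < 5 * \<delta>\<^sup>2 * measure lborel ?B" by (auto simp: eventually_sequentially)
  then show ?thesis using ep[of k] by (intro exI[of _ "1 / real (Suc k)"]) (simp add: nrm2_sq D_def less_imp_le)
qed

text \<open>Squared error and volume are of order \<delta>^2 and \<delta>, so a small \<delta> gives
  the relative error \<tau>. Where the profile is positive, the lens boundaries for different
  \<delta> are disjoint, so at most countably many have positive measure. Taking \<delta> from the
  interval [\<delta>0, 2 \<delta>0] avoids them while c stays independent of x0 and r.\<close>

theorem thin_inclusion_exists:
  fixes n :: "real^'n::finite"
  assumes n: "norm n = 1" and \<tau>: "\<tau> > 0"
  obtains c where "c > 0" "\<And>x0 r. r > 0 \<Longrightarrow> \<exists>E \<psi>. E \<in> sets borel \<and> E \<subseteq> ball x0 r \<and> test_fun (ball x0 r) \<psi> \<and>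
    c * measure lborel (ball x0 r) \<le> measure lborel E \<and>
    (nrm2 lborel (\<lambda>x. grad \<psi> x - indicator E x *\<^sub>R n))\<^sup>2 \<le> \<tau> * measure lborel E"
proof -
  define c2 where "c2 = (1/8::real)^CARD('n) / (exp (16/3) / 4 + 5)"
  have c2: "c2 > 0" unfolding c2_def by (intro divide_pos_pos add_pos_pos) auto
  \<comment> \<open>For \<delta> <= 2 \<delta>0 this ensures \<delta> <= 1/8 and 5 \<delta> <=
    \<tau> c2, which makes the error at most \<tau> times the volume.\<close>
  define \<delta>0 where "\<delta>0 = min (1/16) (\<tau> * c2 / 10)"
  have \<delta>0: "\<delta>0 > 0" "\<delta>0 \<le> 1/16" "10 * \<delta>0 \<le> \<tau> * c2" using \<tau> c2 by (auto simp: \<delta>0_def)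
  show thesis
  proof (rule that[of "\<delta>0 * c2"])
    show "\<delta>0 * c2 > 0" using \<delta>0 c2 by simp
    fix x0 :: "real^'n" and r :: real assume r: "r > 0"
    let ?p = "lens_profile x0 r" and ?B = "ball x0 r"
    note [measurable] = borel_measurable_continuous_onI[OF smooth_continuous[OF lens_profile_props(1)[OF r, of x0]]]
    define N where "N \<delta> = {x. ?p x > 0 \<and> \<bar>n \<bullet> (x - x0)\<bar> = \<delta> * ?p x}" for \<delta>
    \<comment> \<open>The thickness parameter whose lens boundary contains x; the value -1 keeps
      points of zero profile out of all level sets with \<delta> > 0.\<close>
    define q where "q x = (if ?p x > 0 then \<bar>n \<bullet> (x - x0)\<bar> / ?p x else -1)" for x
    have qm: "q \<in> borel_measurable (restrict_space lborel ?B)"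
      unfolding q_def by (rule measurable_restrict_space1) measurable
    define Q where "Q = distr (restrict_space lborel ?B) borel q"
    have sp: "space (restrict_space lborel ?B) = ?B" by (simp add: space_restrict_space)
    have eB: "emeasure (restrict_space lborel ?B) ?B = emeasure lborel ?B" by (rule emeasure_restrict_space) simp_all
    interpret finite_measure Q
    proof
      have "emeasure Q (space Q) = emeasure lborel ?B"
        unfolding Q_def by (simp add: emeasure_distr[OF qm] sp eB)
      then show "emeasure Q (space Q) \<noteq> \<infinity>" using emeasure_lborel_ball_finite[of x0 r] by auto
    qed
    have "\<not> {\<delta>0..2 * \<delta>0} \<subseteq> {\<delta>. measure Q {\<delta>} \<noteq> 0}"
      using countable_support countable_subset uncountable_closed_interval[of \<delta>0 "2 * \<delta>0"] \<delta>0 by auto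
    then obtain \<delta> where \<delta>: "\<delta>0 \<le> \<delta>" "\<delta> \<le> 2 * \<delta>0" "measure Q {\<delta>} = 0" by auto
    have \<delta>8: "0 < \<delta>" "\<delta> \<le> 1/8" using \<delta> \<delta>0 by linarith+
    have "N \<delta> = q -` {\<delta>} \<inter> ?B"
    proof (intro set_eqI iffI)
      fix x assume x: "x \<in> N \<delta>"
      then have "?p x \<noteq> 0" by (simp add: N_def)
      then have "norm (x - x0) < r / 2" using lens_profile_props(3)[OF r, of x x0] by (meson not_le)
      then show "x \<in> q -` {\<delta>} \<inter> ?B" using x r by (simp add: N_def q_def dist_norm norm_minus_commute)
    next
      fix x assume "x \<in> q -` {\<delta>} \<inter> ?B"
      then show "x \<in> N \<delta>" using \<delta>8 by (auto simp: N_def q_def split: if_splits)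
    qed
    moreover have "emeasure Q {\<delta>} = emeasure (restrict_space lborel ?B) (q -` {\<delta>} \<inter> ?B)"
      unfolding Q_def by (simp add: emeasure_distr[OF qm] sp)
    moreover have "emeasure (restrict_space lborel ?B) (q -` {\<delta>} \<inter> ?B) = emeasure lborel (q -` {\<delta>} \<inter> ?B)"
      by (rule emeasure_restrict_space) simp_all
    moreover have "emeasure Q {\<delta>} = 0" using \<delta>(3) by (simp add: emeasure_eq_measure)
    ultimately have "emeasure lborel (N \<delta>) = 0" by simp
    from lens_fun_grad_limit[OF r n \<delta>8 this[unfolded N_def]] obtain e where e: "e > 0"
      "(nrm2 lborel (\<lambda>x. grad (lens_fun n x0 r \<delta> e) x - indicator (lens n x0 r \<delta>) x *\<^sub>R n))\<^sup>2 \<le> 5 * \<delta>\<^sup>2 * measure lborel ?B" by blast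
    have vol: "\<delta> * c2 * measure lborel ?B \<le> measure lborel (lens n x0 r \<delta>)"
      using lens_measure_ge[OF r n \<delta>8] by (simp add: c2_def)
    have "5 * \<delta>\<^sup>2 * measure lborel ?B \<le> \<tau> * (\<delta> * c2 * measure lborel ?B)"
    proof -
      have "5 * \<delta> \<le> \<tau> * c2" using \<delta> \<delta>0 by linarith
      then have "5 * \<delta> * (\<delta> * measure lborel ?B) \<le> \<tau> * c2 * (\<delta> * measure lborel ?B)" using \<delta>8 by (intro mult_right_mono) auto
      then show ?thesis by (simp add: power2_eq_square mult_ac)
    qed
    also have "\<dots> \<le> \<tau> * measure lborel (lens n x0 r \<delta>)" using \<tau> by (intro mult_left_mono vol) simp
    finally have err: "(nrm2 lborel (\<lambda>x. grad (lens_fun n x0 r \<delta> e) x - indicator (lens n x0 r \<delta>) x *\<^sub>R n))\<^sup>2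
      \<le> \<tau> * measure lborel (lens n x0 r \<delta>)" using e(2) by linarith
    have "\<delta>0 * c2 * measure lborel ?B \<le> \<delta> * c2 * measure lborel ?B"
      using \<delta>(1) c2 by (intro mult_right_mono) auto
    with vol have vol0: "\<delta>0 * c2 * measure lborel ?B \<le> measure lborel (lens n x0 r \<delta>)" by linarith
    show "\<exists>E \<psi>. E \<in> sets borel \<and> E \<subseteq> ball x0 r \<and> test_fun (ball x0 r) \<psi> \<and>
      \<delta>0 * c2 * measure lborel (ball x0 r) \<le> measure lborel E \<and>
      (nrm2 lborel (\<lambda>x. grad \<psi> x - indicator E x *\<^sub>R n))\<^sup>2 \<le> \<tau> * measure lborel E"
      using lens_borel[OF r, of n x0 \<delta>] lens_subset_ball[OF r, of n x0 \<delta>] lens_fun_props(1)[OF r e(1), of x0 n \<delta>] vol0 err by blast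
  qed
qed

section \<open>Lower semicontinuous costs\<close>

lemma lsc_onD: "lsc_on S g \<Longrightarrow> x \<in> S \<Longrightarrow> (\<And>n. s n \<in> S) \<Longrightarrow> s \<longlonglongrightarrow> x \<Longrightarrow> g x \<le> liminf (\<lambda>n. g (s n))"
  by (simp add: lsc_on_def)

text \<open>Sublevel sets are sequentially closed. The values of g below \<alpha> are arbitrary,
  hence the composition with \<open>max \<alpha>\<close>.\<close>

lemma lsc_on_borel:
  assumes "lsc_on {\<alpha>..} g"
  shows "(\<lambda>t. g (max \<alpha> t)) \<in> borel_measurable borel"
  unfolding borel_measurable_iff_Iic_ereal
proof
  fix c
  have "closed {t. g (max \<alpha> t) \<le> c}"
    unfolding closed_sequential_limits
  proof (intro allI impI, elim conjE)
    fix s l assume s: "\<forall>n. s n \<in> {t. g (max \<alpha> t) \<le> c}" and lim: "s \<longlonglongrightarrow> l"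
    have "(\<lambda>n. max \<alpha> (s n)) \<longlonglongrightarrow> max \<alpha> l" by (intro tendsto_intros lim)
    then have "g (max \<alpha> l) \<le> liminf (\<lambda>n. g (max \<alpha> (s n)))" by (intro lsc_onD[OF assms]) auto
    also have "\<dots> \<le> liminf (\<lambda>n::nat. c)" by (rule Liminf_mono) (use s in auto)
    finally show "l \<in> {t. g (max \<alpha> t) \<le> c}" by (simp add: Liminf_const)
  qed
  moreover have "(\<lambda>t. g (max \<alpha> t)) -` {..c} \<inter> space borel = {t. g (max \<alpha> t) \<le> c}" by auto
  ultimately show "(\<lambda>t. g (max \<alpha> t)) -` {..c} \<inter> space borel \<in> sets borel" by (simp only: borel_closed)
qed

text \<open>Otherwise points of a compact interval with values below -n accumulate, and
  semicontinuity forces the value minus infinity at a limit point.\<close>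

lemma lsc_on_bounded_below:
  assumes g: "\<forall>b. g b \<noteq> -\<infinity>" and lsc: "lsc_on {\<alpha>..} g"
  shows "\<exists>m. \<forall>s\<in>{\<alpha>..C}. ereal m \<le> g s"
proof (rule ccontr)
  assume "\<not> ?thesis"
  then have "\<forall>n::nat. \<exists>s\<in>{\<alpha>..C}. g s < ereal (- real n)" by (metis not_le)
  then obtain s where s: "\<And>n::nat. s n \<in> {\<alpha>..C}" "\<And>n. g (s n) < ereal (- real n)" by metis
  obtain l r where l: "l \<in> {\<alpha>..C}" "strict_mono r" "(s \<circ> r) \<longlonglongrightarrow> l"
    using compact_imp_seq_compact[OF compact_Icc[of \<alpha> C]] s(1) unfolding seq_compact_def by metis
  have "g l \<le> liminf (\<lambda>n. g ((s \<circ> r) n))"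
    by (rule lsc_onD[OF lsc _ _ l(3)]) (use l(1) s(1) in auto)
  also have "\<dots> \<le> ereal (- x)" for x
  proof -
    obtain N where N: "x \<le> real N" using real_arch_simple by blast
    have "\<forall>\<^sub>F n in sequentially. g ((s \<circ> r) n) \<le> ereal (- x)"
      using eventually_ge_at_top[of N]
    proof eventually_elim
      case (elim n)
      have "real n \<le> real (r n)" using seq_suble[OF l(2), of n] by simp
      then have "- real (r n) \<le> - x" using N elim by linarith
      then have "ereal (- real (r n)) \<le> ereal (- x)" by simp
      then have "g (s (r n)) \<le> ereal (- x)" by (rule order_trans[OF less_imp_le[OF s(2)]])
      then show ?case by simp
    qed
    from Liminf_mono[OF this] show ?thesis by (simp add: Liminf_const)
  qed
  finally have "\<And>x. g l \<le> ereal (- x)" .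
  then have "\<And>x. g l \<le> ereal x" by (metis minus_minus)
  then have "g l = -\<infinity>" by (rule ereal_bot)
  then show False using g by blast
qed

text \<open>Near a0 semicontinuity gives g > L; at distance at least \<eta> the term K \<eta>^2 = |L
  - m| pushes the parabola below the lower bound m on the interval. The quadratic error is later
  controlled by the L^2 oscillation of the coefficient.\<close>

lemma lsc_on_quadratic_minorant:
  assumes g: "\<forall>b. g b \<noteq> -\<infinity>" and lsc: "lsc_on {\<alpha>..} g" and a0: "a0 \<ge> \<alpha>" and L: "ereal L < g a0"
  shows "\<exists>K\<ge>0. \<forall>s\<in>{\<alpha>..C}. ereal (L - K * (s - a0)\<^sup>2) \<le> g s"
proof -
  have "\<exists>\<eta>>0. \<forall>s\<ge>\<alpha>. \<bar>s - a0\<bar> < \<eta> \<longrightarrow> ereal L < g s"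
  proof (rule ccontr)
    assume "\<not> ?thesis"
    then have "\<forall>n::nat. \<exists>s\<ge>\<alpha>. \<bar>s - a0\<bar> < 1 / real (Suc n) \<and> g s \<le> ereal L"
      by (metis not_le zero_less_divide_1_iff of_nat_0_less_iff zero_less_Suc)
    then obtain s where s: "\<And>n::nat. s n \<ge> \<alpha>" "\<And>n. \<bar>s n - a0\<bar> < 1 / real (Suc n)" "\<And>n. g (s n) \<le> ereal L" by metis
    have "(\<lambda>n. s n - a0) \<longlonglongrightarrow> 0"
      by (rule Lim_null_comparison[OF _ LIMSEQ_inverse_real_of_nat])
        (use s(2) in \<open>auto simp: inverse_eq_divide less_imp_le simp del: of_nat_Suc\<close>)
    then have "s \<longlonglongrightarrow> a0" by (simp add: LIM_zero_iff)
    then have "g a0 \<le> liminf (\<lambda>n. g (s n))" using a0 s(1) by (intro lsc_onD[OF lsc]) auto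
    also have "\<dots> \<le> liminf (\<lambda>n::nat. ereal L)" by (rule Liminf_mono) (use s(3) in auto)
    finally show False using L by (simp add: Liminf_const)
  qed
  then obtain \<eta> where \<eta>: "\<eta> > 0" "\<And>s. s \<ge> \<alpha> \<Longrightarrow> \<bar>s - a0\<bar> < \<eta> \<Longrightarrow> ereal L < g s" by blast
  obtain m where m: "\<And>s. s \<in> {\<alpha>..C} \<Longrightarrow> ereal m \<le> g s" using lsc_on_bounded_below[OF g lsc] by blast
  define K where "K = \<bar>L - m\<bar> / \<eta>\<^sup>2"
  have K: "K \<ge> 0" by (simp add: K_def)
  have "ereal (L - K * (s - a0)\<^sup>2) \<le> g s" if s: "s \<in> {\<alpha>..C}" for s
  proof (cases "\<bar>s - a0\<bar> < \<eta>")
    case True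
    have "ereal (L - K * (s - a0)\<^sup>2) \<le> ereal L" using K by simp
    also have "\<dots> \<le> g s" using \<eta>(2)[of s] s True by (simp add: less_imp_le)
    finally show ?thesis .
  next
    case False
    then have "\<eta>\<^sup>2 \<le> \<bar>s - a0\<bar>\<^sup>2" using \<eta>(1) by (intro power_mono) auto
    then have "\<bar>L - m\<bar> \<le> K * (s - a0)\<^sup>2" using \<eta>(1) mult_left_mono[of "\<eta>\<^sup>2" "(s - a0)\<^sup>2" K] K by (simp add: K_def)
    then have "ereal (L - K * (s - a0)\<^sup>2) \<le> ereal m" by simp
    also have "\<dots> \<le> g s" by (rule m[OF s])
    finally show ?thesis .
  qed
  with K show ?thesis by blast
qed

section \<open>Extended-valued integrals\<close>

lemma e2ennreal_max_ereal: "e2ennreal (max 0 (ereal r)) = ennreal r"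
proof (cases "r \<ge> 0")
  case True
  then have "max 0 (ereal r) = ereal r" by (intro max_absorb2) simp
  then show ?thesis by (simp only: e2ennreal_ereal)
next
  case False
  then have "max 0 (ereal r) = 0" by (intro max_absorb1) simp
  with False show ?thesis by (simp add: ennreal_neg e2ennreal_neg)
qed

lemma eint_real:
  assumes u: "integrable M u" and h: "AE x in M. h x = ereal (u x)"
  shows "eint M h = ereal (\<integral>x. u x \<partial>M)"
proof -
  have 1: "(\<integral>\<^sup>+x. e2ennreal (max 0 (h x)) \<partial>M) = (\<integral>\<^sup>+x. ennreal (u x) \<partial>M)"
    by (rule nn_integral_cong_AE) (use h in \<open>auto simp: e2ennreal_max_ereal elim!: eventually_mono\<close>)
  have 2: "(\<integral>\<^sup>+x. e2ennreal (max 0 (- h x)) \<partial>M) = (\<integral>\<^sup>+x. ennreal (- u x) \<partial>M)"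
  proof (rule nn_integral_cong_AE)
    show "AE x in M. e2ennreal (max 0 (- h x)) = ennreal (- u x)"
      using h by eventually_elim (simp add: e2ennreal_max_ereal[of "- _", simplified])
  qed
  have f: "(\<integral>\<^sup>+x. ennreal (u x) \<partial>M) \<noteq> \<infinity>" "(\<integral>\<^sup>+x. ennreal (- u x) \<partial>M) \<noteq> \<infinity>"
    using u real_integrable_def[of M u] by auto
  have "enn2ereal X = ereal (enn2real X)" if "X \<noteq> \<infinity>" for X
    using that by (cases X) (auto simp: enn2ereal_ennreal)
  then show ?thesis unfolding eint_def 1 2 using f real_lebesgue_integral_def[OF u] by simp
qed

text \<open>The lower bound makes the negative part integrable on a finite measure, so
  \<open>eint\<close> can stay below infinity only if the positive part is integrable too.\<close>

lemma (in finite_measure) eint_finite_imp_integrable: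
  assumes h: "h \<in> borel_measurable M" and m: "AE x in M. ereal m \<le> h x" and fin: "eint M h < \<infinity>"
  shows "AE x in M. h x \<noteq> \<infinity>" "integrable M (\<lambda>x. real_of_ereal (h x))"
proof -
  let ?P = "\<integral>\<^sup>+x. e2ennreal (max 0 (h x)) \<partial>M" and ?N = "\<integral>\<^sup>+x. e2ennreal (max 0 (- h x)) \<partial>M"
  have nb: "AE x in M. e2ennreal (max 0 (- h x)) \<le> ennreal \<bar>m\<bar>"
    using m
  proof eventually_elim
    case (elim x)
    then have "- h x \<le> ereal (- m)" by (cases "h x") auto
    also have "\<dots> \<le> ereal \<bar>m\<bar>" by simp
    finally have "max 0 (- h x) \<le> max 0 (ereal \<bar>m\<bar>)" by simp
    then show ?case using e2ennreal_mono e2ennreal_max_ereal by metis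
  qed
  have "?N \<le> (\<integral>\<^sup>+x. ennreal \<bar>m\<bar> \<partial>M)" by (rule nn_integral_mono_AE[OF nb])
  also have "\<dots> < \<infinity>" using emeasure_finite[of "space M"] by (simp add: less_top[symmetric] ennreal_mult_eq_top_iff)
  finally have N: "?N < \<infinity>" .
  have P: "?P \<noteq> \<infinity>"
  proof
    assume "?P = \<infinity>"
    moreover have "enn2ereal X = ereal (enn2real X)" if "X < \<infinity>" for X
      using that by (cases X) (auto simp: enn2ereal_ennreal)
    note this[OF N]
    ultimately have "eint M h = \<infinity>" by (simp add: eint_def top_ereal_def[symmetric] enn2ereal_top del: top_ereal_def) (simp add: top_ereal_def)
    then show False using fin by simp
  qed
  have pm: "(\<lambda>x. e2ennreal (max 0 (h x))) \<in> borel_measurable M" using h by measurable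
  from nn_integral_PInf_AE[OF pm P] show ne: "AE x in M. h x \<noteq> \<infinity>"
    by eventually_elim (auto simp: max_def)
  show "integrable M (\<lambda>x. real_of_ereal (h x))"
  proof (rule integrableI_bounded)
    show "(\<lambda>x. real_of_ereal (h x)) \<in> borel_measurable M" using h by measurable
    have "(\<integral>\<^sup>+x. ennreal (norm (real_of_ereal (h x))) \<partial>M) \<le> (\<integral>\<^sup>+x. e2ennreal (max 0 (h x)) + ennreal \<bar>m\<bar> \<partial>M)"
    proof (rule nn_integral_mono_AE)
      show "AE x in M. ennreal (norm (real_of_ereal (h x))) \<le> e2ennreal (max 0 (h x)) + ennreal \<bar>m\<bar>"
        using m ne
      proof eventually_elim
        case (elim x)
        then obtain u where u: "h x = ereal u" by (cases "h x") auto
        then have mu: "m \<le> u" using elim by simp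
        show ?case
        proof (cases "u \<ge> 0")
          case True
          then show ?thesis by (simp add: u e2ennreal_max_ereal)
        next
          case False
          then have "\<bar>u\<bar> \<le> \<bar>m\<bar>" using mu by simp
          then show ?thesis by (simp add: u e2ennreal_max_ereal ennreal_leI add_increasing)
        qed
      qed
    qed
    also have "\<dots> = ?P + (\<integral>\<^sup>+x. ennreal \<bar>m\<bar> \<partial>M)" by (rule nn_integral_add[OF pm]) simp
    also have "\<dots> < \<infinity>" using P emeasure_finite[of "space M"] by (simp add: less_top[symmetric] ennreal_mult_eq_top_iff)
    finally show "(\<integral>\<^sup>+x. ennreal (norm (real_of_ereal (h x))) \<partial>M) < \<infinity>" .
  qed
qed

section \<open>Perturbation of the coefficient on an inclusion\<close>

text \<open>Against the gradient of a test function the two terms cancel by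
  \<open>integral_grad_swap\<close>: the field is divergence free in the weak sense. Density extends
  this to \<open>H10\<close>.\<close>

lemma H10_curl_orthogonal:
  fixes \<Omega> :: "(real^'n::finite) set"
  assumes \<Omega>: "open \<Omega>" and \<psi>: "test_fun \<Omega> \<psi>" and v: "H10 \<Omega> v Gv"
  shows "(\<integral>x. ((n \<bullet> grad \<psi> x) *\<^sub>R t - (t \<bullet> grad \<psi> x) *\<^sub>R n) \<bullet> Gv x \<partial>lebesgue_on \<Omega>) = 0"
proof -
  let ?M = "lebesgue_on \<Omega>"
  have S: "\<Omega> \<in> sets lebesgue" using borel_open[OF \<Omega>] by (simp add: sets_completionI_sets)
  define \<sigma> where "\<sigma> x = (n \<bullet> grad \<psi> x) *\<^sub>R t - (t \<bullet> grad \<psi> x) *\<^sub>R n" for x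
  have \<sigma>s: "sqi lborel \<sigma>"
  proof -
    have g: "continuous_on UNIV (grad \<psi>)" by (rule smooth_grad_continuous[OF test_fun_smooth[OF \<psi>]])
    obtain K where "compact K" "\<And>x. x \<notin> K \<Longrightarrow> grad \<psi> x = 0" using \<psi> by (metis test_funE)
    then show ?thesis unfolding \<sigma>_def by (intro sqi_compact_support[of _ K] continuous_intros g) auto
  qed
  have \<sigma>0: "\<sigma> x = 0" if "x \<notin> \<Omega>" for x
  proof -
    have "grad \<psi> x = 0" using \<psi> that by (metis test_funE subsetD)
    then show ?thesis by (simp add: \<sigma>_def)
  qed
  note \<sigma>M = sqi_lebesgue_on_vanishing(1)[OF S \<sigma>s \<sigma>0]
  have test: "(\<integral>x. \<sigma> x \<bullet> grad \<phi> x \<partial>?M) = 0" if \<phi>: "test_fun \<Omega> \<phi>" for \<phi>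
  proof -
    have gm: "\<sigma> \<in> borel_measurable borel" "grad \<phi> \<in> borel_measurable borel"
      using sqi_measurable[OF \<sigma>s] sqi_measurable[OF sqi_test_fun(2)[OF \<phi>]] by simp_all
    have "(\<integral>x. \<sigma> x \<bullet> grad \<phi> x \<partial>?M) = (\<integral>x. \<sigma> x \<bullet> grad \<phi> x \<partial>lborel)"
      by (rule lebesgue_on_vanishing(1)[OF S]) (use gm \<sigma>0 in \<open>auto intro!: borel_measurable_inner\<close>)
    also have "\<dots> = (\<integral>x. (grad \<psi> x \<bullet> n) * (grad \<phi> x \<bullet> t) - (grad \<psi> x \<bullet> t) * (grad \<phi> x \<bullet> n) \<partial>lborel)"
      by (rule Bochner_Integration.integral_cong) (simp_all add: \<sigma>_def inner_diff_left inner_commute[of "grad _ _"])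
    also have "\<dots> = 0"
    proof -
      have i: "integrable lborel (\<lambda>x. (grad \<psi> x \<bullet> u) * (grad \<phi> x \<bullet> w))" for u w
      proof -
        have s: "sqi lborel (\<lambda>x. grad \<eta> x \<bullet> w)" if "test_fun \<Omega> \<eta>" for \<eta> w
          by (rule sqi_bound[OF sqi_test_fun(2)[OF that], where K="norm w"])
            (use sqi_measurable[OF sqi_test_fun(2)[OF that]] in \<open>auto intro!: borel_measurable_inner AE_I2 simp: mult.commute[of "norm w"] Cauchy_Schwarz_ineq2\<close>)
        show ?thesis using sqi_inner_integrable[OF s[OF \<psi>, of u] s[OF \<phi>, of w]] by simp
      qed
      show ?thesis using i integral_grad_swap[OF \<psi> \<phi>, of n t] by simp
    qed
    finally show ?thesis .
  qed
  obtain \<phi> where \<phi>: "\<And>k. test_fun \<Omega> (\<phi> k)" "(\<lambda>k. nrm2 ?M (\<lambda>x. grad (\<phi> k) x - Gv x)) \<longlonglongrightarrow> 0"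
    by (rule H10_approx[OF v]) blast
  have "(\<lambda>k. \<integral>x. grad (\<phi> k) x \<bullet> \<sigma> x \<partial>?M) \<longlonglongrightarrow> (\<integral>x. Gv x \<bullet> \<sigma> x \<partial>?M)"
    by (rule sqi_tendsto_inner[OF sqi_test_fun_on(2)[OF \<Omega> \<phi>(1)] H10D(2)[OF v] \<sigma>M \<phi>(2)])
  moreover have "(\<integral>x. grad (\<phi> k) x \<bullet> \<sigma> x \<partial>?M) = 0" for k using test[OF \<phi>(1)] by (simp add: inner_commute)
  ultimately have "(\<integral>x. Gv x \<bullet> \<sigma> x \<partial>?M) = 0" by (simp add: LIMSEQ_const_iff)
  then show ?thesis by (simp add: \<sigma>_def inner_commute)
qed

text \<open>The coefficient is replaced by the constant \<open>b\<close> on \<open>E\<close>; \<open>B\<close> is one constant dominating all data, so that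
  error terms can be collected as powers of \<open>B\<close>.\<close>
locale needle =
  fixes \<Omega> :: "(real^'n::finite) set" and \<alpha> b B :: real and f yd a y p yh :: "real^'n \<Rightarrow> real"
    and Gy Gp Gyh :: "real^'n \<Rightarrow> real^'n" and E :: "(real^'n) set"
  assumes \<Omega>: "open \<Omega>" "bounded \<Omega>" and \<alpha>: "\<alpha> > 0" and b: "\<alpha> \<le> b" "b \<le> B" and B: "1 \<le> B" "1 / \<alpha> \<le> B"
    and am: "a \<in> borel_measurable (lebesgue_on \<Omega>)" and ab: "AE x in lebesgue_on \<Omega>. \<alpha> \<le> a x \<and> a x \<le> B"
    and E: "E \<in> sets borel" "E \<subseteq> \<Omega>"
    and st: "state_eq \<Omega> f a y Gy" and ad: "adjoint_eq \<Omega> yd a y p Gp"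
    and sth: "state_eq \<Omega> f (\<lambda>x. if x \<in> E then b else a x) yh Gyh"
begin

abbreviation "M \<equiv> lebesgue_on \<Omega>"
definition "ah x = (if x \<in> E then b else a x)"
definition "z x = yh x - y x"
definition "Gz x = Gyh x - Gy x"
definition "\<mu> = measure lborel E"
text \<open>The change of coefficient acts as a source on E: \<open>U\<close> is its product with
  the unperturbed state gradient, \<open>V\<close> with the adjoint gradient.\<close>

definition "U x = (indicator E x * (b - a x)) *\<^sub>R Gy x"
definition "V x = (indicator E x * (b - a x)) *\<^sub>R Gp x"

lemma B_nonneg: "B \<ge> 0" "B > 0" using B by auto

lemma indicator_measurable: "indicator E \<in> borel_measurable M"
  by (intro borel_measurable_lebesgue_on borel_measurable_indicator) (use E in simp)

lemma inclusion_measure: "E \<in> sets M" "emeasure M E < \<infinity>" "measure M E = \<mu>"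
proof -
  have L: "\<Omega> \<in> sets lebesgue" by (rule open_bounded_lebesgue_on[OF \<Omega>])
  have EL: "E \<in> sets lebesgue" using E by simp
  show "E \<in> sets M" using L EL E(2) by (simp add: sets_restrict_space_iff)
  interpret finite_measure M by (rule open_bounded_lebesgue_on[OF \<Omega>])
  show "emeasure M E < \<infinity>" using emeasure_finite[of E] by (simp add: less_top[symmetric])
  show "measure M E = \<mu>" unfolding \<mu>_def using L E by (subst measure_restrict_space) (auto simp: measure_completion)
qed

lemma H10_states: "H10 \<Omega> y Gy" "H10 \<Omega> p Gp" "H10 \<Omega> yh Gyh" "H10 \<Omega> z Gz"
  using st ad sth H10_diff[OF \<Omega>(1), of yh Gyh y Gy] by (auto simp: state_eq_def adjoint_eq_def z_def[abs_def] Gz_def[abs_def])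

lemma sqi_gradients: "sqi M Gy" "sqi M Gp" "sqi M Gyh" "sqi M Gz"
  using H10_states by (auto dest: H10D)

lemma ah_measurable: "ah \<in> borel_measurable M"
proof -
  have "(\<lambda>x. indicator E x * (b - a x) + a x) \<in> borel_measurable M" using am indicator_measurable by measurable
  moreover have "(\<lambda>x. indicator E x * (b - a x) + a x) = ah" by (auto simp: ah_def indicator_def fun_eq_iff)
  ultimately show ?thesis by simp
qed

lemma ah_range: "AE x in M. \<alpha> \<le> ah x \<and> ah x \<le> B"
  using ab by eventually_elim (use b in \<open>auto simp: ah_def\<close>)

lemma coeff_bounds: "AE x in M. \<bar>a x\<bar> \<le> B" "AE x in M. \<bar>ah x\<bar> \<le> B"
proof -
  show "AE x in M. \<bar>a x\<bar> \<le> B" using ab by eventually_elim (use \<alpha> in auto)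
  show "AE x in M. \<bar>ah x\<bar> \<le> B" using ah_range by eventually_elim (use \<alpha> in auto)
qed

lemma jump: "(\<lambda>x. indicator E x * (b - a x)) \<in> borel_measurable M" "AE x in M. \<bar>indicator E x * (b - a x)\<bar> \<le> B"
proof -
  show "(\<lambda>x. indicator E x * (b - a x)) \<in> borel_measurable M" using am indicator_measurable by measurable
  show "AE x in M. \<bar>indicator E x * (b - a x)\<bar> \<le> B"
    using ab by eventually_elim (use b \<alpha> in \<open>auto simp: indicator_def\<close>)
qed

lemma ah_eq: "ah x = a x + indicator E x * (b - a x)"
  by (auto simp: ah_def indicator_def)

lemma sqi_sources: "sqi M U" "sqi M V" "sqi M (\<lambda>x. (indicator E x * (b - a x)) *\<^sub>R Gz x)"
  unfolding U_def V_def by (rule sqi_mult[OF sqi_gradients(1) jump], rule sqi_mult[OF sqi_gradients(2) jump], rule sqi_mult[OF sqi_gradients(4) jump])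

lemma coeff_integrable:
  assumes "sqi M F" "sqi M G"
  shows "integrable M (\<lambda>x. a x * (F x \<bullet> G x))" "integrable M (\<lambda>x. ah x * (F x \<bullet> G x))"
  using sqi_inner_integrable[OF sqi_mult[OF assms(1) am coeff_bounds(1)] assms(2)]
    sqi_inner_integrable[OF sqi_mult[OF assms(1) ah_measurable coeff_bounds(2)] assms(2)] by simp_all

text \<open>The difference of the two state equations, written with the perturbed coefficient: the
  source then contains only the unperturbed gradient, and on E the coefficient on the left is the
  constant b.\<close>

lemma perturbed_eq:
  assumes v: "H10 \<Omega> v Gv"
  shows "(\<integral>x. ah x * (Gz x \<bullet> Gv x) \<partial>M) = - (\<integral>x. U x \<bullet> Gv x \<partial>M)"
proof -
  note sv = H10D(2)[OF v]
  have e: "(\<integral>x. a x * (Gy x \<bullet> Gv x) \<partial>M) = (\<integral>x. ah x * (Gyh x \<bullet> Gv x) \<partial>M)"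
  proof -
    have "(\<integral>x. a x * (Gy x \<bullet> Gv x) \<partial>M) = (\<integral>x. f x * v x \<partial>M)" using st v unfolding state_eq_def by blast
    moreover have "(\<integral>x. (if x \<in> E then b else a x) * (Gyh x \<bullet> Gv x) \<partial>M) = (\<integral>x. f x * v x \<partial>M)"
      using sth v unfolding state_eq_def by blast
    ultimately show ?thesis by (simp add: ah_def)
  qed
  have "(\<integral>x. ah x * (Gz x \<bullet> Gv x) \<partial>M)
    = (\<integral>x. ah x * (Gyh x \<bullet> Gv x) - a x * (Gy x \<bullet> Gv x) - U x \<bullet> Gv x \<partial>M)"
    by (rule Bochner_Integration.integral_cong) (simp_all add: Gz_def U_def ah_eq inner_diff_left algebra_simps)
  also have "\<dots> = - (\<integral>x. U x \<bullet> Gv x \<partial>M)"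
    using coeff_integrable(2)[OF sqi_gradients(3) sv] coeff_integrable(1)[OF sqi_gradients(1) sv] sqi_inner_integrable[OF sqi_sources(1) sv] e by simp
  finally show ?thesis .
qed

text \<open>The same difference with the original coefficient. The source now contains
  \<open>Gz\<close> itself, but the left side matches the adjoint equation.\<close>

lemma unperturbed_eq:
  assumes v: "H10 \<Omega> v Gv"
  shows "(\<integral>x. a x * (Gz x \<bullet> Gv x) \<partial>M) = - (\<integral>x. U x \<bullet> Gv x \<partial>M) - (\<integral>x. ((indicator E x * (b - a x)) *\<^sub>R Gz x) \<bullet> Gv x \<partial>M)"
proof -
  note sv = H10D(2)[OF v]
  have "(\<integral>x. ah x * (Gz x \<bullet> Gv x) \<partial>M) = (\<integral>x. a x * (Gz x \<bullet> Gv x) + ((indicator E x * (b - a x)) *\<^sub>R Gz x) \<bullet> Gv x \<partial>M)"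
    by (rule Bochner_Integration.integral_cong) (simp_all add: ah_eq algebra_simps)
  also have "\<dots> = (\<integral>x. a x * (Gz x \<bullet> Gv x) \<partial>M) + (\<integral>x. ((indicator E x * (b - a x)) *\<^sub>R Gz x) \<bullet> Gv x \<partial>M)"
    using coeff_integrable(1)[OF sqi_gradients(4) sv] sqi_inner_integrable[OF sqi_sources(3) sv] by simp
  finally show ?thesis using perturbed_eq[OF v] by simp
qed

text \<open>Coercivity and testing with z itself bound \<alpha> times the norm of \<open>Gz\<close>
  by that of \<open>U\<close>, and B dominates 1 / \<alpha>.\<close>

lemma energy: "nrm2 M Gz \<le> B * nrm2 M U"
proof -
  have "\<alpha> * (nrm2 M Gz)\<^sup>2 \<le> (\<integral>x. ah x * (Gz x \<bullet> Gz x) \<partial>M)"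
  proof -
    have "(\<integral>x. \<alpha> * (norm (Gz x))\<^sup>2 \<partial>M) \<le> (\<integral>x. ah x * (Gz x \<bullet> Gz x) \<partial>M)"
    proof (rule integral_mono_AE)
      show "integrable M (\<lambda>x. \<alpha> * (norm (Gz x))\<^sup>2)" using sqi_integrable[OF sqi_gradients(4)] by simp
      show "AE x in M. \<alpha> * (norm (Gz x))\<^sup>2 \<le> ah x * (Gz x \<bullet> Gz x)"
        using ah_range by eventually_elim (simp add: power2_norm_eq_inner mult_right_mono)
    qed (rule coeff_integrable[OF sqi_gradients(4) sqi_gradients(4)])
    then show ?thesis by (simp add: nrm2_sq)
  qed
  also have "\<dots> = - (\<integral>x. U x \<bullet> Gz x \<partial>M)" by (rule perturbed_eq[OF H10_states(4)])
  also have "\<dots> \<le> nrm2 M U * nrm2 M Gz" using sqi_cs[OF sqi_sources(1) sqi_gradients(4)] by linarith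
  finally have le: "\<alpha> * (nrm2 M Gz)\<^sup>2 \<le> nrm2 M U * nrm2 M Gz" .
  have "\<alpha> * nrm2 M Gz \<le> nrm2 M U"
  proof (cases "nrm2 M Gz = 0")
    case False
    then have "nrm2 M Gz > 0" using nrm2_nonneg[of M Gz] by linarith
    then show ?thesis using le by (simp add: power2_eq_square mult.assoc[symmetric])
  qed simp
  then have "nrm2 M Gz \<le> 1 / \<alpha> * nrm2 M U" using \<alpha> by (simp add: field_simps)
  also have "\<dots> \<le> B * nrm2 M U" by (intro mult_right_mono B) simp
  finally show ?thesis .
qed

text \<open>The adjoint equation is tested with z and the unperturbed equation of z with p.\<close>

lemma adjoint_identity:
  "(\<integral>x. (y x - yd x) * z x \<partial>M) = - (\<integral>x. U x \<bullet> Gp x \<partial>M) - (\<integral>x. V x \<bullet> Gz x \<partial>M)"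
proof -
  have "(\<integral>x. (y x - yd x) * z x \<partial>M) = (\<integral>x. a x * (Gz x \<bullet> Gp x) \<partial>M)"
    using ad H10_states(4) unfolding adjoint_eq_def by (metis (no_types))
  also have "\<dots> = - (\<integral>x. U x \<bullet> Gp x \<partial>M) - (\<integral>x. ((indicator E x * (b - a x)) *\<^sub>R Gz x) \<bullet> Gp x \<partial>M)"
    by (rule unperturbed_eq[OF H10_states(2)])
  also have "(\<integral>x. ((indicator E x * (b - a x)) *\<^sub>R Gz x) \<bullet> Gp x \<partial>M) = (\<integral>x. V x \<bullet> Gz x \<partial>M)"
    by (rule Bochner_Integration.integral_cong) (simp_all add: V_def inner_commute)
  finally show ?thesis .
qed

lemma indicator_nrm2:
  fixes v :: "'b::euclidean_space"
  shows "sqi M (\<lambda>x. indicator E x *\<^sub>R v)" "nrm2 M (\<lambda>x. indicator E x *\<^sub>R v) = norm v * sqrt \<mu>"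
  using sqi_indicator[OF inclusion_measure(1,2), of v] inclusion_measure(3) by auto

lemma sqi_ind: "sqi M G \<Longrightarrow> sqi M (\<lambda>x. indicator E x *\<^sub>R (G x :: 'b::euclidean_space))"
  by (rule sqi_mult[OF _ indicator_measurable, where K=1]) (auto simp: indicator_def)

lemma integral_ind: "(\<integral>x. indicator E x *\<^sub>R u \<bullet> indicator E x *\<^sub>R v \<partial>M) = (u \<bullet> v) * \<mu>"
proof -
  have "(\<integral>x. indicator E x *\<^sub>R u \<bullet> indicator E x *\<^sub>R v \<partial>M) = (\<integral>x. (u \<bullet> v) * indicator E x \<partial>M)"
    by (rule Bochner_Integration.integral_cong) (auto simp: indicator_def)
  also have "\<dots> = (u \<bullet> v) * \<mu>"
    using inclusion_measure sets.sets_into_space[OF inclusion_measure(1)] by (simp add: Int_absorb2 Int_commute)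
  finally show ?thesis .
qed

text \<open>Serves both the state and the adjoint gradient: on E the data may be replaced by their
  values at the centre at a relative L^2 cost w. The bound w <= 1 <= B absorbs this cost in the size
  estimates.\<close>

lemma freeze:
  fixes G :: "real^'n \<Rightarrow> real^'n"
  assumes G: "sqi M G" and g0: "norm g0 \<le> B" and a0: "\<alpha> \<le> a0" "a0 \<le> B" and w: "0 \<le> w" "w \<le> 1"
    and Wa: "nrm2 M (\<lambda>x. indicator E x * (a x - a0)) \<le> w * sqrt \<mu>"
    and Wg: "nrm2 M (\<lambda>x. indicator E x *\<^sub>R (G x - g0)) \<le> w * sqrt \<mu>"
  shows "nrm2 M (\<lambda>x. (indicator E x * (b - a x)) *\<^sub>R G x - indicator E x *\<^sub>R ((b - a0) *\<^sub>R g0)) \<le> 2 * B * w * sqrt \<mu>"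
    and "nrm2 M (\<lambda>x. (indicator E x * (b - a x)) *\<^sub>R G x) \<le> 3 * B\<^sup>2 * sqrt \<mu>"
    and "nrm2 M (\<lambda>x. indicator E x *\<^sub>R G x) \<le> 2 * B * sqrt \<mu>"
proof -
  interpret finite_measure M by (rule open_bounded_lebesgue_on[OF \<Omega>])
  have m0: "\<mu> \<ge> 0" by (simp add: \<mu>_def)
  have c: "sqi M (\<lambda>x. k)" for k :: "'c::euclidean_space" by (simp add: sqi_def)
  have sG: "sqi M (\<lambda>x. indicator E x *\<^sub>R (G x - g0))" by (intro sqi_ind sqi_diff G c)
  have sa: "sqi M (\<lambda>x. indicator E x * (a x - a0))"
  proof -
    have "sqi M (\<lambda>x. a x *\<^sub>R (1::real))" by (rule sqi_mult[OF c am coeff_bounds(1)])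
    then have "sqi M (\<lambda>x. indicator E x *\<^sub>R (a x - a0))" by (intro sqi_ind sqi_diff c) simp
    then show ?thesis by simp
  qed
  let ?A = "\<lambda>x. (indicator E x * (b - a x)) *\<^sub>R (indicator E x *\<^sub>R (G x - g0))"
  let ?C = "\<lambda>x. indicator E x *\<^sub>R (a x - a0) *\<^sub>R g0"
  have A: "sqi M ?A" "nrm2 M ?A \<le> B * (w * sqrt \<mu>)"
    using sqi_mult[OF sG jump] order_trans[OF nrm2_mult[OF sG jump B_nonneg(1)] mult_left_mono[OF Wg B_nonneg(1)]] by auto
  have Cm: "?C \<in> borel_measurable M" using am indicator_measurable by measurable
  have Cle: "norm (?C x) \<le> B * norm (indicator E x * (a x - a0))" for x
    using g0 by (auto simp: indicator_def mult.commute[of B] mult_left_mono)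
  have C: "sqi M ?C" "nrm2 M ?C \<le> B * (w * sqrt \<mu>)"
    using sqi_bound[OF sa Cm AE_I2[OF Cle]] order_trans[OF nrm2_bound[OF sa Cm AE_I2[OF Cle] B_nonneg(1)] mult_left_mono[OF Wa B_nonneg(1)]] by auto
  \<comment> \<open>On E the difference is (b - a) (G - g0) - (a - a0) g0, so that the bounded
    factors multiply the small ones.\<close>
  have eq: "(indicator E x * (b - a x)) *\<^sub>R G x - indicator E x *\<^sub>R ((b - a0) *\<^sub>R g0) = ?A x - ?C x" for x
    by (auto simp: indicator_def algebra_simps)
  have "nrm2 M (\<lambda>x. ?A x - ?C x) \<le> B * (w * sqrt \<mu>) + B * (w * sqrt \<mu>)"
    using nrm2_triangle_diff[OF A(1) C(1)] A(2) C(2) by linarith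
  then show 1: "nrm2 M (\<lambda>x. (indicator E x * (b - a x)) *\<^sub>R G x - indicator E x *\<^sub>R ((b - a0) *\<^sub>R g0)) \<le> 2 * B * w * sqrt \<mu>"
    unfolding eq by simp
  have sJ: "sqi M (\<lambda>x. (indicator E x * (b - a x)) *\<^sub>R G x)" by (rule sqi_mult[OF G jump])
  have bb: "\<bar>b - a0\<bar> \<le> B" using a0 b \<alpha> by auto
  have "nrm2 M (\<lambda>x. (indicator E x * (b - a x)) *\<^sub>R G x)
    \<le> nrm2 M (\<lambda>x. (indicator E x * (b - a x)) *\<^sub>R G x - indicator E x *\<^sub>R ((b - a0) *\<^sub>R g0)) + nrm2 M (\<lambda>x. indicator E x *\<^sub>R ((b - a0) *\<^sub>R g0))"
    using nrm2_triangle[OF sqi_diff[OF sJ indicator_nrm2(1)[of "(b - a0) *\<^sub>R g0"]] indicator_nrm2(1)[of "(b - a0) *\<^sub>R g0"]] by simp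
  also have "\<dots> \<le> 2 * B * w * sqrt \<mu> + norm ((b - a0) *\<^sub>R g0) * sqrt \<mu>"
    using 1 by (simp only: indicator_nrm2(2))
  also have "\<dots> \<le> 2 * B * B * sqrt \<mu> + (B * B) * sqrt \<mu>"
    unfolding norm_scaleR using w B B_nonneg bb g0 m0 by (intro add_mono mult_right_mono mult_mono) auto
  finally show "nrm2 M (\<lambda>x. (indicator E x * (b - a x)) *\<^sub>R G x) \<le> 3 * B\<^sup>2 * sqrt \<mu>" by (simp add: power2_eq_square algebra_simps)
  have "nrm2 M (\<lambda>x. indicator E x *\<^sub>R G x) \<le> nrm2 M (\<lambda>x. indicator E x *\<^sub>R (G x - g0)) + nrm2 M (\<lambda>x. indicator E x *\<^sub>R g0)"
    using nrm2_triangle[OF sG indicator_nrm2(1)[of g0]] by (simp add: scaleR_diff_right)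
  also have "\<dots> \<le> w * sqrt \<mu> + norm g0 * sqrt \<mu>" using Wg by (simp only: indicator_nrm2(2))
  also have "\<dots> \<le> B * sqrt \<mu> + B * sqrt \<mu>" using w B B_nonneg g0 m0 by (intro add_mono mult_right_mono) auto
  finally show "nrm2 M (\<lambda>x. indicator E x *\<^sub>R G x) \<le> 2 * B * sqrt \<mu>" by simp
qed

lemma integral_approx:
  fixes F G F0 G0 :: "real^'n \<Rightarrow> real^'n"
  assumes "sqi M F" "sqi M G" "sqi M F0" "sqi M G0"
    and "nrm2 M (\<lambda>x. F x - F0 x) \<le> u" "nrm2 M G \<le> u'" "nrm2 M F0 \<le> v" "nrm2 M (\<lambda>x. G x - G0 x) \<le> v'"
  shows "\<bar>(\<integral>x. F x \<bullet> G x \<partial>M) - (\<integral>x. F0 x \<bullet> G0 x \<partial>M)\<bar> \<le> u * u' + v * v'"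
proof -
  have "(\<integral>x. F x \<bullet> G x \<partial>M) - (\<integral>x. F0 x \<bullet> G0 x \<partial>M) = (\<integral>x. (F x - F0 x) \<bullet> G x \<partial>M) + (\<integral>x. F0 x \<bullet> (G x - G0 x) \<partial>M)"
    using sqi_inner_integrable[OF assms(1,2)] sqi_inner_integrable[OF assms(3,2)] sqi_inner_integrable[OF assms(3,4)]
    by (simp add: inner_diff_left inner_diff_right)
  moreover have "\<bar>\<integral>x. (F x - F0 x) \<bullet> G x \<partial>M\<bar> \<le> u * u'"
    by (rule order_trans[OF sqi_cs[OF sqi_diff[OF assms(1,3)] assms(2)]])
      (intro mult_mono assms(5,6) order_trans[OF nrm2_nonneg assms(5)] nrm2_nonneg)
  moreover have "\<bar>\<integral>x. F0 x \<bullet> (G x - G0 x) \<partial>M\<bar> \<le> v * v'"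
    by (rule order_trans[OF sqi_cs[OF assms(3) sqi_diff[OF assms(2,4)]]])
      (intro mult_mono assms(7,8) order_trans[OF nrm2_nonneg assms(7)] nrm2_nonneg)
  ultimately show ?thesis by linarith
qed

text \<open>The inclusion is tested with \<open>\<psi>\<close> in the direction \<open>n\<close> and with a divergence free field in the
  orthogonal directions; only the values of the data on \<open>E\<close> enter.\<close>
lemma needle_estimate:
  assumes \<psi>: "test_fun \<Omega> \<psi>" and n: "norm n = 1" and y0: "norm y0 \<le> B" and p0: "norm p0 \<le> B"
    and a0: "\<alpha> \<le> a0" "a0 \<le> B" and w: "0 \<le> w" "w \<le> 1" and t: "0 \<le> t"
    and T: "nrm2 M (\<lambda>x. grad \<psi> x - indicator E x *\<^sub>R n) \<le> t * sqrt \<mu>"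
    and Wa: "nrm2 M (\<lambda>x. indicator E x * (a x - a0)) \<le> w * sqrt \<mu>"
    and Wy: "nrm2 M (\<lambda>x. indicator E x *\<^sub>R (Gy x - y0)) \<le> w * sqrt \<mu>"
    and Wp: "nrm2 M (\<lambda>x. indicator E x *\<^sub>R (Gp x - p0)) \<le> w * sqrt \<mu>"
  shows "nrm2 M U \<le> 3 * B\<^sup>2 * sqrt \<mu>" and "nrm2 M Gz \<le> 3 * B^3 * sqrt \<mu>"
    and "\<bar>(\<integral>x. (y x - yd x) * z x \<partial>M) - \<mu> * (- (b - a0) * (y0 \<bullet> p0) + (b - a0)\<^sup>2 / b * ((n \<bullet> y0) * (n \<bullet> p0)))\<bar>
      \<le> \<mu> * (w * (5 * B^2 + 8 * B^4) + t * (6 * B^5 + 6 * B^7))"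
proof -
  let ?s = "sqrt \<mu>"
  have m0: "\<mu> \<ge> 0" by (simp add: \<mu>_def)
  have ss: "?s * ?s = \<mu>" using m0 by simp
  have s0: "?s \<ge> 0" using m0 by simp
  have b0: "b > 0" "1 / b \<le> B" using b \<alpha> B frac_le[of 1 1 \<alpha> b] by auto
  have bb: "\<bar>b - a0\<bar> \<le> B" using a0 b \<alpha> by auto
  note Uf = freeze[OF sqi_gradients(1) y0 a0 w Wa Wy, folded U_def[abs_def]]
  note Vf = freeze[OF sqi_gradients(2) p0 a0 w Wa Wp, folded V_def[abs_def]]
  have U1: "nrm2 M (\<lambda>x. U x - indicator E x *\<^sub>R ((b - a0) *\<^sub>R y0)) \<le> 2 * B * w * ?s" using Uf(1) by (simp add: U_def)
  have V1: "nrm2 M (\<lambda>x. V x - indicator E x *\<^sub>R ((b - a0) *\<^sub>R p0)) \<le> 2 * B * w * ?s" using Vf(1) by (simp add: V_def)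
  show U2: "nrm2 M U \<le> 3 * B\<^sup>2 * ?s" using Uf(2) by (simp add: U_def[abs_def])
  show Z: "nrm2 M Gz \<le> 3 * B^3 * ?s"
    using order_trans[OF energy mult_left_mono[OF U2 B_nonneg(1)]] by (simp add: power3_eq_cube power2_eq_square mult_ac)
  define I1 where "I1 = (\<integral>x. U x \<bullet> Gp x \<partial>M)"
  define I2 where "I2 = (\<integral>x. V x \<bullet> Gz x \<partial>M)"
  define I3 where "I3 = (\<integral>x. indicator E x *\<^sub>R n \<bullet> Gz x \<partial>M)"
  \<comment> \<open>The component of p0 orthogonal to n. It splits I2 into the normal integral I3,
    which \<psi> determines, and the tangential integral I4, which is small.\<close>
  define tt where "tt = p0 - (n \<bullet> p0) *\<^sub>R n"
  define I4 where "I4 = (\<integral>x. indicator E x *\<^sub>R tt \<bullet> Gz x \<partial>M)"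
  have nn: "n \<bullet> n = 1" using n by (simp add: norm_eq_1)
  have by0: "norm ((b - a0) *\<^sub>R y0) \<le> B\<^sup>2" unfolding norm_scaleR power2_eq_square using bb y0 B_nonneg by (intro mult_mono) auto
  have e1: "\<bar>I1 - \<mu> * ((b - a0) * (y0 \<bullet> p0))\<bar> \<le> \<mu> * (w * (5 * B\<^sup>2))"
  proof -
    have "I1 = (\<integral>x. U x \<bullet> indicator E x *\<^sub>R Gp x \<partial>M)" unfolding I1_def
      by (rule Bochner_Integration.integral_cong) (auto simp: U_def indicator_def)
    moreover have "nrm2 M (\<lambda>x. indicator E x *\<^sub>R Gp x - indicator E x *\<^sub>R p0) \<le> w * ?s" using Wp by (simp add: scaleR_diff_right)
    moreover have "nrm2 M (\<lambda>x. indicator E x *\<^sub>R ((b - a0) *\<^sub>R y0)) \<le> B\<^sup>2 * ?s"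
      unfolding indicator_nrm2(2) by (intro mult_right_mono by0 s0)
    ultimately have "\<bar>I1 - (\<integral>x. indicator E x *\<^sub>R ((b - a0) *\<^sub>R y0) \<bullet> indicator E x *\<^sub>R p0 \<partial>M)\<bar>
      \<le> (2 * B * w * ?s) * (2 * B * ?s) + (B\<^sup>2 * ?s) * (w * ?s)"
      using integral_approx[OF sqi_sources(1) sqi_ind[OF sqi_gradients(2)] indicator_nrm2(1) indicator_nrm2(1) U1 Vf(3)] by simp
    also have "\<dots> = (?s * ?s) * (w * (5 * B\<^sup>2))" by (simp add: power2_eq_square algebra_simps del: real_sqrt_mult_self)
    finally show ?thesis unfolding ss integral_ind by (simp add: mult.commute)
  qed
  have e2: "\<bar>I2 - (b - a0) * ((n \<bullet> p0) * I3 + I4)\<bar> \<le> \<mu> * (w * (6 * B^4))"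
  proof -
    have "(\<integral>x. indicator E x *\<^sub>R ((b - a0) *\<^sub>R p0) \<bullet> Gz x \<partial>M)
      = (\<integral>x. (b - a0) * ((n \<bullet> p0) * (indicator E x *\<^sub>R n \<bullet> Gz x) + indicator E x *\<^sub>R tt \<bullet> Gz x) \<partial>M)"
      by (rule Bochner_Integration.integral_cong) (auto simp: tt_def indicator_def inner_diff_left algebra_simps)
    also have "\<dots> = (b - a0) * ((n \<bullet> p0) * I3 + I4)"
      unfolding I3_def I4_def using sqi_inner_integrable[OF indicator_nrm2(1) sqi_gradients(4)] by simp
    finally have eq: "(\<integral>x. indicator E x *\<^sub>R ((b - a0) *\<^sub>R p0) \<bullet> Gz x \<partial>M) = (b - a0) * ((n \<bullet> p0) * I3 + I4)" .
    have "\<bar>I2 - (\<integral>x. indicator E x *\<^sub>R ((b - a0) *\<^sub>R p0) \<bullet> Gz x \<partial>M)\<bar> \<le> (2 * B * w * ?s) * (3 * B^3 * ?s) + nrm2 M (\<lambda>x. indicator E x *\<^sub>R ((b - a0) *\<^sub>R p0)) * 0"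
      unfolding I2_def
      by (rule integral_approx[OF sqi_sources(2) sqi_gradients(4) indicator_nrm2(1) sqi_gradients(4) V1 Z]) (simp_all add: nrm2_def)
    also have "\<dots> = (?s * ?s) * (w * (6 * B^4))" by (simp add: eval_nat_numeral algebra_simps del: real_sqrt_mult_self)
    finally show ?thesis unfolding ss eq .
  qed
  define e where "e x = grad \<psi> x - indicator E x *\<^sub>R n" for x
  note sp = sqi_test_fun_on(2)[OF \<Omega>(1) \<psi>]
  have es: "sqi M e" unfolding e_def by (rule sqi_diff[OF sp indicator_nrm2(1)])
  have eT: "nrm2 M e \<le> t * ?s" using T by (simp add: e_def[abs_def])
  \<comment> \<open>The equation of z is tested with \<psi>. The coefficient equals b on E, so up to
    the error e the left side is b I3 while the right side integrates U in direction n; this is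
    where the factor 1 / b of the slab arises.\<close>
  have e3: "\<bar>I3 + \<mu> * ((b - a0) / b * (n \<bullet> y0))\<bar> \<le> \<mu> * (w * (2 * B\<^sup>2) + t * (6 * B^5))"
  proof -
    have "(\<integral>x. ah x * (Gz x \<bullet> grad \<psi> x) \<partial>M) = - (\<integral>x. U x \<bullet> grad \<psi> x \<partial>M)"
      by (rule perturbed_eq[OF H10_test_fun[OF \<Omega>(1) \<psi>]])
    moreover have "(\<integral>x. ah x * (Gz x \<bullet> grad \<psi> x) \<partial>M) = b * I3 + (\<integral>x. (ah x *\<^sub>R e x) \<bullet> Gz x \<partial>M)"
    proof -
      have "(\<integral>x. ah x * (Gz x \<bullet> grad \<psi> x) \<partial>M) = (\<integral>x. b * (indicator E x *\<^sub>R n \<bullet> Gz x) + (ah x *\<^sub>R e x) \<bullet> Gz x \<partial>M)"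
        by (rule Bochner_Integration.integral_cong)
          (auto simp: e_def ah_def indicator_def inner_diff_left inner_diff_right inner_commute algebra_simps)
      then show ?thesis unfolding I3_def
        using sqi_inner_integrable[OF indicator_nrm2(1) sqi_gradients(4)] sqi_inner_integrable[OF sqi_mult[OF es ah_measurable coeff_bounds(2)] sqi_gradients(4)] by simp
    qed
    ultimately have i3: "b * I3 = - (\<integral>x. U x \<bullet> grad \<psi> x \<partial>M) - (\<integral>x. (ah x *\<^sub>R e x) \<bullet> Gz x \<partial>M)" by simp
    have r1: "\<bar>\<integral>x. (ah x *\<^sub>R e x) \<bullet> Gz x \<partial>M\<bar> \<le> (B * (t * ?s)) * (3 * B^3 * ?s)"
    proof (rule order_trans[OF sqi_cs[OF sqi_mult[OF es ah_measurable coeff_bounds(2)] sqi_gradients(4)]])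
      have "nrm2 M (\<lambda>x. ah x *\<^sub>R e x) \<le> B * (t * ?s)"
        by (rule order_trans[OF nrm2_mult[OF es ah_measurable coeff_bounds(2) B_nonneg(1)] mult_left_mono[OF eT B_nonneg(1)]])
      then show "nrm2 M (\<lambda>x. ah x *\<^sub>R e x) * nrm2 M Gz \<le> (B * (t * ?s)) * (3 * B^3 * ?s)"
        by (intro mult_mono Z) (use B_nonneg t s0 in auto)
    qed
    have r2: "\<bar>(\<integral>x. grad \<psi> x \<bullet> U x \<partial>M) - (\<integral>x. indicator E x *\<^sub>R n \<bullet> indicator E x *\<^sub>R ((b - a0) *\<^sub>R y0) \<partial>M)\<bar>
      \<le> (t * ?s) * (3 * B\<^sup>2 * ?s) + (1 * ?s) * (2 * B * w * ?s)"
      by (rule integral_approx[OF sp sqi_sources(1) indicator_nrm2(1) indicator_nrm2(1) T U2 _ U1]) (simp add: indicator_nrm2(2) n)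
    have "\<bar>b * I3 + \<mu> * ((b - a0) * (n \<bullet> y0))\<bar> \<le> (t * ?s) * (3 * B\<^sup>2 * ?s) + (1 * ?s) * (2 * B * w * ?s) + (B * (t * ?s)) * (3 * B^3 * ?s)"
      using r1 r2 i3 unfolding integral_ind by (simp add: inner_commute mult_ac)
    also have "\<dots> = (?s * ?s) * (w * (2 * B) + t * (3 * B\<^sup>2 + 3 * B^4))" by (simp add: eval_nat_numeral algebra_simps del: real_sqrt_mult_self)
    also have "\<dots> \<le> \<mu> * (w * (2 * B) + t * (6 * B^4))"
      unfolding ss using m0 t B power_increasing[of 2 4 B] by (intro mult_left_mono add_left_mono) auto
    finally have "\<bar>b * I3 + \<mu> * ((b - a0) * (n \<bullet> y0))\<bar> \<le> \<mu> * (w * (2 * B) + t * (6 * B^4))" .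
    moreover have "b * I3 + \<mu> * ((b - a0) * (n \<bullet> y0)) = b * (I3 + \<mu> * ((b - a0) / b * (n \<bullet> y0)))" using b0 by (simp add: field_simps)
    ultimately have "\<bar>I3 + \<mu> * ((b - a0) / b * (n \<bullet> y0))\<bar> \<le> 1 / b * (\<mu> * (w * (2 * B) + t * (6 * B^4)))"
      using b0 by (simp add: abs_mult field_simps)
    also have "\<dots> \<le> B * (\<mu> * (w * (2 * B) + t * (6 * B^4)))" using b0 m0 w t B_nonneg by (intro mult_right_mono) auto
    also have "\<dots> = \<mu> * (w * (2 * B\<^sup>2) + t * (6 * B^5))" by (simp add: eval_nat_numeral algebra_simps)
    finally show ?thesis .
  qed
  \<comment> \<open>As \<open>tt\<close> is orthogonal to n, the divergence free field built from
    \<psi> is the indicator of E times \<open>tt\<close>, up to \<rho>. Its orthogonality to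
    \<open>Gz\<close> turns I4 into an integral of \<rho>.\<close>
  have e4: "\<bar>I4\<bar> \<le> \<mu> * (t * (6 * B^4))"
  proof -
    have tn: "norm tt \<le> B"
    proof -
      have "(norm tt)\<^sup>2 = (norm p0)\<^sup>2 - (n \<bullet> p0)\<^sup>2"
        unfolding power2_norm_eq_inner tt_def by (simp add: inner_diff_left inner_diff_right inner_commute nn power2_eq_square algebra_simps)
      then have "(norm tt)\<^sup>2 \<le> (norm p0)\<^sup>2" by simp
      then have "norm tt \<le> norm p0" by (rule power2_le_imp_le) simp
      with p0 show ?thesis by simp
    qed
    have tn0: "tt \<bullet> n = 0" by (simp add: tt_def inner_diff_left nn inner_commute[of p0])
    define \<rho> where "\<rho> x = (n \<bullet> e x) *\<^sub>R tt - (tt \<bullet> e x) *\<^sub>R n" for x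
    have \<rho>: "(n \<bullet> grad \<psi> x) *\<^sub>R tt - (tt \<bullet> grad \<psi> x) *\<^sub>R n = indicator E x *\<^sub>R tt + \<rho> x" for x
      by (simp add: \<rho>_def e_def inner_diff_right nn tn0 algebra_simps)
    have \<rho>m: "\<rho> \<in> borel_measurable M" unfolding \<rho>_def using sqi_measurable[OF es] by measurable
    have \<rho>b: "norm (\<rho> x) \<le> (2 * B) * norm (e x)" for x
    proof -
      have "norm (\<rho> x) \<le> \<bar>n \<bullet> e x\<bar> * norm tt + \<bar>tt \<bullet> e x\<bar> * norm n"
        unfolding \<rho>_def by (rule order_trans[OF norm_triangle_ineq4]) simp
      also have "\<dots> \<le> (norm n * norm (e x)) * norm tt + (norm tt * norm (e x)) * norm n"
        by (intro add_mono mult_right_mono Cauchy_Schwarz_ineq2) auto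
      also have "\<dots> = 2 * norm tt * norm (e x)" using n by simp
      also have "\<dots> \<le> (2 * B) * norm (e x)" by (intro mult_right_mono mult_left_mono tn) auto
      finally show ?thesis .
    qed
    have \<rho>s: "sqi M \<rho>" "nrm2 M \<rho> \<le> 2 * B * (t * ?s)"
      using sqi_bound[OF es \<rho>m AE_I2[OF \<rho>b]] order_trans[OF nrm2_bound[OF es \<rho>m AE_I2[OF \<rho>b]] mult_left_mono[OF eT]] B_nonneg by auto
    have "0 = (\<integral>x. (indicator E x *\<^sub>R tt + \<rho> x) \<bullet> Gz x \<partial>M)"
      using H10_curl_orthogonal[OF \<Omega>(1) \<psi> H10_states(4), of n tt] unfolding \<rho> by simp
    also have "\<dots> = I4 + (\<integral>x. \<rho> x \<bullet> Gz x \<partial>M)"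
      unfolding I4_def inner_add_left
      by (rule Bochner_Integration.integral_add[OF sqi_inner_integrable[OF indicator_nrm2(1) sqi_gradients(4)] sqi_inner_integrable[OF \<rho>s(1) sqi_gradients(4)]])
    finally have "\<bar>I4\<bar> = \<bar>\<integral>x. \<rho> x \<bullet> Gz x \<partial>M\<bar>" by linarith
    also have "\<dots> \<le> nrm2 M \<rho> * nrm2 M Gz" by (rule sqi_cs[OF \<rho>s(1) sqi_gradients(4)])
    also have "\<dots> \<le> (2 * B * (t * ?s)) * (3 * B^3 * ?s)"
      by (intro mult_mono \<rho>s Z) (use B_nonneg t s0 in auto)
    also have "\<dots> = (?s * ?s) * (t * (6 * B^4))" by (simp add: eval_nat_numeral algebra_simps del: real_sqrt_mult_self)
    finally show ?thesis unfolding ss .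
  qed
  have np: "\<bar>n \<bullet> p0\<bar> \<le> B" using Cauchy_Schwarz_ineq2[of n p0] n p0 by simp
  let ?q = "(b - a0) / b * (n \<bullet> y0)"
  let ?X = "- (b - a0) * (y0 \<bullet> p0) + (b - a0)\<^sup>2 / b * ((n \<bullet> y0) * (n \<bullet> p0))"
  have "(\<integral>x. (y x - yd x) * z x \<partial>M) - \<mu> * ?X = - (I1 - \<mu> * ((b - a0) * (y0 \<bullet> p0))) - (I2 - (b - a0) * ((n \<bullet> p0) * I3 + I4))
     - ((b - a0) * (n \<bullet> p0)) * (I3 + \<mu> * ?q) - (b - a0) * I4"
    unfolding adjoint_identity I1_def[symmetric] I2_def[symmetric] by (simp add: power2_eq_square algebra_simps)
  then have "\<bar>(\<integral>x. (y x - yd x) * z x \<partial>M) - \<mu> * ?X\<bar> \<le> \<bar>I1 - \<mu> * ((b - a0) * (y0 \<bullet> p0))\<bar> + \<bar>I2 - (b - a0) * ((n \<bullet> p0) * I3 + I4)\<bar>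
     + \<bar>(b - a0) * (n \<bullet> p0)\<bar> * \<bar>I3 + \<mu> * ?q\<bar> + \<bar>b - a0\<bar> * \<bar>I4\<bar>"
    unfolding abs_mult[symmetric] by linarith
  also have "\<dots> \<le> \<mu> * (w * (5 * B\<^sup>2)) + \<mu> * (w * (6 * B^4)) + (B * B) * (\<mu> * (w * (2 * B\<^sup>2) + t * (6 * B^5))) + B * (\<mu> * (t * (6 * B^4)))"
  proof (intro add_mono e1 e2)
    have "\<bar>(b - a0) * (n \<bullet> p0)\<bar> \<le> B * B" unfolding abs_mult using bb np B_nonneg by (intro mult_mono) auto
    then show "\<bar>(b - a0) * (n \<bullet> p0)\<bar> * \<bar>I3 + \<mu> * ?q\<bar> \<le> (B * B) * (\<mu> * (w * (2 * B\<^sup>2) + t * (6 * B^5)))"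
      using e3 B_nonneg by (intro mult_mono) auto
    show "\<bar>b - a0\<bar> * \<bar>I4\<bar> \<le> B * (\<mu> * (t * (6 * B^4)))" using e4 bb B_nonneg by (intro mult_mono) auto
  qed
  also have "\<dots> = \<mu> * (w * (5 * B^2 + 8 * B^4) + t * (6 * B^5 + 6 * B^7))" by (simp add: eval_nat_numeral algebra_simps)
  finally show "\<bar>(\<integral>x. (y x - yd x) * z x \<partial>M) - \<mu> * ?X\<bar> \<le> \<mu> * (w * (5 * B^2 + 8 * B^4) + t * (6 * B^5 + 6 * B^7))" .
qed

end

section \<open>The pointwise inequality\<close>

text \<open>The sources live on E, so only the norm of \<open>Gv\<close> on E appears. For fixed v
  it tends to 0 as E shrinks, which is the gain over the energy bound.\<close>

lemma (in needle) unperturbed_bound: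
  assumes v: "H10 \<Omega> v Gv"
  shows "\<bar>\<integral>x. a x * (Gz x \<bullet> Gv x) \<partial>M\<bar> \<le> (nrm2 M U + B * nrm2 M Gz) * nrm2 M (\<lambda>x. indicator E x *\<^sub>R Gv x)"
proof -
  note sv = sqi_ind[OF H10D(2)[OF v]]
  have 1: "(\<integral>x. U x \<bullet> Gv x \<partial>M) = (\<integral>x. U x \<bullet> indicator E x *\<^sub>R Gv x \<partial>M)"
    by (rule Bochner_Integration.integral_cong) (auto simp: U_def indicator_def)
  have 2: "(\<integral>x. ((indicator E x * (b - a x)) *\<^sub>R Gz x) \<bullet> Gv x \<partial>M)
    = (\<integral>x. ((indicator E x * (b - a x)) *\<^sub>R Gz x) \<bullet> indicator E x *\<^sub>R Gv x \<partial>M)"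
    by (rule Bochner_Integration.integral_cong) (auto simp: indicator_def)
  have "\<bar>\<integral>x. a x * (Gz x \<bullet> Gv x) \<partial>M\<bar> \<le> nrm2 M U * nrm2 M (\<lambda>x. indicator E x *\<^sub>R Gv x)
    + nrm2 M (\<lambda>x. (indicator E x * (b - a x)) *\<^sub>R Gz x) * nrm2 M (\<lambda>x. indicator E x *\<^sub>R Gv x)"
    using unperturbed_eq[OF v] sqi_cs[OF sqi_sources(1) sv] sqi_cs[OF sqi_sources(3) sv] unfolding 1 2 by linarith
  also have "nrm2 M (\<lambda>x. (indicator E x * (b - a x)) *\<^sub>R Gz x) \<le> B * nrm2 M Gz"
    by (rule nrm2_mult[OF sqi_gradients(4) jump B_nonneg(1)])
  finally show ?thesis by (simp add: distrib_right mult_right_mono)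
qed

lemma AE_lebesgue_on_not_in_negligible:
  assumes "S \<in> sets lebesgue" "negligible N" shows "AE x in lebesgue_on S. x \<notin> N"
  using assms by (subst AE_restrict_space_iff) (auto simp: negligible_iff_null_sets intro: AE_not_in AE_mp)

lemma H10_scale:
  assumes "open \<Omega>" "H10 \<Omega> v G" shows "H10 \<Omega> (\<lambda>x. c * v x) (\<lambda>x. c *\<^sub>R G x)"
proof -
  have "grad (\<lambda>x::real^'a. 0) = (\<lambda>x. 0)"
    by (rule ext, rule has_derivative_gradI) (auto intro!: derivative_eq_intros)
  moreover have "test_fun \<Omega> (\<lambda>x. 0)" by (rule test_funI[of _ "{}"]) (auto intro: smooth_const)
  ultimately have "H10 \<Omega> (\<lambda>x. 0) (\<lambda>x. 0)" using H10_test_fun[OF assms(1)] by metis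
  from H10_add_scaled[OF assms(1) this assms(2), of c] show ?thesis by simp
qed

section \<open>Finite costs\<close>

lemma Jt_real:
  assumes "integrable (lebesgue_on \<Omega>) u" "AE x in lebesgue_on \<Omega>. g (a x) = ereal (u x)"
  shows "Jt \<Omega> yd g y a = ereal (1/2 * (\<integral>x. (y x - yd x)\<^sup>2 \<partial>lebesgue_on \<Omega>) + (\<integral>x. u x \<partial>lebesgue_on \<Omega>))"
  unfolding Jt_def eint_real[OF assms] by simp

text \<open>Measurability is obtained for \<open>g (max \<alpha> (a x))\<close>, which agrees with
  \<open>g (a x)\<close> almost everywhere; g is bounded below on the essential range of a, so a
  finite cost makes it integrable.\<close>

lemma finite_cost_integrable:
  fixes \<Omega> :: "(real^'n::finite) set"
  assumes \<Omega>: "open \<Omega>" "bounded \<Omega>" and g: "\<forall>b. g b \<noteq> -\<infinity>" "lsc_on {\<alpha>..} g" and a: "feasible \<Omega> \<alpha> a"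
    and J: "Jt \<Omega> yd g y a < \<infinity>"
  shows "\<exists>u. integrable (lebesgue_on \<Omega>) u \<and> (AE x in lebesgue_on \<Omega>. g (a x) = ereal (u x))"
proof -
  let ?M = "lebesgue_on \<Omega>"
  interpret finite_measure ?M by (rule open_bounded_lebesgue_on[OF \<Omega>])
  obtain C where am: "a \<in> borel_measurable ?M" and C: "AE x in ?M. \<bar>a x\<bar> \<le> C" and al: "AE x in ?M. \<alpha> \<le> a x"
    using a by (auto simp: feasible_def Linf_def)
  define h where "h x = g (max \<alpha> (a x))" for x
  have hm: "h \<in> borel_measurable ?M" unfolding h_def by (rule measurable_compose[OF am lsc_on_borel[OF g(2)]])
  have hg: "AE x in ?M. h x = g (a x)" using al by eventually_elim (simp add: h_def max_def)
  obtain m where m: "\<forall>s\<in>{\<alpha>..C}. ereal m \<le> g s" using lsc_on_bounded_below[OF g] by blast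
  have hb: "AE x in ?M. ereal m \<le> h x"
    using hg al C by eventually_elim (use m in auto)
  have "eint ?M h = eint ?M (\<lambda>x. g (a x))"
  proof -
    have "(\<integral>\<^sup>+x. e2ennreal (max 0 (h x)) \<partial>?M) = (\<integral>\<^sup>+x. e2ennreal (max 0 (g (a x))) \<partial>?M)"
      "(\<integral>\<^sup>+x. e2ennreal (max 0 (- h x)) \<partial>?M) = (\<integral>\<^sup>+x. e2ennreal (max 0 (- g (a x))) \<partial>?M)"
      by (rule nn_integral_cong_AE, use hg in eventually_elim, simp)+
    then show ?thesis by (simp add: eint_def)
  qed
  moreover have "eint ?M (\<lambda>x. g (a x)) < \<infinity>" using J by (auto simp: Jt_def)
  ultimately have fin: "eint ?M h < \<infinity>" by simp
  have "AE x in ?M. g (a x) = ereal (real_of_ereal (h x))"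
    using eint_finite_imp_integrable(1)[OF hm hb fin] hg
  proof eventually_elim
    case (elim x)
    then show ?case using g(1) by (cases "g (a x)") auto
  qed
  with eint_finite_imp_integrable(2)[OF hm hb fin] show ?thesis by blast
qed

text \<open>A violation leaves a gap. The lens error t is chosen to consume less than the gap, and
  this fixes c; the other error terms of the cost comparison, divided by the volume, tend to 0 with
  the radius.\<close>

lemma needle_inequality:
  fixes \<Omega> :: "(real^'n::finite) set"
  assumes \<Omega>: "open \<Omega>" "bounded \<Omega>" and \<alpha>: "\<alpha> > 0" and yd: "sqi (lebesgue_on \<Omega>) yd" and f: "sqi (lebesgue_on \<Omega>) f"
    and g: "\<forall>b. g b \<noteq> -\<infinity>" "lsc_on {\<alpha>..} g" and a: "feasible \<Omega> \<alpha> a"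
    and st: "state_eq \<Omega> f a y Gy" and ad: "adjoint_eq \<Omega> yd a y p Gp" and J: "Jt \<Omega> yd g y a < \<infinity>"
    and \<epsilon>: "\<epsilon> > 0" and opt: "\<And>ah yh Gyh. feasible \<Omega> \<alpha> ah \<Longrightarrow> L1dist \<Omega> ah a < \<epsilon> \<Longrightarrow> state_eq \<Omega> f ah yh Gyh
              \<Longrightarrow> Jt \<Omega> yd g y a \<le> Jt \<Omega> yd g yh ah"
    and r: "\<And>k. r k > 0" "r \<longlonglongrightarrow> 0" and x0: "x0 \<in> \<Omega>" "\<alpha> \<le> a x0"
    and leb: "(\<lambda>k. (\<integral>x. indicator (ball x0 (r k)) x * (norm ((a x, Gy x, Gp x) - (a x0, Gy x0, Gp x0)))\<^sup>2 \<partial>lebesgue_on \<Omega>)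
      / measure lborel (ball x0 (r k))) \<longlonglongrightarrow> 0"
    and b: "\<alpha> \<le> b" and gb: "g b = ereal gb" and L: "ereal L < g (a x0)" and n: "norm n = 1"
  shows "0 \<le> - (b - a x0) * (Gy x0 \<bullet> Gp x0) + (b - a x0)\<^sup>2 / b * ((n \<bullet> Gy x0) * (n \<bullet> Gp x0)) + gb - L"
proof (rule ccontr)
  let ?M = "lebesgue_on \<Omega>"
  let ?X = "- (b - a x0) * (Gy x0 \<bullet> Gp x0) + (b - a x0)\<^sup>2 / b * ((n \<bullet> Gy x0) * (n \<bullet> Gp x0))"
  assume "\<not> 0 \<le> ?X + gb - L"
  then have neg: "?X + gb - L < 0" by simp
  interpret finite_measure ?M by (rule open_bounded_lebesgue_on[OF \<Omega>])
  have \<Omega>L: "\<Omega> \<in> sets lebesgue" by (rule open_bounded_lebesgue_on[OF \<Omega>])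
  obtain C where am: "a \<in> borel_measurable ?M" and C: "AE x in ?M. \<bar>a x\<bar> \<le> C" and al: "AE x in ?M. \<alpha> \<le> a x"
    using a by (auto simp: feasible_def Linf_def)
  define B where "B = 1 + 1 / \<alpha> + \<bar>C\<bar> + b + norm (Gy x0) + norm (Gp x0) + a x0"
  have B: "1 \<le> B" "1 / \<alpha> \<le> B" "C \<le> B" "b \<le> B" "norm (Gy x0) \<le> B" "norm (Gp x0) \<le> B" "a x0 \<le> B"
    using \<alpha> b x0(2) norm_ge_zero[of "Gy x0"] norm_ge_zero[of "Gp x0"] divide_nonneg_nonneg[of 1 \<alpha>] unfolding B_def by linarith+
  have ab: "AE x in ?M. \<alpha> \<le> a x \<and> a x \<le> B" using C al by eventually_elim (use B(3) in auto)
  obtain K where K: "K \<ge> 0" "\<And>s. s \<in> {\<alpha>..B} \<Longrightarrow> ereal (L - K * (s - a x0)\<^sup>2) \<le> g s"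
    using lsc_on_quadratic_minorant[OF g x0(2) L] by blast
  obtain u where u: "integrable ?M u" "AE x in ?M. g (a x) = ereal (u x)"
    using finite_cost_integrable[OF \<Omega> g a J] by blast
  define Kt where "Kt = 6 * B^5 + 6 * B^7"
  define Kw where "Kw = 5 * B^2 + 8 * B^4"
  have Kt: "Kt \<ge> 0" using B(1) by (simp add: Kt_def)
  \<comment> \<open>Half the gap over Kt + 1, so that the lens error t Kt stays below the gap; the
    added 1 keeps the denominator positive.\<close>
  define t where "t = - (?X + gb - L) / (2 * (Kt + 1))"
  have t: "t > 0" using neg Kt unfolding t_def by (intro divide_pos_pos) auto
  have tK: "t * Kt < - (?X + gb - L)"
  proof -
    have "t * Kt < t * (2 * (Kt + 1))" using t Kt by (intro mult_strict_left_mono) auto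
    also have "\<dots> = - (?X + gb - L)" using Kt unfolding t_def by simp
    finally show ?thesis .
  qed
  obtain c where c: "c > 0" "\<And>x0 r. r > 0 \<Longrightarrow> \<exists>E \<psi>. E \<in> sets borel \<and> E \<subseteq> ball x0 r \<and> test_fun (ball x0 r) \<psi> \<and>
    c * measure lborel (ball x0 r) \<le> measure lborel E \<and>
    (nrm2 lborel (\<lambda>x. grad \<psi> x - indicator E x *\<^sub>R n))\<^sup>2 \<le> t\<^sup>2 * measure lborel E"
    by (rule thin_inclusion_exists[OF n, of "t\<^sup>2"]) (use t in auto)
  define D where "D x = (a x, Gy x, Gp x) - (a x0, Gy x0, Gp x0)" for x
  define A where "A k = (\<integral>x. indicator (ball x0 (r k)) x * (norm (D x))\<^sup>2 \<partial>?M) / measure lborel (ball x0 (r k))" for k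
  have Al: "A \<longlonglongrightarrow> 0" using leb unfolding A_def[abs_def] D_def .
  have Vp: "measure lborel (ball x0 (r k)) > 0" for k using r(1)[of k] by (simp add: content_ball)
  have A0: "A k \<ge> 0" for k unfolding A_def using Vp[of k] by (intro divide_nonneg_nonneg integral_nonneg_AE) auto
  obtain d where d: "d > 0" "ball x0 d \<subseteq> \<Omega>" using \<Omega>(1) x0(1) by (meson open_contains_ball)
  have Vl: "(\<lambda>k. B * measure lborel (ball x0 (r k))) \<longlonglongrightarrow> 0"
  proof -
    have "(\<lambda>k. B * (unit_ball_vol (real CARD('n)) * r k ^ CARD('n))) \<longlonglongrightarrow> B * (unit_ball_vol (real CARD('n)) * 0 ^ CARD('n))"
      by (intro tendsto_intros r)
    then show ?thesis using r(1) by (simp add: content_ball less_imp_le zero_power)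
  qed
  have "\<forall>\<^sub>F k in sequentially. r k < d \<and> A k < c \<and> B * measure lborel (ball x0 (r k)) < \<epsilon>"
    by (intro eventually_conj order_tendstoD(2)[OF r(2)] order_tendstoD(2)[OF Al] order_tendstoD(2)[OF Vl] d c \<epsilon>)
  then obtain N where N: "\<And>k. k \<ge> N \<Longrightarrow> r k < d \<and> A k < c \<and> B * measure lborel (ball x0 (r k)) < \<epsilon>"
    unfolding eventually_sequentially by blast
  \<comment> \<open>Dropping finitely many radii makes every ball lie in \<Omega>, every w at most 1
    and every perturbation close enough in L^1.\<close>
  define q where "q k = r (k + N)" for k
  have q: "q k > 0" "q k < d" "B * measure lborel (ball x0 (q k)) < \<epsilon>" for k using r(1) N[of "k + N"] by (auto simp: q_def)
  have ql: "q \<longlonglongrightarrow> 0" unfolding q_def using r(2) by (rule LIMSEQ_ignore_initial_segment)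
  have bO: "ball x0 (q k) \<subseteq> \<Omega>" for k using subset_ball[of "q k" d x0] q(2)[of k] d(2) by fastforce
  define Q where "Q k E \<psi> \<longleftrightarrow> E \<in> sets borel \<and> E \<subseteq> ball x0 (q k) \<and> test_fun (ball x0 (q k)) \<psi> \<and>
    c * measure lborel (ball x0 (q k)) \<le> measure lborel E \<and>
    (nrm2 lborel (\<lambda>x. grad \<psi> x - indicator E x *\<^sub>R n))\<^sup>2 \<le> t\<^sup>2 * measure lborel E" for k E \<psi>
  have "\<exists>E \<psi>. Q k E \<psi>" for k unfolding Q_def by (rule c(2)[OF q(1)])
  then obtain E \<psi> where EQ: "\<And>k. Q k (E k) (\<psi> k)" by metis
  have E: "E k \<in> sets borel" "E k \<subseteq> ball x0 (q k)" and \<psi>: "test_fun (ball x0 (q k)) (\<psi> k)"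
    and Ec: "c * measure lborel (ball x0 (q k)) \<le> measure lborel (E k)"
    and ET: "(nrm2 lborel (\<lambda>x. grad (\<psi> k) x - indicator (E k) x *\<^sub>R n))\<^sup>2 \<le> t\<^sup>2 * measure lborel (E k)" for k
    using EQ[of k] unfolding Q_def by auto
  have EO: "E k \<subseteq> \<Omega>" for k using E(2) bO by blast
  note \<psi>O = test_fun_mono[OF \<psi> bO]
  define \<mu> where "\<mu> k = measure lborel (E k)" for k
  have \<mu>: "\<mu> k > 0" for k
    unfolding \<mu>_def using c(1) Vp[of "k + N"] by (intro less_le_trans[OF mult_pos_pos Ec]) (simp_all only: q_def)
  define ah where "ah k x = (if x \<in> E k then b else a x)" for k x
  have ahm: "ah k \<in> borel_measurable ?M" for k
  proof -
    have "(\<lambda>x. indicator (E k) x) \<in> borel_measurable ?M"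
      by (intro borel_measurable_lebesgue_on borel_measurable_indicator) (use E in simp)
    then have "(\<lambda>x. indicator (E k) x * (b - a x) + a x) \<in> borel_measurable ?M" using am by measurable
    moreover have "(\<lambda>x. indicator (E k) x * (b - a x) + a x) = ah k" by (auto simp: ah_def indicator_def fun_eq_iff)
    ultimately show ?thesis by simp
  qed
  have ahb: "AE x in ?M. \<alpha> \<le> ah k x \<and> ah k x \<le> B" for k
    using ab by eventually_elim (use b B(4) in \<open>auto simp: ah_def\<close>)
  have "\<exists>yh Gyh. state_eq \<Omega> f (ah k) yh Gyh" for k
  proof -
    have "AE x in ?M. \<bar>ah k x\<bar> \<le> B" "AE x in ?M. \<alpha> \<le> ah k x" using ahb[of k] by (eventually_elim, use \<alpha> in auto)+
    from H10_weak_solution_exists[OF \<Omega> \<alpha> ahm this f] show ?thesis unfolding state_eq_def by blast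
  qed
  then obtain yh Gyh where sth: "\<And>k. state_eq \<Omega> f (ah k) (yh k) (Gyh k)" by metis
  have nd: "needle \<Omega> \<alpha> b B f yd a y p (yh k) Gy Gp (Gyh k) (E k)" for k
    by unfold_locales (use \<Omega> \<alpha> b B am ab E EO st ad sth[unfolded ah_def] in auto)
  have \<mu>eq: "needle.\<mu> (E k) = \<mu> k" for k unfolding needle.\<mu>_def[OF nd] \<mu>_def ..
  \<comment> \<open>The mean square of D over \<open>E k\<close> is at most A / c, because
    \<open>E k\<close> fills at least the fraction c of its ball.\<close>
  define w where "w k = sqrt (A (k + N) / c)" for k
  have w: "0 \<le> w k" "w k \<le> 1" for k using A0[of "k + N"] c(1) N[of "k + N"] by (auto simp: w_def)
  have wl: "w \<longlonglongrightarrow> 0"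
  proof -
    have "(\<lambda>k. sqrt (A (k + N) / c)) \<longlonglongrightarrow> sqrt (0 / c)"
      by (intro tendsto_intros LIMSEQ_ignore_initial_segment[OF Al]) (use c in auto)
    then show ?thesis by (simp add: w_def[abs_def])
  qed
  have Hy: "H10 \<Omega> y Gy" and Hp: "H10 \<Omega> p Gp" using st ad by (auto simp: state_eq_def adjoint_eq_def)
  have Dm: "D \<in> borel_measurable ?M"
    unfolding D_def using am sqi_measurable[OF H10D(2)[OF Hy]] sqi_measurable[OF H10D(2)[OF Hp]] by measurable
  have const: "sqi ?M (\<lambda>x. v)" for v :: "'v::euclidean_space" by (simp add: sqi_def)
  have "AE x in ?M. norm (a x) \<le> B * norm (1::real)" using ab by eventually_elim (use \<alpha> in auto)
  from sqi_bound[OF const am this] have sa: "sqi ?M a" .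
  have sD: "sqi ?M D"
  proof -
    have "(norm (D x))\<^sup>2 = (norm (a x - a x0))\<^sup>2 + ((norm (Gy x - Gy x0))\<^sup>2 + (norm (Gp x - Gp x0))\<^sup>2)" for x
      by (simp add: D_def norm_Pair)
    moreover have "integrable ?M (\<lambda>x. (norm (a x - a x0))\<^sup>2 + ((norm (Gy x - Gy x0))\<^sup>2 + (norm (Gp x - Gp x0))\<^sup>2))"
      by (intro Bochner_Integration.integrable_add sqi_integrable sqi_diff sa const H10D(2)[OF Hy] H10D(2)[OF Hp])
    ultimately show ?thesis using Dm by (simp add: sqi_def)
  qed
  have ED: "nrm2 ?M (\<lambda>x. indicator (E k) x *\<^sub>R D x) \<le> w k * sqrt (\<mu> k)" "sqi ?M (\<lambda>x. indicator (E k) x *\<^sub>R D x)" for k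
  proof -
    interpret nd: needle \<Omega> \<alpha> b B f yd a y p "yh k" Gy Gp "Gyh k" "E k" by (rule nd)
    show sE: "sqi ?M (\<lambda>x. indicator (E k) x *\<^sub>R D x)" by (rule nd.sqi_ind[OF sD])
    have bm: "(\<lambda>x. indicator (ball x0 (q k)) x :: real) \<in> borel_measurable ?M"
      by (intro borel_measurable_lebesgue_on borel_measurable_indicator) simp
    have "(nrm2 ?M (\<lambda>x. indicator (E k) x *\<^sub>R D x))\<^sup>2 \<le> (\<integral>x. indicator (ball x0 (q k)) x * (norm (D x))\<^sup>2 \<partial>?M)"
      unfolding nrm2_sq
    proof (rule integral_mono_AE[OF sqi_integrable[OF sE]])
      show "integrable ?M (\<lambda>x. indicator (ball x0 (q k)) x * (norm (D x))\<^sup>2)"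
        by (rule Bochner_Integration.integrable_bound[OF sqi_integrable[OF sD]])
          (use bm Dm in \<open>auto intro!: borel_measurable_times borel_measurable_power borel_measurable_norm split: split_indicator\<close>)
      show "AE x in ?M. (norm (indicator (E k) x *\<^sub>R D x))\<^sup>2 \<le> indicator (ball x0 (q k)) x * (norm (D x))\<^sup>2"
      proof (rule AE_I2)
        fix x
        show "(norm (indicator (E k) x *\<^sub>R D x))\<^sup>2 \<le> indicator (ball x0 (q k)) x * (norm (D x))\<^sup>2"
          using E(2)[of k] by (cases "x \<in> E k") auto
      qed
    qed
    also have "\<dots> = A (k + N) * measure lborel (ball x0 (q k))" using Vp[of "k + N"] unfolding A_def q_def by simp
    also have "\<dots> \<le> A (k + N) * (\<mu> k / c)"
      using Ec[of k] c(1) A0[of "k + N"] by (intro mult_left_mono) (auto simp: \<mu>_def field_simps)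
    also have "\<dots> = (w k * sqrt (\<mu> k))\<^sup>2" using A0[of "k + N"] c(1) \<mu>[of k] by (simp add: w_def power_mult_distrib)
    finally show "nrm2 ?M (\<lambda>x. indicator (E k) x *\<^sub>R D x) \<le> w k * sqrt (\<mu> k)"
      by (rule power2_le_imp_le) (use w(1)[of k] \<mu>[of k] in simp)
  qed
  have comp: "nrm2 ?M (\<lambda>x. indicator (E k) x *\<^sub>R P x) \<le> w k * sqrt (\<mu> k)"
    if "P \<in> borel_measurable ?M" "\<And>x. norm (P x) \<le> norm (D x)" for P :: "real^'n \<Rightarrow> 'v::euclidean_space" and k
  proof -
    interpret nd: needle \<Omega> \<alpha> b B f yd a y p "yh k" Gy Gp "Gyh k" "E k" by (rule nd)
    have "nrm2 ?M (\<lambda>x. indicator (E k) x *\<^sub>R P x) \<le> 1 * nrm2 ?M (\<lambda>x. indicator (E k) x *\<^sub>R D x)"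
      by (rule nrm2_bound[OF ED(2)]) (use that nd.indicator_measurable in \<open>auto intro!: borel_measurable_scaleR mult_left_mono\<close>)
    with ED(1)[of k] show ?thesis by simp
  qed
  have nD: "norm (a x - a x0) \<le> norm (D x)" "norm (Gy x - Gy x0) \<le> norm (D x)" "norm (Gp x - Gp x0) \<le> norm (D x)" for x
    unfolding D_def norm_Pair diff_Pair by (auto simp: real_le_rsqrt)
  have Wa: "nrm2 ?M (\<lambda>x. indicator (E k) x * (a x - a x0)) \<le> w k * sqrt (\<mu> k)" for k
    using comp[of "\<lambda>x. a x - a x0" k] am nD(1) by simp
  have Wy: "nrm2 ?M (\<lambda>x. indicator (E k) x *\<^sub>R (Gy x - Gy x0)) \<le> w k * sqrt (\<mu> k)" for k
    by (rule comp[OF _ nD(2)]) (use sqi_measurable[OF H10D(2)[OF Hy]] in simp)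
  have Wp: "nrm2 ?M (\<lambda>x. indicator (E k) x *\<^sub>R (Gp x - Gp x0)) \<le> w k * sqrt (\<mu> k)" for k
    by (rule comp[OF _ nD(3)]) (use sqi_measurable[OF H10D(2)[OF Hp]] in simp)
  have T: "nrm2 ?M (\<lambda>x. grad (\<psi> k) x - indicator (E k) x *\<^sub>R n) \<le> t * sqrt (\<mu> k)" for k
  proof -
    have fin: "emeasure lborel (E k) < \<infinity>"
      using emeasure_mono[OF E(2)[of k], of lborel] emeasure_lborel_ball_finite[of x0 "q k"] by (auto intro: le_less_trans)
    have sl: "sqi lborel (\<lambda>x. grad (\<psi> k) x - indicator (E k) x *\<^sub>R n)"
      by (rule sqi_diff[OF sqi_test_fun(2)[OF \<psi>] sqi_indicator(1)[OF _ fin]]) (use E in simp)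
    have "nrm2 lborel (\<lambda>x. grad (\<psi> k) x - indicator (E k) x *\<^sub>R n) \<le> t * sqrt (\<mu> k)"
    proof (rule power2_le_imp_le)
      show "(nrm2 lborel (\<lambda>x. grad (\<psi> k) x - indicator (E k) x *\<^sub>R n))\<^sup>2 \<le> (t * sqrt (\<mu> k))\<^sup>2"
        using ET[of k] \<mu>[of k] by (simp add: power_mult_distrib \<mu>_def)
    qed (use t \<mu>[of k] in simp)
    with sqi_lborel_imp_lebesgue_on(2)[OF \<Omega>L sl] show ?thesis by linarith
  qed
  define z where "z k = needle.z y (yh k)" for k
  define Gz where "Gz k = needle.Gz Gy (Gyh k)" for k
  note est = needle.needle_estimate[OF nd \<psi>O n B(5,6) x0(2) B(7) w less_imp_le[OF t], unfolded \<mu>eq, OF T Wa Wy Wp,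
      folded z_def Gz_def Kw_def Kt_def]
  have zx: "z k x = yh k x - y x" for k x by (simp add: z_def needle.z_def[OF nd])
  have Hz: "H10 \<Omega> (z k) (Gz k)" for k unfolding z_def Gz_def by (rule needle.H10_states(4)[OF nd])
  \<comment> \<open>Scaled so that the gradients stay bounded, \<open>Gz k\<close> being of order
    sqrt (\<mu> k).\<close>
  define Z where "Z k x = (1 / sqrt (\<mu> k)) * z k x" for k x
  have HZ: "H10 \<Omega> (Z k) (\<lambda>x. (1 / sqrt (\<mu> k)) *\<^sub>R Gz k x)" for k
    unfolding Z_def[abs_def] by (rule H10_scale[OF \<Omega>(1) Hz])
  have Zl: "(\<lambda>k. nrm2 ?M (Z k)) \<longlonglongrightarrow> 0"
  proof (rule H10_weak_null_imp_strong_null[OF \<Omega> HZ])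
    show "nrm2 ?M (\<lambda>x. (1 / sqrt (\<mu> k)) *\<^sub>R Gz k x) \<le> 3 * B^3" for k
      using est(2)[of k] \<mu>[of k] unfolding nrm2_scaleR by (simp add: field_simps)
    fix h :: "real^'n \<Rightarrow> real" assume h: "sqi ?M h"
    have "AE x in ?M. \<bar>a x\<bar> \<le> B" using ab by eventually_elim (use \<alpha> in auto)
    \<comment> \<open>The functional h is represented by the solution v of an unperturbed equation;
      testing it with \<open>Z k\<close> and applying \<open>unperturbed_bound\<close> leaves the
      norm of \<open>Gv\<close> on \<open>E k\<close>.\<close>
    from H10_weak_solution_exists[OF \<Omega> \<alpha> am this al h] obtain v Gv where v: "H10 \<Omega> v Gv"
      and veq: "\<And>v' Gv'. H10 \<Omega> v' Gv' \<Longrightarrow> (\<integral>x. a x * (Gv x \<bullet> Gv' x) \<partial>?M) = (\<integral>x. h x * v' x \<partial>?M)" by blast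
    note sv = H10D(2)[OF v]
    let ?N = "\<lambda>k. nrm2 ?M (\<lambda>x. indicator (E k) x *\<^sub>R Gv x)"
    show "(\<lambda>k. \<integral>x. h x * Z k x \<partial>?M) \<longlonglongrightarrow> 0"
    proof (rule Lim_null_comparison)
      show "\<forall>\<^sub>F k in sequentially. norm (\<integral>x. h x * Z k x \<partial>?M) \<le> (3 * B\<^sup>2 + 3 * B^4) * ?N k"
      proof (intro always_eventually allI)
        fix k
        have sq: "sqrt (\<mu> k) > 0" using \<mu> by simp
        have "(\<integral>x. h x * Z k x \<partial>?M) = (\<integral>x. (1 / sqrt (\<mu> k)) * (a x * (Gz k x \<bullet> Gv x)) \<partial>?M)"
          unfolding veq[OF HZ, symmetric] by (rule Bochner_Integration.integral_cong) (simp_all add: inner_commute)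
        also have "\<dots> = (1 / sqrt (\<mu> k)) * (\<integral>x. a x * (Gz k x \<bullet> Gv x) \<partial>?M)" by (rule integral_mult_right_zero)
        finally have "norm (\<integral>x. h x * Z k x \<partial>?M) = (1 / sqrt (\<mu> k)) * \<bar>\<integral>x. a x * (Gz k x \<bullet> Gv x) \<partial>?M\<bar>"
          using sq by (simp add: abs_mult)
        also have "\<dots> \<le> (1 / sqrt (\<mu> k)) * ((nrm2 ?M (needle.U b a Gy (E k)) + B * nrm2 ?M (Gz k)) * ?N k)"
          unfolding Gz_def by (rule mult_left_mono[OF needle.unperturbed_bound[OF nd v]]) (use sq in simp)
        also have "\<dots> \<le> (1 / sqrt (\<mu> k)) * ((3 * B\<^sup>2 * sqrt (\<mu> k) + B * (3 * B^3 * sqrt (\<mu> k))) * ?N k)"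
          by (intro mult_left_mono mult_right_mono add_mono est nrm2_nonneg) (use sq B in auto)
        also have "\<dots> = (3 * B\<^sup>2 + 3 * B^4) * ?N k" using sq by (simp add: field_simps eval_nat_numeral)
        finally show "norm (\<integral>x. h x * Z k x \<partial>?M) \<le> (3 * B\<^sup>2 + 3 * B^4) * ?N k" .
      qed
      have "(\<lambda>k. \<integral>x. (norm (indicator (E k) x *\<^sub>R Gv x))\<^sup>2 \<partial>?M) \<longlonglongrightarrow> (\<integral>x. 0 \<partial>?M)"
      proof (rule integral_dominated_convergence[where w="\<lambda>x. (norm (Gv x))\<^sup>2"])
        show "integrable ?M (\<lambda>x. (norm (Gv x))\<^sup>2)" by (rule sqi_integrable[OF sv])
        show "(\<lambda>x. (norm (indicator (E k) x *\<^sub>R Gv x))\<^sup>2) \<in> borel_measurable ?M" for k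
          using sqi_measurable[OF needle.sqi_ind[OF nd sv, of k]] by measurable
        \<comment> \<open>Every point other than x0 eventually leaves the shrinking
          inclusions.\<close>
        have "AE x in ?M. x \<notin> {x0}" by (rule AE_lebesgue_on_not_in_negligible[OF \<Omega>L]) simp
        then show "AE x in ?M. (\<lambda>k. (norm (indicator (E k) x *\<^sub>R Gv x))\<^sup>2) \<longlonglongrightarrow> 0"
        proof eventually_elim
          case (elim x)
          then have "dist x0 x > 0" by simp
          have "\<forall>\<^sub>F k in sequentially. q k < dist x0 x" by (rule order_tendstoD(2)[OF ql \<open>dist x0 x > 0\<close>])
          then have "\<forall>\<^sub>F k in sequentially. (norm (indicator (E k) x *\<^sub>R Gv x))\<^sup>2 = 0"
          proof eventually_elim
            case (elim k)
            then have "x \<notin> E k" using E(2)[of k] by auto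
            then show ?case by simp
          qed
          then show ?case by (rule tendsto_eventually)
        qed
        show "AE x in ?M. norm ((norm (indicator (E k) x *\<^sub>R Gv x))\<^sup>2) \<le> (norm (Gv x))\<^sup>2" for k
          by (rule AE_I2) (simp add: indicator_def)
      qed simp
      then have "?N \<longlonglongrightarrow> 0" by (simp add: nrm2_tendsto0_iff)
      then show "(\<lambda>k. (3 * B\<^sup>2 + 3 * B^4) * ?N k) \<longlonglongrightarrow> 0" by (rule tendsto_mult_right_zero)
    qed
  qed
  \<comment> \<open>Optimality against the coefficient changed to b on \<open>E k\<close>, divided
    by \<mu> k. The last bracket collects what vanishes in the limit; t * Kt stems from the fixed
    flatness of the lens.\<close>
  have main: "0 \<le> ?X + gb - L + t * Kt + (w k * Kw + 1/2 * (nrm2 ?M (Z k))\<^sup>2 + K * (w k)\<^sup>2)" for k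
  proof -
    interpret nd: needle \<Omega> \<alpha> b B f yd a y p "yh k" Gy Gp "Gyh k" "E k" by (rule nd)
    have \<mu>M: "measure ?M (E k) = \<mu> k" using nd.inclusion_measure(3) \<mu>eq by simp
    have iE: "integrable ?M (\<lambda>x. indicator (E k) x :: real)" "(\<integral>x. indicator (E k) x \<partial>?M) = \<mu> k"
      using nd.inclusion_measure(1,2) \<mu>M sets.sets_into_space[OF nd.inclusion_measure(1)] by (auto simp: Int_absorb1 Int_absorb2)
    have feas: "feasible \<Omega> \<alpha> (ah k)" unfolding feasible_def Linf_def
    proof (intro conjI exI)
      show "ah k \<in> borel_measurable ?M" by (rule ahm)
      show "AE x in ?M. \<bar>ah k x\<bar> \<le> B" "AE x in ?M. \<alpha> \<le> ah k x" using ahb[of k] by (eventually_elim, use \<alpha> in auto)+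
    qed
    have "L1dist \<Omega> (ah k) a \<le> (\<integral>x. B * indicator (E k) x \<partial>?M)" unfolding L1dist_def
    proof (rule integral_mono_AE)
      have le: "AE x in ?M. \<bar>ah k x - a x\<bar> \<le> B * indicator (E k) x"
        using ab by eventually_elim (use b B(4) \<alpha> in \<open>auto simp: ah_def\<close>)
      then show "AE x in ?M. \<bar>ah k x - a x\<bar> \<le> B * indicator (E k) x" .
      show i: "integrable ?M (\<lambda>x. B * indicator (E k) x)" using iE(1) by simp
      show "integrable ?M (\<lambda>x. \<bar>ah k x - a x\<bar>)"
        by (rule Bochner_Integration.integrable_bound[OF i]) (use ahm am le in \<open>auto elim: eventually_mono\<close>)
    qed
    also have "\<dots> = B * \<mu> k" using iE by simp
    also have "\<dots> \<le> B * measure lborel (ball x0 (q k))" unfolding \<mu>_def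
      using B E(1)[of k] emeasure_lborel_ball_finite[of x0 "q k"]
      by (intro mult_left_mono measure_mono_fmeasurable[OF E(2)]) (auto intro!: fmeasurableI)
    also have "\<dots> < \<epsilon>" by (rule q(3))
    finally have Jle: "Jt \<Omega> yd g y a \<le> Jt \<Omega> yd g (yh k) (ah k)" using opt[OF feas _ sth] by blast
    let ?c = "\<lambda>x. indicator (E k) x * (gb - u x)"
    have ic: "integrable ?M ?c"
      using Bochner_Integration.integrable_diff[OF integrable_mult_left[OF iE(1), of gb] integrable_real_mult_indicator[OF nd.inclusion_measure(1) u(1)]]
      by (simp add: algebra_simps)
    have "AE x in ?M. g (ah k x) = ereal (u x + ?c x)"
      using u(2) by eventually_elim (use gb in \<open>auto simp: ah_def\<close>)
    from Jle[unfolded Jt_real[OF u] Jt_real[where g=g and a="ah k", OF Bochner_Integration.integrable_add[OF u(1) ic] this]]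
    have J1: "1/2 * (\<integral>x. (y x - yd x)\<^sup>2 \<partial>?M) \<le> 1/2 * (\<integral>x. (yh k x - yd x)\<^sup>2 \<partial>?M) + (\<integral>x. ?c x \<partial>?M)"
      using u(1) ic by simp
    note sz = H10D(1)[OF Hz[of k]] and sy = sqi_diff[OF H10D(1)[OF Hy] yd]
    have "(\<integral>x. (yh k x - yd x)\<^sup>2 \<partial>?M) = (\<integral>x. (y x - yd x)\<^sup>2 + 2 * ((y x - yd x) * z k x) + (z k x)\<^sup>2 \<partial>?M)"
      by (rule Bochner_Integration.integral_cong) (simp_all add: zx power2_eq_square algebra_simps)
    also have "\<dots> = (\<integral>x. (y x - yd x)\<^sup>2 \<partial>?M) + 2 * (\<integral>x. (y x - yd x) * z k x \<partial>?M) + (nrm2 ?M (z k))\<^sup>2"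
      using sqi_integrable[OF sy] sqi_integrable[OF sz] sqi_inner_integrable[OF sy sz] by (simp add: nrm2_sq)
    also have "nrm2 ?M (z k) = sqrt (\<mu> k) * nrm2 ?M (Z k)"
    proof -
      have "z k = (\<lambda>x. sqrt (\<mu> k) *\<^sub>R Z k x)" using \<mu>[of k] by (simp add: Z_def fun_eq_iff)
      then show ?thesis using \<mu>[of k] by (metis nrm2_scaleR abs_of_nonneg real_sqrt_ge_zero less_imp_le)
    qed
    also have "(sqrt (\<mu> k) * nrm2 ?M (Z k))\<^sup>2 = \<mu> k * (nrm2 ?M (Z k))\<^sup>2" using \<mu>[of k] by (simp add: power_mult_distrib)
    finally have J2: "(\<integral>x. (yh k x - yd x)\<^sup>2 \<partial>?M) = (\<integral>x. (y x - yd x)\<^sup>2 \<partial>?M) + 2 * (\<integral>x. (y x - yd x) * z k x \<partial>?M) + \<mu> k * (nrm2 ?M (Z k))\<^sup>2" .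
    have sE: "sqi ?M (\<lambda>x. indicator (E k) x * (a x - a x0))"
      using nd.sqi_ind[OF sqi_diff[OF sa const[of "a x0"]]] by simp
    \<comment> \<open>The minorant replaces -u by -L plus a quadratic error, whose integral over
      \<open>E k\<close> is at most K (w k)^2 \<mu> k.\<close>
    have "(\<integral>x. ?c x \<partial>?M) \<le> (\<integral>x. (gb - L) * indicator (E k) x + K * (norm (indicator (E k) x * (a x - a x0)))\<^sup>2 \<partial>?M)"
    proof (rule integral_mono_AE[OF ic])
      show "integrable ?M (\<lambda>x. (gb - L) * indicator (E k) x + K * (norm (indicator (E k) x * (a x - a x0)))\<^sup>2)"
        using iE(1) sqi_integrable[OF sE] by (intro Bochner_Integration.integrable_add integrable_mult_right) auto
      show "AE x in ?M. ?c x \<le> (gb - L) * indicator (E k) x + K * (norm (indicator (E k) x * (a x - a x0)))\<^sup>2"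
        using u(2) ab
      proof eventually_elim
        case (elim x)
        then have "L - K * (a x - a x0)\<^sup>2 \<le> u x" using K(2)[of "a x"] by simp
        then show ?case by (cases "x \<in> E k") auto
      qed
    qed
    also have "\<dots> = (gb - L) * \<mu> k + K * (nrm2 ?M (\<lambda>x. indicator (E k) x * (a x - a x0)))\<^sup>2"
      unfolding nrm2_sq using iE sqi_integrable[OF sE] by simp
    also have "\<dots> \<le> (gb - L) * \<mu> k + K * (w k * sqrt (\<mu> k))\<^sup>2"
      by (intro add_left_mono mult_left_mono power_mono Wa K nrm2_nonneg)
    also have "\<dots> = \<mu> k * (gb - L + K * (w k)\<^sup>2)" using \<mu>[of k] by (simp add: power_mult_distrib algebra_simps)
    finally have J3: "(\<integral>x. ?c x \<partial>?M) \<le> \<mu> k * (gb - L + K * (w k)\<^sup>2)" .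
    have J4: "(\<integral>x. (y x - yd x) * z k x \<partial>?M) \<le> \<mu> k * ?X + \<mu> k * (w k * Kw + t * Kt)"
      using est(3)[of k] by linarith
    have "0 \<le> (\<mu> k * ?X + \<mu> k * (w k * Kw + t * Kt)) + 1/2 * (\<mu> k * (nrm2 ?M (Z k))\<^sup>2) + \<mu> k * (gb - L + K * (w k)\<^sup>2)"
      using J1 J2 J3 J4 by linarith
    also have "\<dots> = \<mu> k * (?X + gb - L + t * Kt + (w k * Kw + 1/2 * (nrm2 ?M (Z k))\<^sup>2 + K * (w k)\<^sup>2))"
      by (simp only: distrib_left right_diff_distrib mult_ac)
    finally show ?thesis using \<mu>[of k] by (simp only: zero_le_mult_iff) linarith
  qed
  have "(\<lambda>k. ?X + gb - L + t * Kt + (w k * Kw + 1/2 * (nrm2 ?M (Z k))\<^sup>2 + K * (w k)\<^sup>2))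
    \<longlonglongrightarrow> ?X + gb - L + t * Kt + (0 * Kw + 1/2 * 0\<^sup>2 + K * 0\<^sup>2)"
    by (intro tendsto_add tendsto_mult tendsto_const tendsto_power wl Zl)
  from LIMSEQ_le_const[OF this, of 0] main have "0 \<le> ?X + gb - L + t * Kt" by auto
  then show False using tK by linarith
qed

text \<open>The polarization factor of a ball is dominated by that of a slab with a suitable normal: a normal
  orthogonal to \<open>Y\<close> if \<open>Y \<bullet> P \<ge> 0\<close>, and the direction of \<open>Y\<close> otherwise or in dimension one.\<close>
lemma ball_factor_le_slab_factor:
  fixes Y P :: "real^'n::finite"
  assumes a: "a > 0" and b: "b > 0"
  shows "\<exists>n. norm n = 1 \<and> (b - a)\<^sup>2 / b * ((n \<bullet> Y) * (n \<bullet> P))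
    \<le> - (b - a) * (Y \<bullet> P) * (a * real CARD('n) / (b + a * (real CARD('n) - 1))) + (b - a) * (Y \<bullet> P)"
proof -
  let ?d = "real CARD('n)"
  have d1: "?d \<ge> 1" using zero_less_card_finite[where 'a='n] by (simp add: Suc_leI)
  define q where "q = b + a * (?d - 1)"
  have q: "q \<ge> b" "q > 0" using a b d1 by (auto simp: q_def add_pos_nonneg)
  \<comment> \<open>Since a d = q - (b - a), the factor a d / q is 1 - (b - a) / q, and the right
    side takes the shape of the slab term with 1 / q.\<close>
  have rhs: "- (b - a) * (Y \<bullet> P) * (a * ?d / q) + (b - a) * (Y \<bullet> P) = (b - a)\<^sup>2 * ((Y \<bullet> P) / q)"
  proof -
    have "a * ?d = q - (b - a)" by (simp add: q_def algebra_simps)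
    then have "a * ?d / q = 1 - (b - a) / q" using q by (simp add: diff_divide_distrib)
    then have e: "1 - a * ?d / q = (b - a) / q" by simp
    have "- (b - a) * (Y \<bullet> P) * (a * ?d / q) + (b - a) * (Y \<bullet> P) = (b - a) * (Y \<bullet> P) * (1 - a * ?d / q)"
      by (simp only: right_diff_distrib)
    then show ?thesis unfolding e by (simp add: power2_eq_square)
  qed
  have "\<exists>n. norm n = 1 \<and> (n \<bullet> Y) * (n \<bullet> P) / b \<le> (Y \<bullet> P) / q"
  proof (cases "Y \<bullet> P < 0 \<or> CARD('n) = 1 \<and> Y \<noteq> 0")
    case True
    then have Y: "Y \<noteq> 0" by auto
    define n where "n = (1 / norm Y) *\<^sub>R Y"
    have n1: "norm n = 1" using Y by (simp add: n_def)
    have nY: "(n \<bullet> Y) * (n \<bullet> P) = Y \<bullet> P"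
    proof -
      have "(n \<bullet> Y) * (n \<bullet> P) = (1 / norm Y * (norm Y)\<^sup>2) * (1 / norm Y * (Y \<bullet> P))"
        by (simp add: n_def power2_norm_eq_inner)
      then show ?thesis using Y by (simp add: power2_eq_square)
    qed
    \<comment> \<open>For a negative product q >= b gives the inequality; in dimension one q =
      b.\<close>
    have "(Y \<bullet> P) / b \<le> (Y \<bullet> P) / q"
    proof (cases "Y \<bullet> P < 0")
      case True
      then show ?thesis using q b by (simp add: divide_left_mono_neg)
    next
      case False
      then show ?thesis using True by (simp add: q_def)
    qed
    with n1 nY show ?thesis by auto
  next
    case False
    have "\<exists>n. norm n = 1 \<and> n \<bullet> Y = 0"
    proof (cases "Y = 0")
      case True
      then show ?thesis by (intro exI[of _ "axis undefined 1"]) (simp add: norm_axis_1)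
    next
      case Y: False
      then have "CARD('n) \<noteq> 1" "CARD('n) > 0" using False by auto
      then have "2 \<le> CARD('n)" by linarith
      then have "2 \<le> DIM(real^'n)" by simp
      then obtain v where "v \<noteq> 0" "orthogonal Y v" using orthogonal_to_vector_exists by blast
      then show ?thesis
        by (intro exI[of _ "(1 / norm v) *\<^sub>R v"]) (simp add: orthogonal_def inner_commute)
    qed
    with False q show ?thesis by auto
  qed
  then obtain n where n: "norm n = 1" "(n \<bullet> Y) * (n \<bullet> P) / b \<le> (Y \<bullet> P) / q" by blast
  have "(b - a)\<^sup>2 / b * ((n \<bullet> Y) * (n \<bullet> P)) = (b - a)\<^sup>2 * ((n \<bullet> Y) * (n \<bullet> P) / b)" by simp
  also have "\<dots> \<le> (b - a)\<^sup>2 * ((Y \<bullet> P) / q)" using n(2) by (rule mult_left_mono) simp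
  finally show ?thesis using n(1) rhs unfolding q_def by (intro exI[of _ n]) linarith
qed

theorem mainTheorem17:
  fixes \<Omega> :: "(real^'n::finite) set" and \<alpha> :: real
    and yd f a y p :: "real^'n \<Rightarrow> real" and Gy Gp :: "real^'n \<Rightarrow> real^'n"
    and g :: "real \<Rightarrow> ereal"
  assumes "open \<Omega>" "connected \<Omega>" "bounded \<Omega>" "\<Omega> \<noteq> {}"
    and "\<alpha> > 0"
    and "L2 \<Omega> yd" "L2 \<Omega> f"
    and "\<forall>b. g b \<noteq> -\<infinity>" "lsc_on {\<alpha>..} g"
    and "feasible \<Omega> \<alpha> a"
    and "state_eq \<Omega> f a y Gy"
    and "adjoint_eq \<Omega> yd a y p Gp"
    and "Jt \<Omega> yd g y a < \<infinity>"
    and "\<exists>\<epsilon>>0. \<forall>ah yh Gyh. feasible \<Omega> \<alpha> ah \<longrightarrow> L1dist \<Omega> ah a < \<epsilon> \<longrightarrow> state_eq \<Omega> f ah yh Gyh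
              \<longrightarrow> Jt \<Omega> yd g y a \<le> Jt \<Omega> yd g yh ah"
  shows "AE x0 in lebesgue_on \<Omega>. \<forall>b\<ge>\<alpha>.
           ereal (- (b - a x0) * (Gy x0 \<bullet> Gp x0)
                   * (a x0 * real CARD('n) / (b + a x0 * (real CARD('n) - 1))))
           + g b - g (a x0) \<ge> 0"
proof -
  let ?M = "lebesgue_on \<Omega>"
  have \<Omega>: "open \<Omega>" "bounded \<Omega>" by fact+
  have yd: "sqi ?M yd" and f: "sqi ?M f" using assms(6,7) by (simp_all add: L2_iff_sqi)
  obtain C where am: "a \<in> borel_measurable ?M" and C: "AE x in ?M. \<bar>a x\<bar> \<le> C" and al: "AE x in ?M. \<alpha> \<le> a x"
    using assms(10) by (auto simp: feasible_def Linf_def)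
  \<comment> \<open>Makes \<open>g (a x0)\<close> finite almost everywhere, so that the subtraction
    in the conclusion is one of a real number.\<close>
  obtain u where u: "AE x in ?M. g (a x) = ereal (u x)"
    using finite_cost_integrable[OF \<Omega> assms(8-10,13)] by blast
  obtain \<epsilon> where \<epsilon>: "\<epsilon> > 0" and opt: "\<And>ah yh Gyh. feasible \<Omega> \<alpha> ah \<Longrightarrow> L1dist \<Omega> ah a < \<epsilon> \<Longrightarrow> state_eq \<Omega> f ah yh Gyh
              \<Longrightarrow> Jt \<Omega> yd g y a \<le> Jt \<Omega> yd g yh ah" using assms(14) by blast
  have s: "sqi ?M Gy" "sqi ?M Gp" using assms(11,12) by (auto simp: state_eq_def adjoint_eq_def dest: H10D)
  interpret finite_measure ?M by (rule open_bounded_lebesgue_on[OF \<Omega>])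
  have sa: "sqi ?M a"
    by (rule sqi_bound[of ?M "\<lambda>x. 1::real", where K=C]) (use am C in \<open>auto simp: sqi_def\<close>)
  have "integrable ?M (\<lambda>x. (norm (a x))\<^sup>2 + ((norm (Gy x))\<^sup>2 + (norm (Gp x))\<^sup>2))"
    by (intro Bochner_Integration.integrable_add sqi_integrable sa s)
  \<comment> \<open>The three functions are combined into one so that a single sequence of radii
    serves them all. The resulting exceptional set does not involve b, hence works for every
    b.\<close>
  then have F: "sqi ?M (\<lambda>x. (a x, Gy x, Gp x))"
    using am s by (auto simp: sqi_def norm_Pair)
  obtain r where r: "\<And>k. r k > 0" "r \<longlonglongrightarrow> (0::real)" and leb: "AE x in ?M.
    (\<lambda>k. (\<integral>z. indicator (ball x (r k)) z * (norm ((a z, Gy z, Gp z) - (a x, Gy x, Gp x)))\<^sup>2 \<partial>?M) / measure lborel (ball x (r k))) \<longlonglongrightarrow> 0"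
    using lebesgue_points_along_sequence[OF \<Omega> F] by blast
  show ?thesis
    using leb al u AE_space
  proof eventually_elim
    case (elim x0)
    have x0: "x0 \<in> \<Omega>" using elim(4) by simp
    show ?case
    proof (intro allI impI)
      fix b assume b: "b \<ge> \<alpha>"
      let ?T = "- (b - a x0) * (Gy x0 \<bullet> Gp x0) * (a x0 * real CARD('n) / (b + a x0 * (real CARD('n) - 1)))"
      show "ereal ?T + g b - g (a x0) \<ge> 0"
      proof (cases "g b")
        case (real gb)
        obtain n where n: "norm n = 1" "(b - a x0)\<^sup>2 / b * ((n \<bullet> Gy x0) * (n \<bullet> Gp x0)) \<le> ?T + (b - a x0) * (Gy x0 \<bullet> Gp x0)"
          using ball_factor_le_slab_factor[of "a x0" b "Gy x0" "Gp x0"] elim(2) b assms(5) by auto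
        have "u x0 \<le> ?T + gb"
        \<comment> \<open>The minorant needs L strictly below \<open>g (a x0)\<close>; the supremum
          over such L is taken only here.\<close>
        proof (rule dense_le)
          fix L assume "L < u x0"
          then have L: "ereal L < g (a x0)" using elim(3) by simp
          have "0 \<le> - (b - a x0) * (Gy x0 \<bullet> Gp x0) + (b - a x0)\<^sup>2 / b * ((n \<bullet> Gy x0) * (n \<bullet> Gp x0)) + gb - L"
            by (rule needle_inequality[OF \<Omega> assms(5) yd f assms(8-13) \<epsilon> opt r x0 elim(2,1) b real L n(1)])
          then show "L \<le> ?T + gb" using n(2) by linarith
        qed
        then show ?thesis using elim(3) real by simp
      next
        case PInf
        then show ?thesis using elim(3) by simp
      next
        case MInf
        then show ?thesis using assms(8) by simp
      qed
    qed
  qed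
qed

end
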